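(* Let $f\in L_2(\Omega)$, $\boldsymbol G\in H(\mathrm{dDiv},\Omega;\mathbb S)$ and $g\in H^2(\Omega)$. Consider the problem: find $\boldsymbol M\in H(\mathrm{dDiv},\Omega;\mathbb S)$ such that $$\langle\!\langle \boldsymbol M,\boldsymbol N\rangle\!\rangle_{\mathrm{dDiv}}=\frac Bm\bigl(f,\ \mathrm{div\,Div}\,\boldsymbol N+q^2\boldsymbol T:\boldsymbol N\bigr)-B\,\langle \mathrm{tr}^{\mathrm{Ggrad}}(g),\boldsymbol N\rangle\qquad\forall \boldsymbol N\in H_N(\mathrm{dDiv},\Omega;\mathbb S),\tag{a}$$ $$\langle \mathrm{tr}^{\mathrm{dDiv}}(\boldsymbol M),w\rangle=\langle \mathrm{tr}^{\mathrm{dDiv}}(\boldsymbol G),w\rangle\qquad\forall w\in H^2_D(\Omega).\tag{b}$$ This problem has a unique solution $\boldsymbol M$, and $$\|\boldsymbol M\|_{\mathrm{dDiv}}\le \frac1{\sqrt m}\|f\|+2\|\boldsymbol G\|_{\mathrm{dDiv}}+\|g\|_{\mathrm{Ggrad}}.$$ Furthermore, the function $$u:=\frac1m f-\frac Bm\bigl(\mathrm{div\,Div}\,\boldsymbol M+q^2\boldsymbol T:\boldsymbol M\bigr)$$ solves the minimization problem $$u=\operatorname*{arg\,min}_{v\in V_g}\ \frac B2\int_\Omega|\nabla^2 v+q^2\boldsymbol T v|^2+\frac m2\int_\Omega v^2-\int_\Omega f v+B\,\langle \mathrm{tr}^{\mathrm{dDiv}}(\boldsymbol G),v\rangle,$$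 where $V_g:=\{v\in H^2(\Omega):\ \langle \mathrm{tr}^{\mathrm{Ggrad}}(v),\boldsymbol N\rangle=\langle \mathrm{tr}^{\mathrm{Ggrad}}(g),\boldsymbol N\rangle\ \forall \boldsymbol N\in H_N(\mathrm{dDiv},\Omega;\mathbb S)\}$, and $\boldsymbol M=\nabla^2u+q^2\boldsymbol T u$. In particular, $u\in H^2(\Omega)$, $u$ satisfies $\langle \mathrm{tr}^{\mathrm{Ggrad}}(u),\boldsymbol N\rangle=\langle \mathrm{tr}^{\mathrm{Ggrad}}(g),\boldsymbol N\rangle$ for all $\boldsymbol N\in H_N(\mathrm{dDiv},\Omega;\mathbb S)$, and $$\|u\|_{\mathrm{Ggrad}}\le\frac3{\sqrt m}\|f\|+3\|\boldsymbol G\|_{\mathrm{dDiv}}+2\|g\|_{\mathrm{Ggrad}},$$ $$\|u\|\le\frac1m\|f\|+\frac Bm\|\mathrm{div\,Div}\,\boldsymbol M+q^2\boldsymbol T:\boldsymbol M\|\le\frac1m\|f\|+\frac1{\sqrt m}\|\boldsymbol M\|_{\mathrm{dDiv}}.$$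
   Context: Setting. $d\in\{2,3\}$; $\Omega\subset\mathbb R^d$ is a simply-connected, bounded, polygonal/polyhedral Lipschitz domain with boundary $\Gamma$ and exterior unit normal $\boldsymbol n$. $\mathbb S=\{\boldsymbol A\in\mathbb R^{d\times d}:\boldsymbol A=\boldsymbol A^\top\}$ with Frobenius inner product $\boldsymbol A:\boldsymbol B=\sum_{i,j}a_{ij}b_{ij}$ and norm $|\boldsymbol A|^2=\boldsymbol A:\boldsymbol A$. The constants satisfy $m,q>0$, $0<B\le1$, and $\boldsymbol T\in L_\infty(\Omega;\mathbb S)$ is given. $(\cdot,\cdot)$ and $\|\cdot\|$ are the $L_2(\Omega)$ inner product and norm for scalar, vector or tensor functions. $\nabla^2v$ is the Hessian of $v$; $\mathrm{Div}$ is the row-wise divergence of tensors and $\mathrm{div\,Div}$ the (distributional) iterated divergence. Boundary decomposition. $\Gamma$ is the closure of the union of pairwise disjoint relatively open pieces $\Gamma_{hc},\Gamma_{ss},\Gamma_{sc},\Gamma_f$ (each empty or a union of connected sets of positive relative measure) and of the elements of $J=J_D\cup J_N$, where $J_D,J_N$ are disjoint (possibly empty) sets of pairwise disjoint vertex-singletons ($d=2$; a vertex may have angle $\pi$) or relatively open edges ($d=3$) of $\Gamma$, disjoint from the other pieces; every $\gamma\in J$ has positive distance to $\Gamma_{hc}\cup\Gamma_{ss}$. Spaces and norms. On $H^2(\Omega)$: $\|v\|_{\mathrm{Ggrad}}^2:=m\|v\|^2+B\|\nabla^2v+q^2\boldsymbol Tv\|^2$. $H(\mathrm{dDiv},\Omega;\mathbb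 S):=\{\boldsymbol M\in L_2(\Omega;\mathbb S):\mathrm{div\,Div}\,\boldsymbol M\in L_2(\Omega)\}$ with inner product $$\langle\!\langle\boldsymbol M,\boldsymbol N\rangle\!\rangle_{\mathrm{dDiv}}:=B(\boldsymbol M,\boldsymbol N)+\frac{B^2}m\bigl(\mathrm{div\,Div}\,\boldsymbol M+q^2\boldsymbol T:\boldsymbol M,\ \mathrm{div\,Div}\,\boldsymbol N+q^2\boldsymbol T:\boldsymbol N\bigr)$$ and induced norm $\|\cdot\|_{\mathrm{dDiv}}$. Traces. $\mathrm{tr}^{\mathrm{Ggrad}}:H^2(\Omega)\to H(\mathrm{dDiv},\Omega;\mathbb S)^*$ and $\mathrm{tr}^{\mathrm{dDiv}}:H(\mathrm{dDiv},\Omega;\mathbb S)\to H^2(\Omega)^*$ are defined by $$\langle\mathrm{tr}^{\mathrm{Ggrad}}(v),\boldsymbol M\rangle:=\langle\mathrm{tr}^{\mathrm{dDiv}}(\boldsymbol M),v\rangle:=(\mathrm{div\,Div}\,\boldsymbol M,v)-(\boldsymbol M,\nabla^2v).$$ $H^2_D(\Omega):=\{v\in H^2(\Omega): v|_{\Gamma_{hc}\cup\Gamma_{ss}}=0,\ \boldsymbol n\cdot\nabla v|_{\Gamma_{hc}\cup\Gamma_{sc}}=0,\ v|_\gamma=0\ \forall\gamma\in J_D\}$ and $H_N(\mathrm{dDiv},\Omega;\mathbb S):=\{\boldsymbol M\in H(\mathrm{dDiv},\Omega;\mathbb S):\langle\mathrm{tr}^{\mathrm{dDiv}}(\boldsymbol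 M),v\rangle=0\ \forall v\in H^2_D(\Omega)\}$. *)

theory Defs
  imports "HOL-Analysis.Analysis"
begin

section \<open>Square-integrable functions\<close>

text \<open>Elements of L2 spaces are represented by functions; equality in such a space is equality
  almost everywhere on \<open>\<Omega>\<close>.\<close>

definition L2_on :: "'a measure \<Rightarrow> ('a \<Rightarrow> 'b::euclidean_space) set" where
  "L2_on \<mu> = {f \<in> borel_measurable \<mu>. integrable \<mu> (\<lambda>x. (norm (f x))\<^sup>2)}"

abbreviation L2 :: "'a::euclidean_space set \<Rightarrow> ('a \<Rightarrow> 'b::euclidean_space) set" where
  "L2 \<Omega> \<equiv> L2_on (lebesgue_on \<Omega>)"

definition L2_inner ::
  "'a::euclidean_space set \<Rightarrow> ('a \<Rightarrow> 'b::euclidean_space) \<Rightarrow> ('a \<Rightarrow> 'b) \<Rightarrow> real" where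
  "L2_inner \<Omega> f g = (LINT x|lebesgue_on \<Omega>. f x \<bullet> g x)"

definition L2_norm :: "'a::euclidean_space set \<Rightarrow> ('a \<Rightarrow> 'b::euclidean_space) \<Rightarrow> real" where
  "L2_norm \<Omega> f = sqrt (L2_inner \<Omega> f f)"

text \<open>On \<^typ>\<open>real^'d^'d\<close> the library inner product is the Frobenius inner product.\<close>

lemma inner_eq_Frobenius:
  fixes A C :: "real^'d^'d"
  shows "A \<bullet> C = (\<Sum>i\<in>UNIV. \<Sum>j\<in>UNIV. A $ i $ j * C $ i $ j)"
  by (simp add: inner_vec_def)

definition sym_ae :: "(real^'d::finite) set \<Rightarrow> (real^'d \<Rightarrow> real^'d^'d) \<Rightarrow> bool" where
  "sym_ae \<Omega> M \<longleftrightarrow> (AE x in lebesgue_on \<Omega>. transpose (M x) = M x)"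

definition L2_sym :: "(real^'d::finite) set \<Rightarrow> (real^'d \<Rightarrow> real^'d^'d) set" where
  "L2_sym \<Omega> = {M \<in> L2 \<Omega>. sym_ae \<Omega> M}"

definition Linf_sym :: "(real^'d::finite) set \<Rightarrow> (real^'d \<Rightarrow> real^'d^'d) set" where
  "Linf_sym \<Omega> = {T \<in> borel_measurable (lebesgue_on \<Omega>).
     sym_ae \<Omega> T \<and> (\<exists>C. AE x in lebesgue_on \<Omega>. norm (T x) \<le> C)}"


section \<open>Smooth functions and distributions\<close>

definition partial :: "'d::finite \<Rightarrow> (real^'d \<Rightarrow> real) \<Rightarrow> real^'d \<Rightarrow> real" where
  "partial i \<phi> x = frechet_derivative \<phi> (at x) (axis i 1)"

definition smooth :: "(real^'d::finite \<Rightarrow> real) \<Rightarrow> bool" where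
  "smooth \<phi> \<longleftrightarrow> (\<forall>is x. foldr partial is \<phi> differentiable (at x))"

definition test_functions :: "(real^'d::finite) set \<Rightarrow> (real^'d \<Rightarrow> real) set" where
  "test_functions \<Omega> = {\<phi>. smooth \<phi> \<and> compact (closure {x. \<phi> x \<noteq> 0}) \<and> closure {x. \<phi> x \<noteq> 0} \<subseteq> \<Omega>}"

text \<open>Distributions are functionals on test functions; only their values on
  \<^const>\<open>test_functions\<close> are ever used.\<close>

type_synonym 'd distr = "(real^'d \<Rightarrow> real) \<Rightarrow> real"

definition distr_of :: "(real^'d::finite) set \<Rightarrow> (real^'d \<Rightarrow> real) \<Rightarrow> 'd distr" where
  "distr_of \<Omega> v = (\<lambda>\<phi>. LINT x|lebesgue_on \<Omega>. v x * \<phi> x)"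

definition dpartial :: "'d::finite \<Rightarrow> 'd distr \<Rightarrow> 'd distr" where
  "dpartial i D = (\<lambda>\<phi>. - D (partial i \<phi>))"

definition represents :: "(real^'d::finite) set \<Rightarrow> 'd distr \<Rightarrow> (real^'d \<Rightarrow> real) \<Rightarrow> bool" where
  "represents \<Omega> D w \<longleftrightarrow> w \<in> L2 \<Omega> \<and> (\<forall>\<phi>\<in>test_functions \<Omega>. D \<phi> = distr_of \<Omega> w \<phi>)"

text \<open>A representative is unique up to a null set of \<open>\<Omega>\<close>.\<close>

definition in_L2 :: "(real^'d::finite) set \<Rightarrow> 'd distr \<Rightarrow> bool" where
  "in_L2 \<Omega> D \<longleftrightarrow> (\<exists>w. represents \<Omega> D w)"

definition L2_rep :: "(real^'d::finite) set \<Rightarrow> 'd distr \<Rightarrow> real^'d \<Rightarrow> real" where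
  "L2_rep \<Omega> D = (SOME w. represents \<Omega> D w)"

definition Div_distr :: "(real^'d::finite) set \<Rightarrow> (real^'d \<Rightarrow> real^'d^'d) \<Rightarrow> 'd \<Rightarrow> 'd distr" where
  "Div_distr \<Omega> M i = (\<lambda>\<phi>. \<Sum>j\<in>UNIV. dpartial j (distr_of \<Omega> (\<lambda>x. M x $ i $ j)) \<phi>)"

definition divDiv_distr :: "(real^'d::finite) set \<Rightarrow> (real^'d \<Rightarrow> real^'d^'d) \<Rightarrow> 'd distr" where
  "divDiv_distr \<Omega> M = (\<lambda>\<phi>. \<Sum>i\<in>UNIV. dpartial i (Div_distr \<Omega> M i) \<phi>)"

definition divDiv :: "(real^'d::finite) set \<Rightarrow> (real^'d \<Rightarrow> real^'d^'d) \<Rightarrow> real^'d \<Rightarrow> real" where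
  "divDiv \<Omega> M = L2_rep \<Omega> (divDiv_distr \<Omega> M)"

definition weak_grad :: "(real^'d::finite) set \<Rightarrow> (real^'d \<Rightarrow> real) \<Rightarrow> real^'d \<Rightarrow> real^'d" where
  "weak_grad \<Omega> v x = (\<chi> i. L2_rep \<Omega> (dpartial i (distr_of \<Omega> v)) x)"

definition hessian :: "(real^'d::finite) set \<Rightarrow> (real^'d \<Rightarrow> real) \<Rightarrow> real^'d \<Rightarrow> real^'d^'d" where
  "hessian \<Omega> v x = (\<chi> i j. L2_rep \<Omega> (dpartial i (dpartial j (distr_of \<Omega> v))) x)"


section \<open>Function spaces\<close>

definition H1 :: "(real^'d::finite) set \<Rightarrow> (real^'d \<Rightarrow> real) set" where
  "H1 \<Omega> = {v \<in> L2 \<Omega>. \<forall>i. in_L2 \<Omega> (dpartial i (distr_of \<Omega> v))}"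

definition H2 :: "(real^'d::finite) set \<Rightarrow> (real^'d \<Rightarrow> real) set" where
  "H2 \<Omega> = {v \<in> H1 \<Omega>. \<forall>i j. in_L2 \<Omega> (dpartial i (dpartial j (distr_of \<Omega> v)))}"

definition H_dDiv :: "(real^'d::finite) set \<Rightarrow> (real^'d \<Rightarrow> real^'d^'d) set" where
  "H_dDiv \<Omega> = {M \<in> L2_sym \<Omega>. in_L2 \<Omega> (divDiv_distr \<Omega> M)}"

definition Ggrad_op ::
  "(real^'d::finite) set \<Rightarrow> real \<Rightarrow> (real^'d \<Rightarrow> real^'d^'d) \<Rightarrow> (real^'d \<Rightarrow> real) \<Rightarrow> real^'d \<Rightarrow> real^'d^'d"
  where "Ggrad_op \<Omega> q T v x = hessian \<Omega> v x + (q\<^sup>2 * v x) *\<^sub>R T x"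

definition dDiv_op ::
  "(real^'d::finite) set \<Rightarrow> real \<Rightarrow> (real^'d \<Rightarrow> real^'d^'d) \<Rightarrow> (real^'d \<Rightarrow> real^'d^'d) \<Rightarrow> real^'d \<Rightarrow> real"
  where "dDiv_op \<Omega> q T M x = divDiv \<Omega> M x + q\<^sup>2 * (T x \<bullet> M x)"

definition norm_Ggrad ::
  "(real^'d::finite) set \<Rightarrow> real \<Rightarrow> real \<Rightarrow> real \<Rightarrow> (real^'d \<Rightarrow> real^'d^'d) \<Rightarrow> (real^'d \<Rightarrow> real) \<Rightarrow> real"
  where "norm_Ggrad \<Omega> m q B T v =
    sqrt (m * (L2_norm \<Omega> v)\<^sup>2 + B * (L2_norm \<Omega> (Ggrad_op \<Omega> q T v))\<^sup>2)"

definition inner_dDiv ::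
  "(real^'d::finite) set \<Rightarrow> real \<Rightarrow> real \<Rightarrow> real \<Rightarrow> (real^'d \<Rightarrow> real^'d^'d) \<Rightarrow>
    (real^'d \<Rightarrow> real^'d^'d) \<Rightarrow> (real^'d \<Rightarrow> real^'d^'d) \<Rightarrow> real"
  where "inner_dDiv \<Omega> m q B T M N =
    B * L2_inner \<Omega> M N + B\<^sup>2 / m * L2_inner \<Omega> (dDiv_op \<Omega> q T M) (dDiv_op \<Omega> q T N)"

definition norm_dDiv ::
  "(real^'d::finite) set \<Rightarrow> real \<Rightarrow> real \<Rightarrow> real \<Rightarrow> (real^'d \<Rightarrow> real^'d^'d) \<Rightarrow>
    (real^'d \<Rightarrow> real^'d^'d) \<Rightarrow> real"
  where "norm_dDiv \<Omega> m q B T M = sqrt (inner_dDiv \<Omega> m q B T M M)"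

definition tr_Ggrad ::
  "(real^'d::finite) set \<Rightarrow> (real^'d \<Rightarrow> real) \<Rightarrow> (real^'d \<Rightarrow> real^'d^'d) \<Rightarrow> real" where
  "tr_Ggrad \<Omega> v M = L2_inner \<Omega> (divDiv \<Omega> M) v - L2_inner \<Omega> M (hessian \<Omega> v)"

definition tr_dDiv ::
  "(real^'d::finite) set \<Rightarrow> (real^'d \<Rightarrow> real^'d^'d) \<Rightarrow> (real^'d \<Rightarrow> real) \<Rightarrow> real" where
  "tr_dDiv \<Omega> M v = L2_inner \<Omega> (divDiv \<Omega> M) v - L2_inner \<Omega> M (hessian \<Omega> v)"


section \<open>Polyhedral Lipschitz domains and their boundary\<close>

text \<open>Around each boundary point, in the coordinate direction \<open>e\<close>, the set is the strict epigraph
  of a Lipschitz function of the component orthogonal to \<open>e\<close>.\<close>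

definition lipschitz_boundary :: "(real^'d::finite) set \<Rightarrow> bool" where
  "lipschitz_boundary \<Omega> \<longleftrightarrow> (\<forall>x\<in>frontier \<Omega>. \<exists>r>0. \<exists>e L. \<exists>h :: real^'d \<Rightarrow> real.
     norm e = 1 \<and> L-lipschitz_on UNIV h \<and>
     (\<forall>y\<in>ball x r. y \<in> \<Omega> \<longleftrightarrow> y \<bullet> e > h (y - (y \<bullet> e) *\<^sub>R e)))"

text \<open>A face-to-face subdivision of the boundary into flat convex pieces. Neighbouring pieces may
  be coplanar, so vertices of angle \<open>\<pi>\<close> are allowed.\<close>

definition face_complex :: "(real^'d::finite) set set \<Rightarrow> (real^'d) set \<Rightarrow> bool" where
  "face_complex F \<Omega> \<longleftrightarrow> finite F \<and> \<Union>F = frontier \<Omega> \<and>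
     (\<forall>p\<in>F. polytope p \<and> aff_dim p = int CARD('d) - 1) \<and>
     (\<forall>p\<in>F. \<forall>p'\<in>F. p \<inter> p' face_of p \<and> p \<inter> p' face_of p')"

definition polyhedral_lipschitz_domain :: "(real^'d::finite) set \<Rightarrow> bool" where
  "polyhedral_lipschitz_domain \<Omega> \<longleftrightarrow> open \<Omega> \<and> \<Omega> \<noteq> {} \<and> bounded \<Omega> \<and> simply_connected \<Omega> \<and>
     lipschitz_boundary \<Omega> \<and> (\<exists>F. face_complex F \<Omega>)"

text \<open>The faces of codimension two: vertex singletons if \<open>d = 2\<close>, relatively open edges if
  \<open>d = 3\<close>.\<close>

definition corner_sets :: "(real^'d::finite) set set \<Rightarrow> (real^'d) set set" where
  "corner_sets F = {rel_interior e | e p. p \<in> F \<and> e face_of p \<and> aff_dim e = int CARD('d) - 2}"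

text \<open>The s-dimensional Hausdorff outer measure, normalised to agree with Lebesgue measure on
  flat s-dimensional sets. It is a metric outer measure, so by Caratheodory's criterion its
  restriction to the Borel sets is a measure.\<close>

definition hausdorff_outer :: "nat \<Rightarrow> 'a::euclidean_space set \<Rightarrow> ennreal" where
  "hausdorff_outer s A = ennreal (unit_ball_vol (real s) / 2 ^ s) *
     (SUP \<delta>\<in>{0<..}. INF U\<in>{U :: nat \<Rightarrow> 'a set. A \<subseteq> (\<Union>k. U k) \<and>
                                 (\<forall>k. bounded (U k) \<and> diameter (U k) \<le> \<delta>)}.
        \<Sum>k. ennreal (diameter (U k) ^ s))"

definition surface_measure :: "(real^'d::finite) set \<Rightarrow> (real^'d) measure" where
  "surface_measure \<Omega> = restrict_space
     (measure_of UNIV (sets borel) (hausdorff_outer (CARD('d) - 1))) (frontier \<Omega>)"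

text \<open>On a polyhedral boundary this is defined on the interiors of the flat faces, hence almost
  everywhere with respect to \<^const>\<open>surface_measure\<close>.\<close>

definition outer_normal :: "(real^'d::finite) set \<Rightarrow> real^'d \<Rightarrow> real^'d" where
  "outer_normal \<Omega> x = (THE n. norm n = 1 \<and>
     (\<exists>r>0. \<forall>y\<in>ball x r. y \<in> \<Omega> \<longleftrightarrow> (y - x) \<bullet> n < 0))"

definition boundary_piece :: "(real^'d::finite) set \<Rightarrow> (real^'d) set \<Rightarrow> bool" where
  "boundary_piece \<Omega> S \<longleftrightarrow> openin (top_of_set (frontier \<Omega>)) S \<and>
     (\<exists>C. S = \<Union>C \<and> (\<forall>c\<in>C. connected c \<and> hausdorff_outer (CARD('d) - 1) c > 0))"

definition boundary_decomposition ::
  "(real^'d::finite) set \<Rightarrow> (real^'d) set \<Rightarrow> (real^'d) set \<Rightarrow> (real^'d) set \<Rightarrow> (real^'d) set \<Rightarrow>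
    (real^'d) set set \<Rightarrow> (real^'d) set set \<Rightarrow> bool" where
  "boundary_decomposition \<Omega> \<Gamma>hc \<Gamma>ss \<Gamma>sc \<Gamma>f JD JN \<longleftrightarrow>
     boundary_piece \<Omega> \<Gamma>hc \<and> boundary_piece \<Omega> \<Gamma>ss \<and> boundary_piece \<Omega> \<Gamma>sc \<and> boundary_piece \<Omega> \<Gamma>f \<and>
     \<Gamma>hc \<inter> \<Gamma>ss = {} \<and> \<Gamma>hc \<inter> \<Gamma>sc = {} \<and> \<Gamma>hc \<inter> \<Gamma>f = {} \<and>
     \<Gamma>ss \<inter> \<Gamma>sc = {} \<and> \<Gamma>ss \<inter> \<Gamma>f = {} \<and> \<Gamma>sc \<inter> \<Gamma>f = {} \<and>
     (\<exists>F. face_complex F \<Omega> \<and> JD \<union> JN \<subseteq> corner_sets F) \<and>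
     JD \<inter> JN = {} \<and> disjoint (JD \<union> JN) \<and>
     (\<forall>\<gamma>\<in>JD \<union> JN. \<gamma> \<inter> (\<Gamma>hc \<union> \<Gamma>ss \<union> \<Gamma>sc \<union> \<Gamma>f) = {} \<and>
        (\<exists>\<delta>>0. \<forall>x\<in>\<gamma>. \<forall>y\<in>\<Gamma>hc \<union> \<Gamma>ss. \<delta> \<le> dist x y)) \<and>
     frontier \<Omega> = closure (\<Gamma>hc \<union> \<Gamma>ss \<union> \<Gamma>sc \<union> \<Gamma>f \<union> \<Union>(JD \<union> JN))"


section \<open>Boundary conditions\<close>

text \<open>The trace of an \<open>H\<^sup>1\<close> function as the limit in \<open>L\<^sub>2(\<Gamma>)\<close> of the restrictions of smooth
  approximations.\<close>

definition has_trace :: "(real^'d::finite) set \<Rightarrow> (real^'d \<Rightarrow> real) \<Rightarrow> (real^'d \<Rightarrow> real) \<Rightarrow> bool" where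
  "has_trace \<Omega> v w \<longleftrightarrow> v \<in> H1 \<Omega> \<and> w \<in> L2_on (surface_measure \<Omega>) \<and>
     (\<exists>\<phi>. (\<forall>k::nat. smooth (\<phi> k)) \<and>
       (\<lambda>k. L2_norm \<Omega> (\<lambda>x. \<phi> k x - v x)) \<longlonglongrightarrow> 0 \<and>
       (\<lambda>k. L2_norm \<Omega> (\<lambda>x. (\<chi> i. partial i (\<phi> k) x) - weak_grad \<Omega> v x)) \<longlonglongrightarrow> 0 \<and>
       (\<lambda>k. LINT x|surface_measure \<Omega>. (\<phi> k x - w x)\<^sup>2) \<longlonglongrightarrow> 0)"

definition zero_trace_on :: "(real^'d::finite) set \<Rightarrow> (real^'d) set \<Rightarrow> (real^'d \<Rightarrow> real) \<Rightarrow> bool" where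
  "zero_trace_on \<Omega> S v \<longleftrightarrow>
     (\<exists>w. has_trace \<Omega> v w \<and> (AE x in surface_measure \<Omega>. x \<in> S \<longrightarrow> w x = 0))"

definition zero_normal_deriv_on ::
  "(real^'d::finite) set \<Rightarrow> (real^'d) set \<Rightarrow> (real^'d \<Rightarrow> real) \<Rightarrow> bool" where
  "zero_normal_deriv_on \<Omega> S v \<longleftrightarrow>
     (\<exists>w. (\<forall>i. has_trace \<Omega> (\<lambda>x. weak_grad \<Omega> v x $ i) (\<lambda>x. w x $ i)) \<and>
          (AE x in surface_measure \<Omega>. x \<in> S \<longrightarrow> outer_normal \<Omega> x \<bullet> w x = 0))"

text \<open>Vertices and edges are null sets for \<^const>\<open>surface_measure\<close>. For \<open>d \<le> 3\<close> functions in
  \<open>H\<^sup>2(\<Omega>)\<close> have a representative that is continuous up to the boundary, whose values are meant.\<close>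

definition vanishes_on :: "(real^'d::finite) set \<Rightarrow> (real^'d) set \<Rightarrow> (real^'d \<Rightarrow> real) \<Rightarrow> bool" where
  "vanishes_on \<Omega> \<gamma> v \<longleftrightarrow>
     (\<exists>w. continuous_on (closure \<Omega>) w \<and> (AE x in lebesgue_on \<Omega>. w x = v x) \<and> (\<forall>x\<in>\<gamma>. w x = 0))"

definition H2_D ::
  "(real^'d::finite) set \<Rightarrow> (real^'d) set \<Rightarrow> (real^'d) set \<Rightarrow> (real^'d) set \<Rightarrow> (real^'d) set set \<Rightarrow>
    (real^'d \<Rightarrow> real) set" where
  "H2_D \<Omega> \<Gamma>hc \<Gamma>ss \<Gamma>sc JD = {v \<in> H2 \<Omega>. zero_trace_on \<Omega> (\<Gamma>hc \<union> \<Gamma>ss) v \<and>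
     zero_normal_deriv_on \<Omega> (\<Gamma>hc \<union> \<Gamma>sc) v \<and> (\<forall>\<gamma>\<in>JD. vanishes_on \<Omega> \<gamma> v)}"

definition HN_dDiv ::
  "(real^'d::finite) set \<Rightarrow> (real^'d) set \<Rightarrow> (real^'d) set \<Rightarrow> (real^'d) set \<Rightarrow> (real^'d) set set \<Rightarrow>
    (real^'d \<Rightarrow> real^'d^'d) set" where
  "HN_dDiv \<Omega> \<Gamma>hc \<Gamma>ss \<Gamma>sc JD =
     {M \<in> H_dDiv \<Omega>. \<forall>v\<in>H2_D \<Omega> \<Gamma>hc \<Gamma>ss \<Gamma>sc JD. tr_dDiv \<Omega> M v = 0}"


section \<open>The mixed problem and the minimization problem\<close>

text \<open>\<open>HN\<close> and \<open>HD\<close> are to be instantiated with \<^const>\<open>HN_dDiv\<close> and \<^const>\<open>H2_D\<close>.\<close>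

definition mixed_solution ::
  "(real^'d::finite) set \<Rightarrow> real \<Rightarrow> real \<Rightarrow> real \<Rightarrow> (real^'d \<Rightarrow> real^'d^'d) \<Rightarrow>
    (real^'d \<Rightarrow> real^'d^'d) set \<Rightarrow> (real^'d \<Rightarrow> real) set \<Rightarrow>
    (real^'d \<Rightarrow> real) \<Rightarrow> (real^'d \<Rightarrow> real^'d^'d) \<Rightarrow> (real^'d \<Rightarrow> real) \<Rightarrow>
    (real^'d \<Rightarrow> real^'d^'d) \<Rightarrow> bool" where
  "mixed_solution \<Omega> m q B T HN HD f G g M \<longleftrightarrow> M \<in> H_dDiv \<Omega> \<and>
     (\<forall>N\<in>HN. inner_dDiv \<Omega> m q B T M N =
        B / m * L2_inner \<Omega> f (dDiv_op \<Omega> q T N) - B * tr_Ggrad \<Omega> g N) \<and>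
     (\<forall>w\<in>HD. tr_dDiv \<Omega> M w = tr_dDiv \<Omega> G w)"

definition admissible ::
  "(real^'d::finite) set \<Rightarrow> (real^'d \<Rightarrow> real^'d^'d) set \<Rightarrow> (real^'d \<Rightarrow> real) \<Rightarrow> (real^'d \<Rightarrow> real) set"
  where "admissible \<Omega> HN g = {v \<in> H2 \<Omega>. \<forall>N\<in>HN. tr_Ggrad \<Omega> v N = tr_Ggrad \<Omega> g N}"

definition energy ::
  "(real^'d::finite) set \<Rightarrow> real \<Rightarrow> real \<Rightarrow> real \<Rightarrow> (real^'d \<Rightarrow> real^'d^'d) \<Rightarrow>
    (real^'d \<Rightarrow> real) \<Rightarrow> (real^'d \<Rightarrow> real^'d^'d) \<Rightarrow> (real^'d \<Rightarrow> real) \<Rightarrow> real" where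
  "energy \<Omega> m q B T f G v =
     B / 2 * (LINT x|lebesgue_on \<Omega>. (norm (Ggrad_op \<Omega> q T v x))\<^sup>2)
     + m / 2 * (LINT x|lebesgue_on \<Omega>. (v x)\<^sup>2)
     - (LINT x|lebesgue_on \<Omega>. f x * v x)
     + B * tr_dDiv \<Omega> G v"

end

theory Submission
  imports Defs
begin

text \<open>The difference \<open>M - G\<close> of a solution and the datum lies in \<open>HN\<close>, so existence and the bound
  on \<open>M\<close> are the Riesz theorem in the Hilbert space \<open>HN\<close>: a minimizing sequence of the quadratic functional
  converges because \<open>L2\<close> is complete. Testing (a) with compactly supported smooth tensors shows that
  \<open>M - q\<^sup>2 u T\<close> is the distributional Hessian of \<open>u\<close>, and \<open>u\<close> minimizes the energy because
  the energy differs from its value at \<open>u\<close> by a positive quadratic form plus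
  \<open>B \<langle>tr (G - M), v - u\<rangle> = 0\<close>.

  That \<open>u\<close> lies in \<open>H2\<close> also requires the first derivatives to be in \<open>L2\<close>. Near every boundary point a
  Lipschitz domain admits translations along an open cone of directions \<open>\<xi>\<close>; for a test function \<open>\<phi>\<close> supported
  there, \<open>F t = \<integral> u(x) \<phi>(x - t \<xi>) dx\<close> satisfies \<open>\<bar>F\<bar> \<le> \<parallel>u\<parallel> \<parallel>\<phi>\<parallel>\<close> and
  \<open>\<bar>F''\<bar> \<le> c \<parallel>\<nabla>\<^sup>2 u\<parallel> \<parallel>\<phi>\<parallel>\<close>, and Taylor's formula bounds \<open>F' 0 = \<langle>\<partial>\<^sub>\<xi> u, \<phi>\<rangle>\<close> by a multiple of
  \<open>\<parallel>\<phi>\<parallel>\<close>. Cutoff functions and compactness of the closure make the bound global.\<close>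

section \<open>Square-integrable functions\<close>

text \<open>Elements of the spaces are functions, not classes, and \<open>L2_rep\<close> picks an
  arbitrary representative. So \<open>divDiv\<close> and \<open>hessian\<close> are linear only
  almost everywhere, and each such identity is recovered from the fundamental lemma through
  \<open>represents_unique\<close>. For the same reason \<open>L2_inner\<close> and
  \<open>ip\<close> are only semi-inner products. The Riesz argument is therefore split:
  \<open>semi_inner_minimizing_sequence\<close> works without completeness and yields a Cauchy
  sequence along which the representation holds in the limit; the limit function is built
  separately, by \<open>L2_complete\<close> or \<open>H_complete\<close>. It serves twice, for the
  mixed problem and to turn a distribution bounded in the \<open>L2\<close> norm into a function.
  The obstacle is the first derivatives of \<open>u\<close>: equation (a) yields only second ones,
  and a bound valid up to the boundary has to come from test functions that never reach it. All
  bounds are therefore by \<open>L2_norm \<Omega> \<phi>\<close> alone, without derivatives of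
  \<open>\<phi>\<close>; such bounds survive multiplication by cutoffs with values between 0 and
  1.\<close>

lemma L2_measurable: "f \<in> L2_on \<mu> \<Longrightarrow> f \<in> borel_measurable \<mu>"
  by (simp add: L2_on_def)

text \<open>The combination \<open>f + c g\<close> is the basic linear operation throughout: sums,
  differences and multiples are instances of it, and the Riesz argument is phrased with it.\<close>

lemma L2_on_lincomb:
  fixes f g :: "'a \<Rightarrow> 'b::euclidean_space"
  assumes f: "f \<in> L2_on \<mu>" and g: "g \<in> L2_on \<mu>"
  shows "(\<lambda>x. f x + c *\<^sub>R g x) \<in> L2_on \<mu>"
proof -
  have [measurable]: "f \<in> borel_measurable \<mu>" "g \<in> borel_measurable \<mu>"
    using f g by (auto simp: L2_on_def)
  have "integrable \<mu> (\<lambda>x. (norm (f x + c *\<^sub>R g x))\<^sup>2)"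
  proof (rule Bochner_Integration.integrable_bound)
    show "integrable \<mu> (\<lambda>x. 2 * (norm (f x))\<^sup>2 + (2 * c\<^sup>2) * (norm (g x))\<^sup>2)"
      using f g by (auto simp: L2_on_def)
    have "(norm (f x + c *\<^sub>R g x))\<^sup>2 \<le> 2 * (norm (f x))\<^sup>2 + (2 * c\<^sup>2) * (norm (g x))\<^sup>2" for x
    proof -
      have "(norm (f x + c *\<^sub>R g x))\<^sup>2 \<le> (norm (f x) + \<bar>c\<bar> * norm (g x))\<^sup>2"
        by (intro power_mono) (auto intro: order_trans[OF norm_triangle_ineq])
      also have "\<dots> \<le> 2 * (norm (f x))\<^sup>2 + 2 * (\<bar>c\<bar> * norm (g x))\<^sup>2"
        using sum_squares_bound[of "norm (f x)" "\<bar>c\<bar> * norm (g x)"] by (simp add: power2_sum)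
      finally show ?thesis by (simp add: power_mult_distrib)
    qed
    then show "AE x in \<mu>. norm ((norm (f x + c *\<^sub>R g x))\<^sup>2) \<le>
        norm (2 * (norm (f x))\<^sup>2 + (2 * c\<^sup>2) * (norm (g x))\<^sup>2)"
      by (intro AE_I2) (simp add: order_trans[OF _ abs_ge_self])
  qed measurable
  then show ?thesis by (simp add: L2_on_def)
qed

lemma L2_on_zero: "(\<lambda>x. 0) \<in> L2_on \<mu>"
  by (simp add: L2_on_def)

lemma L2_on_scaleR: "f \<in> L2_on \<mu> \<Longrightarrow> (\<lambda>x. c *\<^sub>R f x) \<in> L2_on \<mu>"
  using L2_on_lincomb[OF L2_on_zero, of f \<mu> c] by simp

lemma L2_on_mult: 
  fixes f :: "'a \<Rightarrow> real"
  shows "f \<in> L2_on \<mu> \<Longrightarrow> (\<lambda>x. c * f x) \<in> L2_on \<mu>"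
  using L2_on_scaleR[of f \<mu> c] by simp

lemma L2_on_add: "f \<in> L2_on \<mu> \<Longrightarrow> g \<in> L2_on \<mu> \<Longrightarrow> (\<lambda>x. f x + g x) \<in> L2_on \<mu>"
  using L2_on_lincomb[of f \<mu> g 1] by simp

lemma L2_on_diff: "f \<in> L2_on \<mu> \<Longrightarrow> g \<in> L2_on \<mu> \<Longrightarrow> (\<lambda>x. f x - g x) \<in> L2_on \<mu>"
  using L2_on_lincomb[of f \<mu> g "-1"] by simp

lemma L2_on_sum:
  assumes "finite I" "\<And>i. i \<in> I \<Longrightarrow> f i \<in> L2_on \<mu>"
  shows "(\<lambda>x. \<Sum>i\<in>I. f i x) \<in> L2_on \<mu>"
  using assms by (induction I rule: finite_induct) (auto intro: L2_on_zero L2_on_add)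

lemma L2_on_bound:
  fixes f :: "'a \<Rightarrow> 'b::euclidean_space" and g :: "'a \<Rightarrow> 'c::euclidean_space"
  assumes f: "f \<in> L2_on \<mu>" and g: "g \<in> borel_measurable \<mu>"
    and le: "AE x in \<mu>. norm (g x) \<le> C * norm (f x)"
  shows "g \<in> L2_on \<mu>"
proof -
  have [measurable]: "f \<in> borel_measurable \<mu>" "g \<in> borel_measurable \<mu>"
    using f g by (auto simp: L2_on_def)
  have "integrable \<mu> (\<lambda>x. (norm (g x))\<^sup>2)"
  proof (rule Bochner_Integration.integrable_bound)
    show "integrable \<mu> (\<lambda>x. C\<^sup>2 * (norm (f x))\<^sup>2)"
      using f by (auto simp: L2_on_def)
    show "AE x in \<mu>. norm ((norm (g x))\<^sup>2) \<le> norm (C\<^sup>2 * (norm (f x))\<^sup>2)"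
      using le
    proof eventually_elim
      case (elim x)
      then have "(norm (g x))\<^sup>2 \<le> (C * norm (f x))\<^sup>2"
        by (intro power_mono) auto
      then show ?case by (simp add: power_mult_distrib)
    qed
  qed measurable
  then show ?thesis by (simp add: L2_on_def)
qed

lemma L2_on_vec_nth:
  fixes M :: "'a \<Rightarrow> 'b::euclidean_space^'n"
  assumes "M \<in> L2_on \<mu>"
  shows "(\<lambda>x. M x $ i) \<in> L2_on \<mu>"
proof (rule L2_on_bound[OF assms, of _ 1])
  have "(\<lambda>x. x $ i) \<in> borel_measurable (borel :: ('b^'n) measure)"
    by (intro borel_measurable_continuous_onI continuous_intros)
  then show "(\<lambda>x. M x $ i) \<in> borel_measurable \<mu>"
    using L2_measurable[OF assms] by (rule measurable_compose[rotated])
qed (simp add: Finite_Cartesian_Product.norm_nth_le)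

lemma integrable_inner_L2:
  fixes f g :: "'a \<Rightarrow> 'b::euclidean_space"
  assumes f: "f \<in> L2_on \<mu>" and g: "g \<in> L2_on \<mu>"
  shows "integrable \<mu> (\<lambda>x. f x \<bullet> g x)"
proof (rule Bochner_Integration.integrable_bound)
  have [measurable]: "f \<in> borel_measurable \<mu>" "g \<in> borel_measurable \<mu>"
    using f g by (auto simp: L2_on_def)
  show "integrable \<mu> (\<lambda>x. (norm (f x))\<^sup>2 + (norm (g x))\<^sup>2)"
    using f g by (auto simp: L2_on_def)
  show "(\<lambda>x. f x \<bullet> g x) \<in> borel_measurable \<mu>" by measurable
  have "\<bar>f x \<bullet> g x\<bar> \<le> (norm (f x))\<^sup>2 + (norm (g x))\<^sup>2" for x
  proof -
    have "\<bar>f x \<bullet> g x\<bar> \<le> norm (f x) * norm (g x)" by (rule Cauchy_Schwarz_ineq2)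
    also have "\<dots> \<le> (norm (f x))\<^sup>2 + (norm (g x))\<^sup>2"
      using sum_squares_bound[of "norm (f x)" "norm (g x)"] mult_nonneg_nonneg[OF norm_ge_zero[of "f x"] norm_ge_zero[of "g x"]]
      by linarith
    finally show ?thesis .
  qed
  then show "AE x in \<mu>. norm (f x \<bullet> g x) \<le> norm ((norm (f x))\<^sup>2 + (norm (g x))\<^sup>2)"
    by (intro AE_I2) simp
qed

lemma integrable_mult_L2:
  fixes f g :: "'a \<Rightarrow> real"
  assumes "f \<in> L2_on \<mu>" "g \<in> L2_on \<mu>"
  shows "integrable \<mu> (\<lambda>x. f x * g x)"
  using integrable_inner_L2[OF assms] by simp

section \<open>Inner product, norm and Cauchy-Schwarz inequality\<close>

lemma L2_inner_commute: "L2_inner \<Omega> f g = L2_inner \<Omega> g f"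
  by (simp add: L2_inner_def inner_commute)

lemma L2_inner_lincomb_left:
  assumes "f \<in> L2 \<Omega>" "g \<in> L2 \<Omega>" "h \<in> L2 \<Omega>"
  shows "L2_inner \<Omega> (\<lambda>x. f x + c *\<^sub>R g x) h = L2_inner \<Omega> f h + c * L2_inner \<Omega> g h"
  using assms by (simp add: L2_inner_def inner_add_left integrable_inner_L2)

lemma L2_inner_lincomb_right:
  assumes "f \<in> L2 \<Omega>" "g \<in> L2 \<Omega>" "h \<in> L2 \<Omega>"
  shows "L2_inner \<Omega> h (\<lambda>x. f x + c *\<^sub>R g x) = L2_inner \<Omega> h f + c * L2_inner \<Omega> h g"
  using L2_inner_lincomb_left[OF assms] by (simp add: L2_inner_commute)

lemma L2_inner_diff_left:
  assumes "f \<in> L2 \<Omega>" "g \<in> L2 \<Omega>" "h \<in> L2 \<Omega>"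
  shows "L2_inner \<Omega> (\<lambda>x. f x - g x) h = L2_inner \<Omega> f h - L2_inner \<Omega> g h"
  using L2_inner_lincomb_left[OF assms, of "-1"] by simp

lemma L2_inner_diff_right:
  assumes "f \<in> L2 \<Omega>" "g \<in> L2 \<Omega>" "h \<in> L2 \<Omega>"
  shows "L2_inner \<Omega> h (\<lambda>x. f x - g x) = L2_inner \<Omega> h f - L2_inner \<Omega> h g"
  using L2_inner_lincomb_right[OF assms, of "-1"] by simp

lemma L2_inner_cong_AE:
  assumes "AE x in lebesgue_on \<Omega>. f x = f' x" "AE x in lebesgue_on \<Omega>. g x = g' x"
    and "f \<in> L2 \<Omega>" "f' \<in> L2 \<Omega>" "g \<in> L2 \<Omega>" "g' \<in> L2 \<Omega>"
  shows "L2_inner \<Omega> f g = L2_inner \<Omega> f' g'"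
  unfolding L2_inner_def
proof (rule integral_cong_AE)
  show "AE x in lebesgue_on \<Omega>. f x \<bullet> g x = f' x \<bullet> g' x"
    using assms(1,2) by eventually_elim simp
qed (use assms in \<open>auto dest!: L2_measurable intro: borel_measurable_inner\<close>)

lemma L2_inner_self_nonneg: "0 \<le> L2_inner \<Omega> f f"
  by (simp add: L2_inner_def)

lemma L2_norm_nonneg: "0 \<le> L2_norm \<Omega> f"
  by (simp add: L2_norm_def L2_inner_self_nonneg)

lemma L2_norm_sq: "(L2_norm \<Omega> f)\<^sup>2 = L2_inner \<Omega> f f"
  by (simp add: L2_norm_def L2_inner_self_nonneg)

lemma L2_norm_sq_integral: "(L2_norm \<Omega> f)\<^sup>2 = (LINT x|lebesgue_on \<Omega>. (norm (f x))\<^sup>2)"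
  by (simp add: L2_norm_sq L2_inner_def power2_norm_eq_inner)

text \<open>The case \<open>c = 0\<close> is included because the forms are only semidefinite.
  Besides Cauchy-Schwarz, the inequality gives the rate at which a minimizing sequence satisfies its
  Euler equation.\<close>

lemma discriminant_nonpos:
  fixes a b c :: real
  assumes pos: "\<And>t. 0 \<le> a + 2 * t * b + t\<^sup>2 * c" and c: "0 \<le> c"
  shows "b\<^sup>2 \<le> a * c"
proof (cases "c = 0")
  case True
  have "b = 0"
  proof (rule ccontr)
    assume "b \<noteq> 0"
    \<comment> \<open>Since \<open>c = 0\<close>, this value of \<open>t\<close> turns the quadratic
      into \<open>a + 2 t b = -1\<close>.\<close>
    then show False using pos[of "- (a + 1) / (2 * b)"] True by (simp add: field_simps)
  qed
  then show ?thesis using True by simp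
next
  case False
  then have "0 \<le> a * c - b\<^sup>2"
    using pos[of "- b / c"] c mult_nonneg_nonneg[of c "a + 2 * (- b / c) * b + (- b / c)\<^sup>2 * c"]
    by (simp add: field_simps power2_eq_square)
  then show ?thesis by simp
qed

lemma L2_Cauchy_Schwarz:
  assumes f: "f \<in> L2 \<Omega>" and g: "g \<in> L2 \<Omega>"
  shows "\<bar>L2_inner \<Omega> f g\<bar> \<le> L2_norm \<Omega> f * L2_norm \<Omega> g"
proof -
  have "(L2_inner \<Omega> f g)\<^sup>2 \<le> L2_inner \<Omega> f f * L2_inner \<Omega> g g"
  proof (rule discriminant_nonpos)
    fix t
    have "0 \<le> L2_inner \<Omega> (\<lambda>x. f x + t *\<^sub>R g x) (\<lambda>x. f x + t *\<^sub>R g x)"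
      by (rule L2_inner_self_nonneg)
    also have "\<dots> = L2_inner \<Omega> f f + 2 * t * L2_inner \<Omega> f g + t\<^sup>2 * L2_inner \<Omega> g g"
      using f g by (simp add: L2_inner_lincomb_left L2_inner_lincomb_right L2_on_lincomb
        L2_inner_commute[of \<Omega> g f] algebra_simps power2_eq_square)
    finally show "0 \<le> L2_inner \<Omega> f f + 2 * t * L2_inner \<Omega> f g + t\<^sup>2 * L2_inner \<Omega> g g" .
  qed (rule L2_inner_self_nonneg)
  then have "(\<bar>L2_inner \<Omega> f g\<bar>)\<^sup>2 \<le> (L2_norm \<Omega> f * L2_norm \<Omega> g)\<^sup>2"
    by (simp add: power_mult_distrib L2_norm_sq)
  then show ?thesis
    by (rule power2_le_imp_le) (simp add: L2_norm_nonneg)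
qed

lemma L2_norm_triangle:
  assumes f: "f \<in> L2 \<Omega>" and g: "g \<in> L2 \<Omega>"
  shows "L2_norm \<Omega> (\<lambda>x. f x + c *\<^sub>R g x) \<le> L2_norm \<Omega> f + \<bar>c\<bar> * L2_norm \<Omega> g"
proof (rule power2_le_imp_le)
  have "(L2_norm \<Omega> (\<lambda>x. f x + c *\<^sub>R g x))\<^sup>2 =
      L2_inner \<Omega> f f + 2 * (c * L2_inner \<Omega> f g) + c * c * L2_inner \<Omega> g g"
    unfolding L2_norm_sq using f g by (simp add: L2_inner_lincomb_left L2_inner_lincomb_right L2_on_lincomb
        L2_inner_commute[of \<Omega> g f] algebra_simps)
  also have "c * L2_inner \<Omega> f g \<le> \<bar>c\<bar> * \<bar>L2_inner \<Omega> f g\<bar>"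
    by (metis abs_ge_self abs_mult)
  also have "\<bar>c\<bar> * \<bar>L2_inner \<Omega> f g\<bar> \<le> \<bar>c\<bar> * (L2_norm \<Omega> f * L2_norm \<Omega> g)"
    by (intro mult_left_mono L2_Cauchy_Schwarz f g) auto
  finally show "(L2_norm \<Omega> (\<lambda>x. f x + c *\<^sub>R g x))\<^sup>2 \<le> (L2_norm \<Omega> f + \<bar>c\<bar> * L2_norm \<Omega> g)\<^sup>2"
    by (simp add: L2_norm_sq[symmetric] power2_eq_square algebra_simps)
qed (simp add: L2_norm_nonneg)

lemma L2_norm_scaleR: "L2_norm \<Omega> (\<lambda>x. c *\<^sub>R f x) = \<bar>c\<bar> * L2_norm \<Omega> f"
  by (simp add: L2_norm_def L2_inner_def real_sqrt_mult flip: power2_eq_square mult.assoc)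

lemma L2_norm_cong_AE:
  assumes "AE x in lebesgue_on \<Omega>. f x = f' x" "f \<in> L2 \<Omega>" "f' \<in> L2 \<Omega>"
  shows "L2_norm \<Omega> f = L2_norm \<Omega> f'"
  unfolding L2_norm_def using L2_inner_cong_AE[OF assms(1,1)] assms by simp

lemma L2_norm_zero_imp_AE:
  assumes "f \<in> L2 \<Omega>" "L2_norm \<Omega> f = 0"
  shows "AE x in lebesgue_on \<Omega>. f x = 0"
proof -
  have "(LINT x|lebesgue_on \<Omega>. (norm (f x))\<^sup>2) = 0"
    using assms(2) L2_norm_sq_integral[of \<Omega> f] by simp
  moreover have "integrable (lebesgue_on \<Omega>) (\<lambda>x. (norm (f x))\<^sup>2)"
    using assms(1) by (simp add: L2_on_def)
  ultimately show ?thesis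
    by (subst (asm) integral_nonneg_eq_0_iff_AE) auto
qed

section \<open>Completeness of L2 over sets of finite measure\<close>

lemma L2_on_finite_measure_integrable:
  fixes f :: "'a \<Rightarrow> 'b::euclidean_space"
  assumes "finite_measure \<mu>" "f \<in> L2_on \<mu>"
  shows "integrable \<mu> f"
proof (rule Bochner_Integration.integrable_bound)
  interpret finite_measure \<mu> by fact
  show "integrable \<mu> (\<lambda>x. 1 + (norm (f x))\<^sup>2)"
    using assms(2) by (auto simp: L2_on_def)
  have "norm (f x) \<le> 1 + (norm (f x))\<^sup>2" for x
    using sum_squares_bound[of 1 "norm (f x)"] norm_ge_zero[of "f x"] by (simp del: norm_ge_zero)
  then show "AE x in \<mu>. norm (f x) \<le> norm (1 + (norm (f x))\<^sup>2)" by (intro AE_I2) simp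
qed (use assms in \<open>simp add: L2_on_def\<close>)

lemma L2_const:
  fixes c :: "'b::euclidean_space"
  assumes "finite_measure \<mu>"
  shows "(\<lambda>x. c) \<in> L2_on \<mu>"
proof -
  interpret finite_measure \<mu> by fact
  show ?thesis by (simp add: L2_on_def)
qed

text \<open>On a set of finite measure the \<open>L2\<close> norm controls the \<open>L1\<close>
  norm, with factor \<open>V\<close>, the root of the measure. Hence a subsequence converges almost
  everywhere, and Fatou's lemma carries the Cauchy estimates over to the pointwise limit. The last
  conclusion keeps pointwise constraints in the limit; it later preserves the symmetry of
  tensors.\<close>

lemma L2_complete:
  fixes f :: "nat \<Rightarrow> 'a::euclidean_space \<Rightarrow> 'b::euclidean_space"
  assumes fin: "finite_measure (lebesgue_on \<Omega>)"
    and f: "\<And>n. f n \<in> L2 \<Omega>"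
    and Cauchy: "\<And>e. e > 0 \<Longrightarrow> \<exists>N. \<forall>i\<ge>N. \<forall>j\<ge>N. L2_norm \<Omega> (\<lambda>x. f i x - f j x) < e"
  obtains F where "F \<in> L2 \<Omega>" "(\<lambda>n. L2_norm \<Omega> (\<lambda>x. f n x - F x)) \<longlonglongrightarrow> 0"
    "\<forall>S. closed S \<longrightarrow> (\<forall>n. AE x in lebesgue_on \<Omega>. f n x \<in> S) \<longrightarrow> (AE x in lebesgue_on \<Omega>. F x \<in> S)"
proof -
  interpret finite_measure "lebesgue_on \<Omega>" by fact
  note [measurable] = L2_measurable[OF f]
  define V where "V = L2_norm \<Omega> (\<lambda>x. 1::real)"
  have L1: "(LINT x|lebesgue_on \<Omega>. norm (f i x - f j x)) \<le> L2_norm \<Omega> (\<lambda>x. f i x - f j x) * V" for i j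
  proof -
    have "(\<lambda>x. norm (f i x - f j x)) \<in> L2 \<Omega>"
      by (rule L2_on_bound[OF L2_on_diff[OF f f], of _ 1]) (auto simp: L2_measurable)
    from L2_Cauchy_Schwarz[OF this L2_const[OF fin, of 1]]
    show ?thesis by (simp add: L2_inner_def V_def L2_norm_def flip: power2_norm_eq_inner power2_eq_square)
  qed
  obtain r where r: "strict_mono r" "AE x in lebesgue_on \<Omega>. Cauchy (\<lambda>i. f (r i) x)"
  proof (rule cauchy_L1_AE_cauchy_subseq)
    show "integrable (lebesgue_on \<Omega>) (f n)" for n
      using L2_on_finite_measure_integrable[OF fin f] .
    fix e :: real assume "e > 0"
    have V: "V \<ge> 0" by (simp add: V_def L2_norm_nonneg)
    obtain N where N: "\<forall>i\<ge>N. \<forall>j\<ge>N. L2_norm \<Omega> (\<lambda>x. f i x - f j x) < e / (V + 1)"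
      using Cauchy[of "e / (V + 1)"] \<open>e > 0\<close> V by auto
    show "\<exists>N. \<forall>i\<ge>N. \<forall>j\<ge>N. (LINT x|lebesgue_on \<Omega>. norm (f i x - f j x)) < e"
    proof (intro exI allI impI)
      fix i j assume "i \<ge> N" "j \<ge> N"
      have "(LINT x|lebesgue_on \<Omega>. norm (f i x - f j x)) \<le> L2_norm \<Omega> (\<lambda>x. f i x - f j x) * V"
        by (rule L1)
      also have "\<dots> \<le> e / (V + 1) * V"
        using N \<open>i \<ge> N\<close> \<open>j \<ge> N\<close> V by (intro mult_right_mono) (auto intro: less_imp_le)
      also have "\<dots> < e" using V \<open>e > 0\<close> by (simp add: field_simps)
      finally show "(LINT x|lebesgue_on \<Omega>. norm (f i x - f j x)) < e" .
    qed
  qed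
  define F where "F x = lim (\<lambda>i. f (r i) x)" for x
  have [measurable]: "F \<in> borel_measurable (lebesgue_on \<Omega>)"
    unfolding F_def by measurable
  have lim: "AE x in lebesgue_on \<Omega>. (\<lambda>i. f (r i) x) \<longlonglongrightarrow> F x"
    using r(2) by eventually_elim (simp add: F_def Cauchy_convergent convergent_LIMSEQ_iff[symmetric])
  \<comment> \<open>Fatou along the subsequence \<open>r\<close> yields at once that
    \<open>f n - F\<close> is square integrable and that it inherits the bound \<open>e\<close>
    valid for all late differences.\<close>
  have fatou: "(\<lambda>x. f n x - F x) \<in> L2 \<Omega> \<and> (L2_norm \<Omega> (\<lambda>x. f n x - F x))\<^sup>2 \<le> e\<^sup>2"
    if e: "e \<ge> 0" and N: "\<And>j. j \<ge> N \<Longrightarrow> L2_norm \<Omega> (\<lambda>x. f n x - f j x) \<le> e" for n N e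
  proof -
    have nn: "(\<integral>\<^sup>+x. ennreal ((norm (f n x - f j x))\<^sup>2) \<partial>lebesgue_on \<Omega>) =
        ennreal ((L2_norm \<Omega> (\<lambda>x. f n x - f j x))\<^sup>2)" for j
      using L2_on_diff[OF f f, of n j] unfolding L2_norm_sq_integral
      by (intro nn_integral_eq_integral) (auto simp: L2_on_def)
    have "(\<integral>\<^sup>+x. ennreal ((norm (f n x - F x))\<^sup>2) \<partial>lebesgue_on \<Omega>)
        = (\<integral>\<^sup>+x. liminf (\<lambda>i. ennreal ((norm (f n x - f (r i) x))\<^sup>2)) \<partial>lebesgue_on \<Omega>)"
    proof (intro nn_integral_cong_AE)
      show "AE x in lebesgue_on \<Omega>. ennreal ((norm (f n x - F x))\<^sup>2) =
          liminf (\<lambda>i. ennreal ((norm (f n x - f (r i) x))\<^sup>2))"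
        using lim
      proof eventually_elim
        case (elim x)
        have "(\<lambda>i. ennreal ((norm (f n x - f (r i) x))\<^sup>2)) \<longlonglongrightarrow> ennreal ((norm (f n x - F x))\<^sup>2)"
          by (intro tendsto_intros elim)
        from lim_imp_Liminf[OF _ this] show ?case by simp
      qed
    qed
    also have "\<dots> \<le> liminf (\<lambda>i. \<integral>\<^sup>+x. ennreal ((norm (f n x - f (r i) x))\<^sup>2) \<partial>lebesgue_on \<Omega>)"
      by (intro nn_integral_liminf) measurable
    also have "\<dots> \<le> ennreal (e\<^sup>2)"
    proof (rule Liminf_le)
      show "\<forall>\<^sub>F i in sequentially. (\<integral>\<^sup>+x. ennreal ((norm (f n x - f (r i) x))\<^sup>2) \<partial>lebesgue_on \<Omega>) \<le> ennreal (e\<^sup>2)"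
        using eventually_ge_at_top[of N]
      proof eventually_elim
        case (elim i)
        then have "r i \<ge> N" using r(1) by (meson le_trans strict_mono_imp_increasing)
        then have "(L2_norm \<Omega> (\<lambda>x. f n x - f (r i) x))\<^sup>2 \<le> e\<^sup>2"
          using N by (intro power_mono L2_norm_nonneg) auto
        then show ?case by (simp add: nn ennreal_leI)
      qed
    qed simp
    finally have le: "(\<integral>\<^sup>+x. ennreal ((norm (f n x - F x))\<^sup>2) \<partial>lebesgue_on \<Omega>) \<le> ennreal (e\<^sup>2)" .
    then have int: "integrable (lebesgue_on \<Omega>) (\<lambda>x. (norm (f n x - F x))\<^sup>2)"
      by (intro integrableI_bounded) (auto simp: le_less_trans[OF _ ennreal_less_top])
    then have "ennreal ((L2_norm \<Omega> (\<lambda>x. f n x - F x))\<^sup>2) \<le> ennreal (e\<^sup>2)"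
      using le unfolding L2_norm_sq_integral by (subst (asm) nn_integral_eq_integral) auto
    then show ?thesis using int by (simp add: L2_on_def ennreal_le_iff)
  qed
  obtain N0 where N0: "\<forall>i\<ge>N0. \<forall>j\<ge>N0. L2_norm \<Omega> (\<lambda>x. f i x - f j x) < 1"
    using Cauchy[of 1] by auto
  \<comment> \<open>One index suffices for membership: \<open>F = f N0 - (f N0 - F)\<close>.\<close>
  have "(\<lambda>x. f N0 x - F x) \<in> L2 \<Omega>"
    using fatou[of 1 N0 N0] N0 by (auto intro: less_imp_le)
  from L2_on_diff[OF f[of N0] this] have F: "F \<in> L2 \<Omega>" by simp
  moreover have "(\<lambda>n. L2_norm \<Omega> (\<lambda>x. f n x - F x)) \<longlonglongrightarrow> 0"
  proof (rule LIMSEQ_I)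
    fix e :: real assume "e > 0"
    then obtain N where N: "\<forall>i\<ge>N. \<forall>j\<ge>N. L2_norm \<Omega> (\<lambda>x. f i x - f j x) < e / 2"
      using Cauchy[of "e/2"] by auto
    show "\<exists>N. \<forall>n\<ge>N. norm (L2_norm \<Omega> (\<lambda>x. f n x - F x) - 0) < e"
    proof (intro exI allI impI)
      fix n assume "n \<ge> N"
      have "(L2_norm \<Omega> (\<lambda>x. f n x - F x))\<^sup>2 \<le> (e/2)\<^sup>2"
        using fatou[of "e/2" N n] N \<open>n \<ge> N\<close> \<open>e > 0\<close> by (auto intro: less_imp_le)
      then have "L2_norm \<Omega> (\<lambda>x. f n x - F x) \<le> e / 2"
        using \<open>e > 0\<close> by (simp only: power2_le_imp_le divide_nonneg_pos zero_less_numeral less_imp_le)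
      then show "norm (L2_norm \<Omega> (\<lambda>x. f n x - F x) - 0) < e"
        using \<open>e > 0\<close> by (simp add: L2_norm_nonneg)
    qed
  qed
  moreover have "\<forall>S. closed S \<longrightarrow> (\<forall>n. AE x in lebesgue_on \<Omega>. f n x \<in> S) \<longrightarrow> (AE x in lebesgue_on \<Omega>. F x \<in> S)"
  proof (intro allI impI)
    fix S assume S: "closed S" "\<forall>n. AE x in lebesgue_on \<Omega>. f n x \<in> S"
    have "AE x in lebesgue_on \<Omega>. \<forall>n. f n x \<in> S" using S(2) by (simp add: AE_all_countable)
    then show "AE x in lebesgue_on \<Omega>. F x \<in> S" using lim
    proof eventually_elim
      case (elim x)
      then show ?case
        using closed_sequentially[OF S(1), of "\<lambda>i. f (r i) x" "F x"] by simp
    qed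
  qed
  ultimately show ?thesis by (rule that)
qed

lemma L2_inner_tendsto:
  assumes f: "\<And>n. f n \<in> L2 \<Omega>" "F \<in> L2 \<Omega>" and g: "g \<in> L2 \<Omega>"
    and lim: "(\<lambda>n. L2_norm \<Omega> (\<lambda>x. f n x - F x)) \<longlonglongrightarrow> 0"
  shows "(\<lambda>n. L2_inner \<Omega> (f n) g) \<longlonglongrightarrow> L2_inner \<Omega> F g"
proof -
  have "(\<lambda>n. L2_inner \<Omega> (f n) g - L2_inner \<Omega> F g) \<longlonglongrightarrow> 0"
  proof (rule Lim_null_comparison)
    show "\<forall>\<^sub>F n in sequentially. norm (L2_inner \<Omega> (f n) g - L2_inner \<Omega> F g)
        \<le> L2_norm \<Omega> (\<lambda>x. f n x - F x) * L2_norm \<Omega> g"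
      using L2_Cauchy_Schwarz[OF L2_on_diff[OF f(1) f(2)] g]
      by (simp add: L2_inner_diff_left[OF f(1) f(2) g])
    show "(\<lambda>n. L2_norm \<Omega> (\<lambda>x. f n x - F x) * L2_norm \<Omega> g) \<longlonglongrightarrow> 0"
      using tendsto_mult_left_zero[OF lim] by simp
  qed
  then show ?thesis by (simp add: LIM_zero_iff)
qed

section \<open>Smooth functions\<close>

lemma partial_eq:
  assumes "(f has_derivative f') (at x)"
  shows "partial i f x = f' (axis i 1)"
  by (simp add: partial_def frechet_derivative_at[OF assms, symmetric])

lemma smooth_differentiable: "smooth f \<Longrightarrow> f differentiable (at x)"
  using foldr.simps(1)[of partial] by (metis smooth_def id_apply)

lemma smooth_has_derivative: "smooth f \<Longrightarrow> (f has_derivative frechet_derivative f (at x)) (at x)"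
  using smooth_differentiable frechet_derivative_works by blast

lemma smooth_partial: "smooth f \<Longrightarrow> smooth (partial i f)"
  unfolding smooth_def
proof (intro allI)
  fix "is" x
  assume "\<forall>is x. foldr partial is f differentiable (at x)"
  \<comment> \<open>\<open>foldr\<close> applies the last index of the list first, so appending
    \<open>i\<close> means differentiating by \<open>i\<close> before all the others.\<close>
  then have "foldr partial (is @ [i]) f differentiable (at x)" by blast
  then show "foldr partial is (partial i f) differentiable (at x)" by simp
qed

lemma smooth_continuous_on: "smooth f \<Longrightarrow> continuous_on S f"
  by (meson continuous_at_imp_continuous_on differentiable_imp_continuous_within smooth_differentiable)

text \<open>Smoothness is the largest property that implies differentiability and is inherited by
  partial derivatives. Closure proofs thus need an invariant family of functions instead of formulas
  for iterated derivatives.\<close>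

lemma smooth_coinduct:
  assumes "S f" and "\<And>g x. S g \<Longrightarrow> g differentiable (at x)" and "\<And>g i. S g \<Longrightarrow> S (partial i g)"
  shows "smooth f"
proof -
  have "S (foldr partial is f)" for "is"
    by (induction "is") (use assms in auto)
  then show ?thesis using assms(2) by (simp add: smooth_def)
qed

text \<open>The functions \<open>t \<mapsto> p (1/t) exp (-1/t)\<close>, extended by zero to \<open>t \<le> 0\<close>, are closed under
  differentiation.\<close>

definition bump :: "real poly \<Rightarrow> real \<Rightarrow> real" where
  "bump p t = (if t \<le> 0 then 0 else poly p (inverse t) * exp (- inverse t))"

lemma bump_tendsto_0: "(bump p \<longlongrightarrow> 0) (at 0)"
proof -
  have "((\<lambda>s. poly p s * exp (- s)) \<longlongrightarrow> 0) at_top"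
  proof -
    have "((\<lambda>s. \<Sum>i\<le>degree p. coeff p i * (s ^ i / exp s)) \<longlongrightarrow> (\<Sum>i\<le>degree p. coeff p i * 0)) at_top"
      by (intro tendsto_intros tendsto_power_div_exp_0)
    moreover have "(\<Sum>i\<le>degree p. coeff p i * (s ^ i / exp s)) = poly p s * exp (- s)" for s
      by (simp add: poly_altdef sum_distrib_right exp_minus field_simps sum_divide_distrib)
    ultimately show ?thesis by simp
  qed
  from filterlim_compose[OF this filterlim_inverse_at_top_right]
  have "((\<lambda>t. poly p (inverse t) * exp (- inverse t)) \<longlongrightarrow> 0) (at_right 0)" .
  then have "(bump p \<longlongrightarrow> 0) (at_right 0)"
    by (rule Lim_transform_eventually) (auto simp: bump_def eventually_at_right_field intro!: exI[of _ 1])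
  moreover have "(bump p \<longlongrightarrow> 0) (at_left 0)"
    by (rule Lim_transform_eventually[OF tendsto_const])
      (auto simp: bump_def eventually_at_left_field intro!: exI[of _ "-1"])
  ultimately show ?thesis by (simp add: filterlim_at_split)
qed

text \<open>With \<open>s = 1/t\<close> one has \<open>d/dt = - s^2 d/ds\<close>, and
  \<open>d/ds (p exp(-s)) = (p' - p) exp(-s)\<close>. This produces the polynomial
  \<open>s^2 (p - p')\<close>.\<close>

lemma DERIV_bump:
  "(bump p has_real_derivative bump ([:0, 0, 1:] * (p - pderiv p)) t) (at t)"
proof -
  consider "t < 0" | "t = 0" | "t > 0" by linarith
  then show ?thesis
  proof cases
    case 1
    have "((\<lambda>_. 0) has_real_derivative 0) (at t)" by simp
    then have "(bump p has_real_derivative 0) (at t)"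
      by (rule has_field_derivative_transform_within_open[of _ _ _ "{..<0}"]) (use 1 in \<open>auto simp: bump_def\<close>)
    then show ?thesis using 1 by (simp add: bump_def)
  next
    case 2
    \<comment> \<open>The difference quotient at 0 is \<open>bump p h / h\<close>, which is the bump
      function of the polynomial multiplied by its variable.\<close>
    have "(bump ([:0, 1:] * p) \<longlongrightarrow> 0) (at 0)" by (rule bump_tendsto_0)
    then have "((\<lambda>h. (bump p (0 + h) - bump p 0) / h) \<longlongrightarrow> 0) (at 0)"
      by (rule Lim_transform_eventually)
        (auto simp: bump_def eventually_at_filter field_simps intro!: always_eventually)
    then show ?thesis using 2 by (simp add: DERIV_def bump_def)
  next
    case 3
    have "((\<lambda>t. poly p (inverse t) * exp (- inverse t)) has_real_derivative
        poly ([:0, 0, 1:] * (p - pderiv p)) (inverse t) * exp (- inverse t)) (at t)"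
      using 3 by (auto intro!: derivative_eq_intros simp: field_simps power2_eq_square)
    then have "(bump p has_real_derivative
        poly ([:0, 0, 1:] * (p - pderiv p)) (inverse t) * exp (- inverse t)) (at t)"
      by (rule has_field_derivative_transform_within_open[of _ _ _ "{0<..}"]) (use 3 in \<open>auto simp: bump_def\<close>)
    then show ?thesis using 3 by (simp add: bump_def)
  qed
qed

text \<open>An invariant family for \<open>smooth_coinduct\<close>. Differentiating a product, a
  reciprocal or a \<open>bump\<close> leaves the set of smooth functions built so far but not this
  closure; \<open>bump\<close> occurs with every polynomial because differentiation changes the
  polynomial.\<close>

inductive smooth_closure :: "(real^'d::finite \<Rightarrow> real) \<Rightarrow> bool" where
  base: "smooth f \<Longrightarrow> smooth_closure f"
| const: "smooth_closure (\<lambda>x. c)"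
| coord: "smooth_closure (\<lambda>x. x $ i)"
| add: "smooth_closure f \<Longrightarrow> smooth_closure g \<Longrightarrow> smooth_closure (\<lambda>x. f x + g x)"
| mult: "smooth_closure f \<Longrightarrow> smooth_closure g \<Longrightarrow> smooth_closure (\<lambda>x. f x * g x)"
| inverse: "smooth_closure f \<Longrightarrow> (\<And>x. f x \<noteq> 0) \<Longrightarrow> smooth_closure (\<lambda>x. inverse (f x))"
| bump: "smooth_closure f \<Longrightarrow> smooth_closure (\<lambda>x. bump p (f x))"

lemma smooth_closure_partial:
  fixes f :: "real^'d::finite \<Rightarrow> real"
  shows "smooth_closure f \<Longrightarrow> (\<forall>x. f differentiable (at x)) \<and> (\<forall>i. smooth_closure (partial i f))"
proof (induction rule: smooth_closure.induct)
  case (base f)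
  then show ?case by (auto intro: smooth_differentiable smooth_partial smooth_closure.base)
next
  case (const c)
  have "partial i (\<lambda>x::real^'d. c) = (\<lambda>x. 0)" for i
    by (rule ext, subst partial_eq[OF has_derivative_const]) simp
  then show ?case using smooth_closure.const[of 0] by simp
next
  case (coord j)
  have d: "((\<lambda>x. x $ j) has_derivative (\<lambda>x. x $ j)) (at x)" for x :: "real^'d"
    by (intro bounded_linear_imp_has_derivative bounded_linear_vec_nth)
  have "partial i (\<lambda>x::real^'d. x $ j) = (\<lambda>x. axis i 1 $ j)" for i
    by (rule ext, subst partial_eq[OF d]) simp
  then show ?case using d by (auto intro: smooth_closure.const simp: differentiable_def)
next
  case (add f g)
  have d: "(f has_derivative frechet_derivative f (at x)) (at x)" "(g has_derivative frechet_derivative g (at x)) (at x)" for x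
    using add by (auto simp: frechet_derivative_works)
  have "partial i (\<lambda>x. f x + g x) = (\<lambda>x. partial i f x + partial i g x)" for i
    by (rule ext, subst partial_eq[OF has_derivative_add[OF d]]) (simp add: partial_def)
  then show ?case using add by (auto intro: smooth_closure.add)
next
  case (mult f g)
  have d: "(f has_derivative frechet_derivative f (at x)) (at x)" "(g has_derivative frechet_derivative g (at x)) (at x)" for x
    using mult by (auto simp: frechet_derivative_works)
  have "partial i (\<lambda>x. f x * g x) = (\<lambda>x. f x * partial i g x + partial i f x * g x)" for i
    by (rule ext, subst partial_eq[OF has_derivative_mult[OF d]]) (simp add: partial_def)
  then show ?case using mult by (auto intro!: smooth_closure.add smooth_closure.mult)
next
  case (inverse f)
  have d: "((\<lambda>x. inverse (f x)) has_derivative (\<lambda>h. - (inverse (f x) * frechet_derivative f (at x) h * inverse (f x)))) (at x)" for x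
    by (rule Deriv.has_derivative_inverse) (use inverse in \<open>auto simp: frechet_derivative_works\<close>)
  have "partial i (\<lambda>x. inverse (f x)) = (\<lambda>x. (-1) * (inverse (f x) * partial i f x * inverse (f x)))" for i
    by (rule ext, subst partial_eq[OF d]) (simp add: partial_def)
  moreover have "smooth_closure (\<lambda>x. (-1) * (inverse (f x) * partial i f x * inverse (f x)))" for i
    by (intro smooth_closure.mult smooth_closure.const smooth_closure.inverse) (use inverse in auto)
  ultimately show ?case using d by (auto simp: differentiable_def)
next
  case (bump f p)
  have "((\<lambda>x. bump p (f x)) has_derivative (\<lambda>h. frechet_derivative f (at x) h * bump ([:0, 0, 1:] * (p - pderiv p)) (f x))) (at x)" for x
    by (rule DERIV_compose_FDERIV[OF DERIV_bump]) (use bump in \<open>auto simp: frechet_derivative_works\<close>)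
  note d = this
  have "partial i (\<lambda>x. bump p (f x)) = (\<lambda>x. partial i f x * bump ([:0, 0, 1:] * (p - pderiv p)) (f x))" for i
    by (rule ext, subst partial_eq[OF d]) (simp add: partial_def)
  moreover have "smooth_closure (\<lambda>x. partial i f x * bump ([:0, 0, 1:] * (p - pderiv p)) (f x))" for i
    by (intro smooth_closure.mult smooth_closure.bump) (use bump in auto)
  ultimately show ?case using d by (auto simp: differentiable_def)
qed

lemma smooth_closure_imp_smooth: "smooth_closure f \<Longrightarrow> smooth f"
  by (rule smooth_coinduct[of smooth_closure]) (auto simp: smooth_closure_partial)

lemma smooth_const: "smooth (\<lambda>x. c)"
  and smooth_coord: "smooth (\<lambda>x. x $ i)"
  by (auto intro!: smooth_closure_imp_smooth smooth_closure.intros)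

lemma smooth_add: "smooth f \<Longrightarrow> smooth g \<Longrightarrow> smooth (\<lambda>x. f x + g x)"
  and smooth_mult: "smooth f \<Longrightarrow> smooth g \<Longrightarrow> smooth (\<lambda>x. f x * g x)"
  and smooth_inverse: "smooth f \<Longrightarrow> (\<And>x. f x \<noteq> 0) \<Longrightarrow> smooth (\<lambda>x. inverse (f x))"
  and smooth_bump: "smooth f \<Longrightarrow> smooth (\<lambda>x. bump p (f x))"
  by (auto intro!: smooth_closure_imp_smooth intro: smooth_closure.intros)

lemma smooth_diff: "smooth f \<Longrightarrow> smooth g \<Longrightarrow> smooth (\<lambda>x. f x - g x)"
  using smooth_add[OF _ smooth_mult[OF smooth_const[of "-1"]], of f g] by simp

lemma smooth_sum: "finite I \<Longrightarrow> (\<And>i. i \<in> I \<Longrightarrow> smooth (f i)) \<Longrightarrow> smooth (\<lambda>x. \<Sum>i\<in>I. f i x)"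
  by (induction I rule: finite_induct) (auto intro: smooth_const smooth_add)

lemma smooth_prod: "finite I \<Longrightarrow> (\<And>i. i \<in> I \<Longrightarrow> smooth (f i)) \<Longrightarrow> smooth (\<lambda>x. \<Prod>i\<in>I. f i x)"
  by (induction I rule: finite_induct) (auto intro: smooth_const smooth_mult)

lemma partial_lincomb:
  assumes "smooth f" "smooth g"
  shows "partial i (\<lambda>x. f x + c * g x) = (\<lambda>x. partial i f x + c * partial i g x)"
proof
  fix x
  have "((\<lambda>x. f x + c * g x) has_derivative
      (\<lambda>h. frechet_derivative f (at x) h + c * frechet_derivative g (at x) h)) (at x)"
    by (intro derivative_intros smooth_has_derivative assms)
  then show "partial i (\<lambda>x. f x + c * g x) x = partial i f x + c * partial i g x"
    by (simp add: partial_eq) (simp add: partial_def)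
qed

lemma has_derivative_translate:
  assumes "smooth f"
  shows "((\<lambda>x. f (x - a)) has_derivative frechet_derivative f (at (x - a))) (at x)"
  by (rule has_derivative_compose[of "\<lambda>x. x - a" "\<lambda>h. h", OF _ smooth_has_derivative[OF assms]])
    (auto intro!: derivative_eq_intros)

lemma partial_translate:
  assumes "smooth f"
  shows "partial i (\<lambda>x. f (x - a)) = (\<lambda>x. partial i f (x - a))"
  by (rule ext, subst partial_eq[OF has_derivative_translate[OF assms]]) (simp add: partial_def)

lemma smooth_translate:
  assumes "smooth f" shows "smooth (\<lambda>x. f (x - a))"
proof (rule smooth_coinduct[of "\<lambda>h. \<exists>f. smooth f \<and> h = (\<lambda>x. f (x - a))"])
  show "\<exists>f'. smooth f' \<and> (\<lambda>x. f (x - a)) = (\<lambda>x. f' (x - a))" using assms by blast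
  show "g differentiable (at x)" if "\<exists>f. smooth f \<and> g = (\<lambda>x. f (x - a))" for g x
    using that has_derivative_translate differentiable_def by blast
  show "\<exists>f. smooth f \<and> partial i g = (\<lambda>x. f (x - a))" if "\<exists>f. smooth f \<and> g = (\<lambda>x. f (x - a))" for g i
    using that partial_translate smooth_partial by blast
qed

section \<open>Directional derivatives and symmetry of second derivatives\<close>

lemma frechet_derivative_eq_partials:
  assumes "smooth f"
  shows "frechet_derivative f (at x) \<xi> = (\<Sum>i\<in>UNIV. \<xi> $ i * partial i f x)"
proof -
  have lin: "linear (frechet_derivative f (at x))"
    using smooth_has_derivative[OF assms] has_derivative_linear by blast
  have "frechet_derivative f (at x) \<xi> = frechet_derivative f (at x) (\<Sum>i\<in>UNIV. \<xi> $ i *\<^sub>R axis i 1)"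
    using basis_expansion[of \<xi>] by (simp add: scalar_mult_eq_scaleR)
  then show ?thesis by (simp add: linear_sum[OF lin] linear_cmul[OF lin] partial_def)
qed

lemma smooth_line_derivative:
  assumes "smooth f"
  shows "((\<lambda>t. f (y + t *\<^sub>R \<xi>)) has_real_derivative (\<Sum>i\<in>UNIV. \<xi> $ i * partial i f (y + t *\<^sub>R \<xi>))) (at t)"
proof -
  have "((\<lambda>t. f (y + t *\<^sub>R \<xi>)) has_derivative (\<lambda>s. frechet_derivative f (at (y + t *\<^sub>R \<xi>)) (s *\<^sub>R \<xi>))) (at t)"
    by (rule has_derivative_compose[of "\<lambda>t. y + t *\<^sub>R \<xi>" "\<lambda>s. s *\<^sub>R \<xi>", OF _ smooth_has_derivative[OF assms]])
      (auto intro!: derivative_eq_intros)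
  then show ?thesis
    by (rule has_derivative_imp_has_field_derivative)
      (simp add: frechet_derivative_eq_partials[OF assms] sum_distrib_left mult_ac)
qed

lemma partial_line_derivative:
  assumes "smooth f"
  shows "((\<lambda>t. f (y + t *\<^sub>R axis i 1)) has_real_derivative partial i f (y + t *\<^sub>R axis i 1)) (at t)"
  using smooth_line_derivative[OF assms, of y "axis i 1" t]
  by (simp add: axis_def if_distrib[of "\<lambda>x. x * _"] cong: if_cong)

text \<open>The mean value theorem is applied first in direction \<open>i\<close> and then in
  direction \<open>j\<close>. The left-hand side is symmetric in \<open>i\<close> and
  \<open>j\<close>, while the order of the derivatives on the right is not.\<close>

lemma mixed_difference:
  fixes f :: "real^'d::finite \<Rightarrow> real"
  assumes "smooth f" "h > 0"
  defines "e k \<equiv> axis k 1 :: real^'d"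
  obtains s t where "0 < s" "s < h" "0 < t" "t < h"
    "f (x + h *\<^sub>R e i + h *\<^sub>R e j) - f (x + h *\<^sub>R e i) - f (x + h *\<^sub>R e j) + f x
      = h * h * partial j (partial i f) (x + s *\<^sub>R e i + t *\<^sub>R e j)"
proof -
  let ?g = "\<lambda>s. f (x + h *\<^sub>R e j + s *\<^sub>R e i) - f (x + s *\<^sub>R e i)"
  have "(?g has_real_derivative partial i f (x + h *\<^sub>R e j + s *\<^sub>R e i) - partial i f (x + s *\<^sub>R e i)) (at s)" for s
    unfolding e_def by (intro derivative_intros partial_line_derivative assms)
  from MVT2[OF assms(2) this] obtain s where s: "0 < s" "s < h"
    "?g h - ?g 0 = h * (partial i f (x + h *\<^sub>R e j + s *\<^sub>R e i) - partial i f (x + s *\<^sub>R e i))" by auto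
  have "((\<lambda>t. partial i f (x + s *\<^sub>R e i + t *\<^sub>R e j)) has_real_derivative
      partial j (partial i f) (x + s *\<^sub>R e i + t *\<^sub>R e j)) (at t)" for t
    unfolding e_def by (intro partial_line_derivative smooth_partial assms)
  from MVT2[OF assms(2) this] obtain t where t: "0 < t" "t < h"
    "partial i f (x + s *\<^sub>R e i + h *\<^sub>R e j) - partial i f (x + s *\<^sub>R e i)
       = h * partial j (partial i f) (x + s *\<^sub>R e i + t *\<^sub>R e j)" by auto
  show ?thesis
    by (rule that[OF s(1,2) t(1,2)]) (use s(3) t(3) in \<open>simp add: algebra_simps\<close>)
qed

text \<open>Both mixed derivatives equal the same second difference divided by \<open>h^2\<close>,
  taken at points within \<open>2 h\<close> of \<open>x\<close>; as \<open>h\<close> tends to 0,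
  their continuity gives equality at \<open>x\<close>.\<close>

lemma partial_commute:
  fixes f :: "real^'d::finite \<Rightarrow> real"
  assumes "smooth f"
  shows "partial i (partial j f) = partial j (partial i f)"
proof
  fix x :: "real^'d"
  let ?e = "\<lambda>k. axis k 1 :: real^'d"
  have "\<exists>p q. dist p x \<le> 2 * inverse (real (Suc n)) \<and> dist q x \<le> 2 * inverse (real (Suc n)) \<and>
      partial i (partial j f) p = partial j (partial i f) q" for n
  proof -
    define h where "h = inverse (real (Suc n))"
    have h: "h > 0" by (simp add: h_def)
    obtain s t where st: "0 < s" "s < h" "0 < t" "t < h"
      "f (x + h *\<^sub>R ?e i + h *\<^sub>R ?e j) - f (x + h *\<^sub>R ?e i) - f (x + h *\<^sub>R ?e j) + f x
      = h * h * partial j (partial i f) (x + s *\<^sub>R ?e i + t *\<^sub>R ?e j)"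
      using mixed_difference[OF assms h, of x i j] by blast
    obtain s' t' where st': "0 < s'" "s' < h" "0 < t'" "t' < h"
      "f (x + h *\<^sub>R ?e j + h *\<^sub>R ?e i) - f (x + h *\<^sub>R ?e j) - f (x + h *\<^sub>R ?e i) + f x
      = h * h * partial i (partial j f) (x + s' *\<^sub>R ?e j + t' *\<^sub>R ?e i)"
      using mixed_difference[OF assms h, of x j i] by blast
    have "partial i (partial j f) (x + s' *\<^sub>R ?e j + t' *\<^sub>R ?e i) = partial j (partial i f) (x + s *\<^sub>R ?e i + t *\<^sub>R ?e j)"
      using st(5) st'(5) h by (simp add: algebra_simps)
    moreover have "dist (x + a *\<^sub>R ?e k + b *\<^sub>R ?e l) x \<le> 2 * h" if "0 < a" "a < h" "0 < b" "b < h" for a b k l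
    proof -
      have "norm (a *\<^sub>R ?e k + b *\<^sub>R ?e l) \<le> norm (a *\<^sub>R ?e k) + norm (b *\<^sub>R ?e l)" by (rule norm_triangle_ineq)
      also have "\<dots> \<le> 2 * h" using that by simp
      finally show ?thesis by (simp add: dist_norm algebra_simps)
    qed
    ultimately show ?thesis using st st' unfolding h_def by blast
  qed
  then obtain p q where pq: "\<And>n. dist (p n) x \<le> 2 * inverse (real (Suc n))" "\<And>n. dist (q n) x \<le> 2 * inverse (real (Suc n))"
      "\<And>n. partial i (partial j f) (p n) = partial j (partial i f) (q n)"
    by metis
  have 0: "(\<lambda>n. 2 * inverse (real (Suc n))) \<longlonglongrightarrow> 0"
    using tendsto_mult_right_zero[OF LIMSEQ_inverse_real_of_nat, of 2] by simp
  have "p \<longlonglongrightarrow> x" "q \<longlonglongrightarrow> x"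
    by (subst tendsto_dist_iff, rule tendsto_sandwich[OF _ _ tendsto_const 0], use pq in simp_all)+
  moreover have "isCont (partial i (partial j f)) x" "isCont (partial j (partial i f)) x"
    using differentiable_imp_continuous_within[OF smooth_differentiable[OF smooth_partial[OF smooth_partial[OF assms]]]] by blast+
  ultimately have "(\<lambda>n. partial i (partial j f) (p n)) \<longlonglongrightarrow> partial i (partial j f) x"
    "(\<lambda>n. partial j (partial i f) (q n)) \<longlonglongrightarrow> partial j (partial i f) x"
    by (auto intro: isCont_tendsto_compose)
  then show "partial i (partial j f) x = partial j (partial i f) x"
    using pq(3) LIMSEQ_unique by (metis (no_types, lifting) ext)
qed

section \<open>Cutoff functions\<close>

lemma smooth_square_dist: "smooth (\<lambda>x. (dist a x)\<^sup>2)"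
proof -
  have "(\<lambda>x. (dist a x)\<^sup>2) = (\<lambda>x. \<Sum>i\<in>UNIV. (x $ i - a $ i) * (x $ i - a $ i))"
    by (rule ext) (simp add: dist_norm norm_minus_commute[of a] power2_norm_eq_inner inner_vec_def)
  then show ?thesis
    by (auto intro!: smooth_sum smooth_mult smooth_diff smooth_coord smooth_const)
qed

lemma bump_1_nonneg: "0 \<le> bump 1 t" and bump_1_le: "bump 1 t \<le> 1" and bump_1_pos_iff: "0 < bump 1 t \<longleftrightarrow> 0 < t"
  by (auto simp: bump_def)

text \<open>\<open>u\<close> vanishes outside the large ball and \<open>v\<close> inside the small
  one, and they have no common zero because \<open>r < R\<close>; so \<open>u / (u + v)\<close> is
  defined everywhere. Squared distances are used because the distance is not smooth at
  \<open>a\<close>.\<close>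

lemma ball_cutoff:
  fixes a :: "real^'d::finite"
  assumes "0 < r" "r < R"
  obtains \<psi> where "smooth \<psi>" "\<And>x. 0 \<le> \<psi> x \<and> \<psi> x \<le> 1" "\<And>x. x \<in> cball a r \<Longrightarrow> \<psi> x = 1"
    "\<And>x. x \<notin> ball a R \<Longrightarrow> \<psi> x = 0"
proof -
  define u v where "u x = bump 1 (R\<^sup>2 - (dist a x)\<^sup>2)" and "v x = bump 1 ((dist a x)\<^sup>2 - r\<^sup>2)" for x
  have rR: "r\<^sup>2 < R\<^sup>2" using assms by (intro power_strict_mono) auto
  have uv: "0 < u x + v x" "0 \<le> u x" "0 \<le> v x" for x
  proof -
    have "0 < R\<^sup>2 - (dist a x)\<^sup>2 \<or> 0 < (dist a x)\<^sup>2 - r\<^sup>2" using rR by linarith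
    then show "0 < u x + v x" "0 \<le> u x" "0 \<le> v x"
      unfolding u_def v_def using bump_1_nonneg bump_1_pos_iff by (metis add_nonneg_pos add_pos_nonneg)+
  qed
  show ?thesis
  proof (rule that[of "\<lambda>x. u x * inverse (u x + v x)"])
    show "smooth (\<lambda>x. u x * inverse (u x + v x))"
      using uv(1) unfolding u_def v_def
      by (intro smooth_mult smooth_inverse smooth_add smooth_bump smooth_diff smooth_const smooth_square_dist)
        (metis less_irrefl)
    show "0 \<le> u x * inverse (u x + v x) \<and> u x * inverse (u x + v x) \<le> 1" for x
      using uv[of x] by (simp add: field_simps)
    show "u x * inverse (u x + v x) = 1" if "x \<in> cball a r" for x
    proof -
      have "(dist a x)\<^sup>2 \<le> r\<^sup>2" using that assms by (intro power_mono) auto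
      then have "v x = 0" by (simp add: v_def bump_def)
      then show ?thesis using uv[of x] by simp
    qed
    show "u x * inverse (u x + v x) = 0" if "x \<notin> ball a R" for x
    proof -
      have "R\<^sup>2 \<le> (dist a x)\<^sup>2" using that assms by (intro power_mono) auto
      then show ?thesis by (simp add: u_def bump_def)
    qed
  qed
qed

text \<open>For \<open>t > 0\<close>, \<open>bump 1 (k t) = exp (- 1 / (k t))\<close> tends to 1,
  and it is 0 otherwise. A product of such factors, one for each face of the box, tends to the
  indicator of the open box, while the supports lie in the closed box, which is compact.\<close>

lemma smooth_box_approximation:
  fixes a b :: "real^'d::finite"
  obtains \<psi> where "\<And>k. smooth (\<psi> k)" "\<And>k x. \<bar>\<psi> k x\<bar> \<le> indicat_real (cbox a b) x"
    "\<And>x. (\<lambda>k::nat. \<psi> k x) \<longlonglongrightarrow> indicat_real (box a b) x"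
proof -
  define \<psi> where "\<psi> k x = (\<Prod>i\<in>UNIV. bump 1 (real (Suc k) * (x $ i - a $ i)) * bump 1 (real (Suc k) * (b $ i - x $ i)))"
    for k and x :: "real^'d"
  have lim: "(\<lambda>k. bump 1 (real (Suc k) * t)) \<longlonglongrightarrow> of_bool (0 < t)" for t
  proof (cases "0 < t")
    case True
    have "(\<lambda>k. exp (- (inverse (real (Suc k)) * inverse t))) \<longlonglongrightarrow> exp (- (0 * inverse t))"
      by (intro tendsto_intros LIMSEQ_inverse_real_of_nat)
    moreover have "bump 1 (real (Suc k) * t) = exp (- (inverse (real (Suc k)) * inverse t))" for k
    proof -
      have "real (Suc k) * t > 0" using True by simp
      then show ?thesis unfolding bump_def by (simp only: not_le[symmetric] if_False inverse_mult_distrib poly_1 mult_1)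
    qed
    ultimately show ?thesis using True by simp
  next
    case False
    then have "bump 1 (real (Suc k) * t) = 0" for k
      by (simp only: bump_def mult_nonneg_nonpos of_nat_0_le_iff not_less if_True)
    then show ?thesis using False by simp
  qed
  show ?thesis
  proof (rule that[of \<psi>])
    show "smooth (\<psi> k)" for k unfolding \<psi>_def
      by (intro smooth_prod smooth_mult smooth_bump smooth_diff smooth_coord smooth_const) simp
    fix k x
    show "\<bar>\<psi> k x\<bar> \<le> indicat_real (cbox a b) x"
    proof (cases "x \<in> cbox a b")
      case True
      have "\<psi> k x \<le> 1" unfolding \<psi>_def
        by (intro prod_le_1 conjI mult_nonneg_nonneg mult_le_one bump_1_nonneg bump_1_le)
      moreover have "0 \<le> \<psi> k x" unfolding \<psi>_def
        by (intro prod_nonneg mult_nonneg_nonneg bump_1_nonneg)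
      ultimately show ?thesis using True by simp
    next
      case False
      then obtain i where "x $ i < a $ i \<or> b $ i < x $ i" by (auto simp: mem_box_cart not_le)
      then have "bump 1 (real (Suc k) * (x $ i - a $ i)) * bump 1 (real (Suc k) * (b $ i - x $ i)) = 0"
        by (auto simp: bump_def mult_le_0_iff not_le)
      then have "\<psi> k x = 0" unfolding \<psi>_def by (metis (mono_tags, lifting) UNIV_I finite prod_zero)
      then show ?thesis by simp
    qed
  next
    fix x
    have "(\<lambda>k. \<psi> k x) \<longlonglongrightarrow> (\<Prod>i\<in>UNIV. of_bool (0 < x $ i - a $ i) * of_bool (0 < b $ i - x $ i))"
      unfolding \<psi>_def by (intro tendsto_prod tendsto_mult lim)
    also have "(\<Prod>i\<in>UNIV. of_bool (0 < x $ i - a $ i) * of_bool (0 < b $ i - x $ i)) = indicat_real (box a b) x"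
      by (auto simp: indicator_def mem_box_cart prod_zero_iff of_bool_def intro!: prod.neutral)
    finally show "(\<lambda>k. \<psi> k x) \<longlonglongrightarrow> indicat_real (box a b) x" .
  qed
qed

section \<open>Test functions\<close>

lemma partial_zero_outside:
  assumes "closed K" "\<And>x. x \<notin> K \<Longrightarrow> f x = 0" "x \<notin> K"
  shows "partial i f x = 0"
proof -
  have "((\<lambda>x. 0) has_derivative (\<lambda>h. 0)) (at x)" by simp
  then have "(f has_derivative (\<lambda>h. 0)) (at x)"
    by (rule has_derivative_transform_within_open[of _ _ _ _ "- K"]) (use assms in auto)
  then show ?thesis by (simp add: partial_eq)
qed

text \<open>Any compact set containing the support will do, so the closure of the support of a
  translate, a sum or a derivative never has to be computed.\<close>

lemma test_functionsI:
  assumes "smooth \<phi>" "compact K" "K \<subseteq> \<Omega>" "\<And>x. x \<notin> K \<Longrightarrow> \<phi> x = 0"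
  shows "\<phi> \<in> test_functions \<Omega>"
proof -
  have "closure {x. \<phi> x \<noteq> 0} \<subseteq> K"
    using assms by (intro closure_minimal compact_imp_closed) auto
  moreover from this have "compact (closure {x. \<phi> x \<noteq> 0})"
    using compact_Int_closed[OF assms(2), of "closure {x. \<phi> x \<noteq> 0}"] by (simp add: Int_absorb1)
  ultimately show ?thesis using assms by (auto simp: test_functions_def)
qed

lemma test_functionsE:
  assumes "\<phi> \<in> test_functions \<Omega>"
  obtains K where "smooth \<phi>" "compact K" "K \<subseteq> \<Omega>" "\<And>x. x \<notin> K \<Longrightarrow> \<phi> x = 0"
  using assms closure_subset[of "{x. \<phi> x \<noteq> 0}"]
  by (intro that[of "closure {x. \<phi> x \<noteq> 0}"]) (auto simp: test_functions_def)

lemma test_functions_smooth: "\<phi> \<in> test_functions \<Omega> \<Longrightarrow> smooth \<phi>"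
  by (simp add: test_functions_def)

lemma test_functions_zero_outside: "\<phi> \<in> test_functions \<Omega> \<Longrightarrow> x \<notin> \<Omega> \<Longrightarrow> \<phi> x = 0"
  by (metis test_functionsE subsetD)

lemma test_functions_partial:
  assumes "\<phi> \<in> test_functions \<Omega>" shows "partial i \<phi> \<in> test_functions \<Omega>"
proof -
  obtain K where "smooth \<phi>" "compact K" "K \<subseteq> \<Omega>" "\<And>x. x \<notin> K \<Longrightarrow> \<phi> x = 0"
    using assms by (rule test_functionsE) blast
  then show ?thesis
    by (intro test_functionsI[of _ K]) (auto intro: smooth_partial partial_zero_outside compact_imp_closed)
qed

lemma test_functions_mult:
  assumes "smooth \<psi>" "\<phi> \<in> test_functions \<Omega>" shows "(\<lambda>x. \<psi> x * \<phi> x) \<in> test_functions \<Omega>"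
proof -
  obtain K where "smooth \<phi>" "compact K" "K \<subseteq> \<Omega>" "\<And>x. x \<notin> K \<Longrightarrow> \<phi> x = 0"
    using assms(2) by (rule test_functionsE) blast
  then show ?thesis using assms(1)
    by (intro test_functionsI[of _ K]) (auto intro: smooth_mult)
qed

lemma test_functions_lincomb:
  assumes "\<phi> \<in> test_functions \<Omega>" "\<psi> \<in> test_functions \<Omega>"
  shows "(\<lambda>x. \<phi> x + c * \<psi> x) \<in> test_functions \<Omega>"
proof -
  obtain K where "smooth \<phi>" "compact K" "K \<subseteq> \<Omega>" "\<And>x. x \<notin> K \<Longrightarrow> \<phi> x = 0"
    using assms(1) by (rule test_functionsE) blast
  moreover obtain K' where "smooth \<psi>" "compact K'" "K' \<subseteq> \<Omega>" "\<And>x. x \<notin> K' \<Longrightarrow> \<psi> x = 0"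
    using assms(2) by (rule test_functionsE) blast
  ultimately show ?thesis
    by (intro test_functionsI[of _ "K \<union> K'"]) (auto intro!: smooth_add smooth_mult smooth_const)
qed

lemma test_functions_zero: "(\<lambda>x. 0) \<in> test_functions \<Omega>"
  by (rule test_functionsI[of _ "{}"]) (auto intro: smooth_const)

lemma smooth_measurable: "smooth f \<Longrightarrow> f \<in> borel_measurable borel"
  by (intro borel_measurable_continuous_onI smooth_continuous_on)

lemma smooth_measurable_lebesgue_on: "smooth f \<Longrightarrow> f \<in> borel_measurable (lebesgue_on S)"
  by (intro measurable_restrict_space1 measurable_completion) (simp add: smooth_measurable)

lemma integrable_compact_support:
  assumes "smooth f" "compact K" "\<And>x. x \<notin> K \<Longrightarrow> f x = 0"
  shows "integrable lborel f"
proof -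
  have "integrable lborel (\<lambda>x. indicator K x *\<^sub>R f x)"
    by (intro borel_integrable_compact smooth_continuous_on assms)
  moreover have "(\<lambda>x. indicator K x *\<^sub>R f x) = f"
    using assms(3) by (auto simp: indicator_def fun_eq_iff)
  ultimately show ?thesis by simp
qed

lemma L2_compact_support:
  assumes f: "smooth f" "compact K" "\<And>x. x \<notin> K \<Longrightarrow> f x = 0" and S: "S \<in> sets lebesgue"
  shows "f \<in> L2 S"
proof -
  have "integrable lborel (\<lambda>x. f x * f x)"
    by (rule integrable_compact_support[OF _ f(2)]) (use f in \<open>auto intro: smooth_mult\<close>)
  then have "integrable lebesgue (\<lambda>x. f x * f x)"
    using smooth_measurable[OF f(1)] by (subst integrable_completion) auto
  then have "integrable (lebesgue_on S) (\<lambda>x. f x * f x)"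
    using S by (simp add: integrable_restrict_space integrable_mult_indicator[of S lebesgue "\<lambda>x. f x * f x", simplified])
  then show ?thesis
    using smooth_measurable_lebesgue_on[OF f(1)] by (simp add: L2_on_def power2_eq_square)
qed

lemma test_functions_L2:
  assumes "\<phi> \<in> test_functions \<Omega>" "S \<in> sets lebesgue"
  shows "\<phi> \<in> L2 S"
  using assms by (elim test_functionsE) (rule L2_compact_support)

lemma L2_indicator_compact:
  assumes "compact K" "S \<in> sets lebesgue"
  shows "indicat_real K \<in> L2 S"
proof -
  have K: "K \<in> sets lebesgue" using assms(1) by (simp add: borel_compact)
  have "integrable lborel (indicat_real K)"
    using borel_integrable_compact[OF assms(1), of "\<lambda>x. 1::real"] by simp
  then have "integrable lebesgue (indicat_real K)"
    using assms(1) by (subst integrable_completion) (auto intro: borel_compact)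
  then have "integrable (lebesgue_on S) (indicat_real K)"
    using assms(2) integrable_mult_indicator[of S lebesgue "indicat_real K"] by (simp add: integrable_restrict_space)
  moreover have "(\<lambda>x. (norm (indicat_real K x))\<^sup>2) = indicat_real K"
    by (auto simp: indicator_def)
  moreover have "indicat_real K \<in> borel_measurable (lebesgue_on S)"
    using K by (intro measurable_restrict_space1) simp
  ultimately show ?thesis by (simp add: L2_on_def)
qed

section \<open>Translations under the integral and integration by parts\<close>

lemma lebesgue_on_integral_zero_outside:
  fixes f :: "'a::euclidean_space \<Rightarrow> real"
  assumes "\<And>x. x \<notin> S \<Longrightarrow> f x = 0" "S \<in> sets lebesgue"
  shows "(LINT x|lebesgue_on S. f x) = (LINT x|lebesgue. f x)"
proof -
  have "(\<lambda>x. indicator S x *\<^sub>R f x) = f"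
    using assms(1) by (auto simp: indicator_def fun_eq_iff)
  then show ?thesis using assms(2) by (simp add: integral_restrict_space)
qed

lemma lebesgue_integral_translate:
  fixes f :: "'a::euclidean_space \<Rightarrow> real"
  assumes f: "f \<in> borel_measurable borel"
  shows "(LINT x|lebesgue. f (x - a)) = (LINT x|lebesgue. f x)"
proof -
  have "(LINT x|lebesgue. f (x - a)) = (LINT x|lborel. f ((-a) + x))"
    using f by (subst integral_completion) auto
  also have "\<dots> = (LINT x|distr lborel borel ((+) (-a)). f x)"
    using f by (subst integral_distr) auto
  also have "\<dots> = (LINT x|lebesgue. f x)"
    using f by (simp add: lborel_distr_plus integral_completion)
  finally show ?thesis .
qed

text \<open>Differentiation under the integral by dominated convergence. The difference quotients of
  \<open>\<phi>\<close> are bounded by the Lipschitz constant \<open>C\<close> along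
  \<open>\<xi>\<close> and vanish outside one fixed ball, so the majorant is a product of two
  \<open>L2\<close> functions. Only \<open>\<phi>\<close> has to be smooth; \<open>v\<close> is
  arbitrary in \<open>L2\<close>.\<close>

lemma deriv_integral_translate:
  fixes \<phi> v :: "real^'d::finite \<Rightarrow> real"
  assumes \<Omega>: "\<Omega> \<in> sets lebesgue" and v: "v \<in> L2 \<Omega>"
    and \<phi>: "smooth \<phi>" "compact K" "\<And>x. x \<notin> K \<Longrightarrow> \<phi> x = 0"
  shows "((\<lambda>t. LINT x|lebesgue_on \<Omega>. v x * \<phi> (x - t *\<^sub>R \<xi>)) has_real_derivative
     (LINT x|lebesgue_on \<Omega>. v x * - (\<Sum>i\<in>UNIV. \<xi> $ i * partial i \<phi> (x - t *\<^sub>R \<xi>)))) (at t)"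
proof -
  define D where "D y = (\<Sum>i\<in>UNIV. \<xi> $ i * partial i \<phi> y)" for y
  have D: "smooth D" unfolding D_def
    by (intro smooth_sum smooth_mult smooth_const smooth_partial \<phi>) simp
  have D0: "D y = 0" if "y \<notin> K" for y
    unfolding D_def using partial_zero_outside[OF compact_imp_closed[OF \<phi>(2)] \<phi>(3) that] by simp
  have "bounded (D ` K)"
    by (intro compact_imp_bounded compact_continuous_image smooth_continuous_on D \<phi>)
  then obtain C where C: "\<And>y. y \<in> K \<Longrightarrow> \<bar>D y\<bar> \<le> C" "C > 0" by (auto simp: bounded_pos)
  have C': "\<bar>D y\<bar> \<le> C" for y using C D0[of y] by (cases "y \<in> K") auto
  have line: "((\<lambda>s. \<phi> (y - s *\<^sub>R \<xi>)) has_real_derivative - D (y - s *\<^sub>R \<xi>)) (at s)" for y s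
    using smooth_line_derivative[OF \<phi>(1), of y "- \<xi>" s] by (simp add: D_def sum_negf)
  have lip: "\<bar>\<phi> (y - s *\<^sub>R \<xi>) - \<phi> (y - s' *\<^sub>R \<xi>)\<bar> \<le> C * \<bar>s - s'\<bar>" for y s s'
    using field_differentiable_bound[of UNIV "\<lambda>s. \<phi> (y - s *\<^sub>R \<xi>)" "\<lambda>s. - D (y - s *\<^sub>R \<xi>)" C s s'] line C'
    by simp
  have meas: "(\<lambda>x. f (x - a)) \<in> borel_measurable (lebesgue_on \<Omega>)" if "smooth f" for f :: "real^'d \<Rightarrow> real" and a
    using that by (intro smooth_measurable_lebesgue_on smooth_translate)
  note [measurable] = L2_measurable[OF v] meas[OF \<phi>(1)] meas[OF D]
  have "((\<lambda>h. ((LINT x|lebesgue_on \<Omega>. v x * \<phi> (x - (t + h) *\<^sub>R \<xi>)) - (LINT x|lebesgue_on \<Omega>. v x * \<phi> (x - t *\<^sub>R \<xi>))) / h)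
     \<longlongrightarrow> (LINT x|lebesgue_on \<Omega>. v x * - D (x - t *\<^sub>R \<xi>))) (at 0)"
    unfolding tendsto_at_iff_sequentially comp_def
  proof (intro allI impI)
    fix X :: "nat \<Rightarrow> real"
    assume X: "\<forall>i. X i \<in> UNIV - {0}" "X \<longlonglongrightarrow> 0"
    obtain M where M: "\<And>i. \<bar>X i\<bar> \<le> M"
      using convergent_imp_Bseq[OF convergentI[OF X(2)]] by (auto simp: Bseq_def)
    obtain r where r: "\<And>x. x \<in> K \<Longrightarrow> norm x \<le> r"
      using compact_imp_bounded[OF \<phi>(2)] by (auto simp: bounded_iff)
    \<comment> \<open>\<open>M\<close> bounds the increments \<open>X i\<close>, so the ball of
      radius \<open>R\<close> contains the support of every translate that occurs.\<close>
    define R where "R = r + (\<bar>t\<bar> + M) * norm \<xi>"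
    have out: "\<phi> (x - s *\<^sub>R \<xi>) = 0" if "x \<notin> cball 0 R" "\<bar>s\<bar> \<le> \<bar>t\<bar> + M" for x s
    proof (rule \<phi>(3))
      show "x - s *\<^sub>R \<xi> \<notin> K"
      proof
        assume "x - s *\<^sub>R \<xi> \<in> K"
        then have "norm (x - s *\<^sub>R \<xi>) \<le> r" by (rule r)
        moreover have "norm x \<le> norm (x - s *\<^sub>R \<xi>) + norm (s *\<^sub>R \<xi>)"
          using norm_triangle_ineq[of "x - s *\<^sub>R \<xi>" "s *\<^sub>R \<xi>"] by simp
        moreover have "norm (s *\<^sub>R \<xi>) \<le> (\<bar>t\<bar> + M) * norm \<xi>"
          using that(2) by (simp add: mult_right_mono)
        ultimately show False using that(1) by (simp add: R_def)
      qed
    qed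
    have L2s: "(\<lambda>x. v x * \<phi> (x - s *\<^sub>R \<xi>)) \<in> borel_measurable (lebesgue_on \<Omega>)"
      "integrable (lebesgue_on \<Omega>) (\<lambda>x. v x * \<phi> (x - s *\<^sub>R \<xi>))" for s
    proof -
      have "(\<lambda>x. \<phi> (x - s *\<^sub>R \<xi>)) \<in> L2 \<Omega>"
      proof (rule L2_compact_support[OF smooth_translate[OF \<phi>(1)] _ _ \<Omega>])
        show "compact ((+) (s *\<^sub>R \<xi>) ` K)" using \<phi>(2) by (rule compact_translation)
        show "\<phi> (x - s *\<^sub>R \<xi>) = 0" if "x \<notin> (+) (s *\<^sub>R \<xi>) ` K" for x
        proof (rule \<phi>(3))
          show "x - s *\<^sub>R \<xi> \<notin> K"
            using that image_eqI[of x "(+) (s *\<^sub>R \<xi>)" "x - s *\<^sub>R \<xi>" K] by auto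
        qed
      qed
      from integrable_mult_L2[OF v this] show "integrable (lebesgue_on \<Omega>) (\<lambda>x. v x * \<phi> (x - s *\<^sub>R \<xi>))" .
    qed measurable
    have "(\<lambda>i. LINT x|lebesgue_on \<Omega>. v x * ((\<phi> (x - (t + X i) *\<^sub>R \<xi>) - \<phi> (x - t *\<^sub>R \<xi>)) / X i))
        \<longlonglongrightarrow> (LINT x|lebesgue_on \<Omega>. v x * - D (x - t *\<^sub>R \<xi>))"
    proof (rule integral_dominated_convergence[where w = "\<lambda>x. \<bar>v x\<bar> * (C * indicat_real (cball 0 R) x)"])
      have "(\<lambda>x. \<bar>v x\<bar>) \<in> L2 \<Omega>" by (rule L2_on_bound[OF v, of _ 1]) auto
      then show "integrable (lebesgue_on \<Omega>) (\<lambda>x. \<bar>v x\<bar> * (C * indicat_real (cball 0 R) x))"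
        by (intro integrable_mult_L2 L2_on_mult L2_indicator_compact \<Omega> compact_cball)
      show "AE x in lebesgue_on \<Omega>. (\<lambda>i. v x * ((\<phi> (x - (t + X i) *\<^sub>R \<xi>) - \<phi> (x - t *\<^sub>R \<xi>)) / X i))
          \<longlonglongrightarrow> v x * - D (x - t *\<^sub>R \<xi>)"
      proof (intro AE_I2 tendsto_mult tendsto_const)
        fix x
        have "((\<lambda>h. (\<phi> (x - (t + h) *\<^sub>R \<xi>) - \<phi> (x - t *\<^sub>R \<xi>)) / h) \<longlongrightarrow> - D (x - t *\<^sub>R \<xi>)) (at 0)"
          using line[of x t] by (simp add: DERIV_def)
        then show "(\<lambda>i. (\<phi> (x - (t + X i) *\<^sub>R \<xi>) - \<phi> (x - t *\<^sub>R \<xi>)) / X i) \<longlonglongrightarrow> - D (x - t *\<^sub>R \<xi>)"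
          using X unfolding tendsto_at_iff_sequentially comp_def by blast
      qed
      show "AE x in lebesgue_on \<Omega>. norm (v x * ((\<phi> (x - (t + X i) *\<^sub>R \<xi>) - \<phi> (x - t *\<^sub>R \<xi>)) / X i))
          \<le> \<bar>v x\<bar> * (C * indicat_real (cball 0 R) x)" for i
      proof (intro AE_I2)
        fix x
        have "\<bar>(\<phi> (x - (t + X i) *\<^sub>R \<xi>) - \<phi> (x - t *\<^sub>R \<xi>)) / X i\<bar> \<le> C * indicat_real (cball 0 R) x"
        proof (cases "x \<in> cball 0 R")
          case True
          have "X i \<noteq> 0" using X by auto
          then show ?thesis using True lip[of x "t + X i" t] by (simp add: field_simps)
        next
          case False
          have "\<bar>t + X i\<bar> \<le> \<bar>t\<bar> + M" "\<bar>t\<bar> \<le> \<bar>t\<bar> + M" using M[of i] by linarith+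
          then show ?thesis using out[OF False] False by simp
        qed
        then show "norm (v x * ((\<phi> (x - (t + X i) *\<^sub>R \<xi>) - \<phi> (x - t *\<^sub>R \<xi>)) / X i))
          \<le> \<bar>v x\<bar> * (C * indicat_real (cball 0 R) x)"
          by (simp only: real_norm_def abs_mult) (intro mult_left_mono, auto)
      qed
    qed measurable
    moreover have "(LINT x|lebesgue_on \<Omega>. v x * ((\<phi> (x - (t + X i) *\<^sub>R \<xi>) - \<phi> (x - t *\<^sub>R \<xi>)) / X i))
        = ((LINT x|lebesgue_on \<Omega>. v x * \<phi> (x - (t + X i) *\<^sub>R \<xi>)) -
        (LINT x|lebesgue_on \<Omega>. v x * \<phi> (x - t *\<^sub>R \<xi>))) / X i" for i
    proof -
      have "(LINT x|lebesgue_on \<Omega>. v x * ((\<phi> (x - (t + X i) *\<^sub>R \<xi>) - \<phi> (x - t *\<^sub>R \<xi>)) / X i))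
         = (LINT x|lebesgue_on \<Omega>. (v x * \<phi> (x - (t + X i) *\<^sub>R \<xi>) - v x * \<phi> (x - t *\<^sub>R \<xi>)) / X i)"
        by (intro Bochner_Integration.integral_cong refl) (simp only: right_diff_distrib times_divide_eq_right)
      then show ?thesis by (simp only: integral_divide_zero Bochner_Integration.integral_diff[OF L2s(2) L2s(2)])
    qed
    ultimately show "(\<lambda>i. ((LINT x|lebesgue_on \<Omega>. v x * \<phi> (x - (t + X i) *\<^sub>R \<xi>)) -
        (LINT x|lebesgue_on \<Omega>. v x * \<phi> (x - t *\<^sub>R \<xi>))) / X i)
        \<longlonglongrightarrow> (LINT x|lebesgue_on \<Omega>. v x * - D (x - t *\<^sub>R \<xi>))"
      by (simp only:)
  qed
  then show ?thesis by (simp add: DERIV_def D_def)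
qed

text \<open>The function \<open>t \<mapsto> \<integral> \<phi>(x) \<psi>(x - t e) dx\<close>, with
  \<open>e\<close> the \<open>i\<close>-th unit vector, is differentiated at 0 in two ways:
  directly, with the derivative falling on \<open>\<psi>\<close>, and after a change of variables
  that moves the translation, and hence the derivative, onto \<open>\<phi>\<close>.\<close>

lemma integration_by_parts:
  fixes \<phi> \<psi> :: "real^'d::finite \<Rightarrow> real"
  assumes \<phi>: "\<phi> \<in> test_functions \<Omega>" and \<psi>: "\<psi> \<in> test_functions \<Omega>" and \<Omega>: "\<Omega> \<in> sets lebesgue"
  shows "(LINT x|lebesgue_on \<Omega>. partial i \<phi> x * \<psi> x) = - (LINT x|lebesgue_on \<Omega>. \<phi> x * partial i \<psi> x)"
proof -
  have D: "((\<lambda>t. LINT x|lebesgue. \<phi> x * \<psi> (x - t *\<^sub>R axis i 1)) has_real_derivative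
      - (LINT x|lebesgue. \<phi> x * partial i \<psi> x)) (at 0)"
    if *: "\<phi> \<in> test_functions \<Omega>" "\<psi> \<in> test_functions \<Omega>" for \<phi> \<psi>
  proof -
    obtain K where "smooth \<psi>" "compact K" "K \<subseteq> \<Omega>" "\<And>x. x \<notin> K \<Longrightarrow> \<psi> x = 0"
      using *(2) by (rule test_functionsE) blast
    from deriv_integral_translate[OF _ test_functions_L2[OF *(1)] this(1,2,4), of UNIV "axis i 1" 0]
    show ?thesis
      by (simp add: lebesgue_on_UNIV_eq axis_def if_distrib[of "\<lambda>x. x * _"] cong: if_cong)
  qed
  have "(LINT x|lebesgue. \<psi> x * \<phi> (x - (-t) *\<^sub>R axis i 1)) = (LINT x|lebesgue. \<phi> x * \<psi> (x - t *\<^sub>R axis i 1))" for t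
  proof -
    let ?f = "\<lambda>x. \<psi> (x - t *\<^sub>R axis i 1) * \<phi> x"
    have "smooth ?f" by (intro smooth_mult smooth_translate test_functions_smooth[OF \<phi>] test_functions_smooth[OF \<psi>])
    from lebesgue_integral_translate[OF smooth_measurable[OF this], of "(-t) *\<^sub>R axis i 1"]
    show ?thesis by (simp add: mult.commute)
  qed
  then have "((\<lambda>t. LINT x|lebesgue. \<psi> x * \<phi> (x - (-t) *\<^sub>R axis i 1)) has_real_derivative
      - (LINT x|lebesgue. \<phi> x * partial i \<psi> x)) (at 0)"
    using D[OF \<phi> \<psi>] by simp
  moreover have "((\<lambda>t. LINT x|lebesgue. \<psi> x * \<phi> (x - (-t) *\<^sub>R axis i 1)) has_real_derivative
      (LINT x|lebesgue. \<psi> x * partial i \<phi> x)) (at 0)"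
    using DERIV_mirror[of "\<lambda>t. LINT x|lebesgue. \<psi> x * \<phi> (x - t *\<^sub>R axis i 1)" "- (LINT x|lebesgue. \<psi> x * partial i \<phi> x)" 0] D[OF \<psi> \<phi>]
    by simp
  ultimately have "(LINT x|lebesgue. \<psi> x * partial i \<phi> x) = - (LINT x|lebesgue. \<phi> x * partial i \<psi> x)"
    using DERIV_unique by blast
  moreover have eq: "(LINT x|lebesgue_on \<Omega>. f x * g x) = (LINT x|lebesgue. f x * g x)"
    if "f \<in> test_functions \<Omega>" for f g
    using test_functions_zero_outside[OF that] by (intro lebesgue_on_integral_zero_outside \<Omega>) auto
  ultimately show ?thesis
    unfolding eq[OF \<phi>] eq[OF test_functions_partial[OF \<phi>]] by (simp add: mult.commute[of "\<psi> _"])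
qed

text \<open>As \<open>ennreal\<close> truncates negative values to 0, the two densities are the
  positive and negative parts of \<open>h\<close>. The measures they define are finite and agree on
  boxes, which form a generator stable under intersections; so the measures are equal and both parts
  coincide almost everywhere.\<close>

lemma AE_zero_if_box_integrals_zero:
  fixes h :: "'a::euclidean_space \<Rightarrow> real"
  assumes h: "integrable lborel h" and box: "\<And>c d. (LINT x|lborel. indicator (box c d) x * h x) = 0"
  shows "AE x in lborel. h x = 0"
proof -
  have [measurable]: "h \<in> borel_measurable borel" using h by auto
  have fin: "(\<integral>\<^sup>+x. ennreal (s * h x) * indicator A x \<partial>lborel) < \<infinity>" if "s = 1 \<or> s = -1" for s A
  proof -
    have "(\<integral>\<^sup>+x. ennreal (s * h x) * indicator A x \<partial>lborel) \<le> (\<integral>\<^sup>+x. ennreal (norm (h x)) \<partial>lborel)"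
      using that by (intro nn_integral_mono) (auto simp: indicator_def intro: ennreal_leI)
    also have "\<dots> < \<infinity>" using h by (simp add: integrable_iff_bounded)
    finally show ?thesis .
  qed
  have "density lborel (\<lambda>x. ennreal (h x)) = density lborel (\<lambda>x. ennreal (- h x))"
  proof (rule measure_eqI_generator_eq)
    let ?E = "range (\<lambda>(a, b). box a b::'a set)"
    show "Int_stable ?E"
      by (auto simp: Int_stable_def box_Int_box)
    show "?E \<subseteq> Pow UNIV" "sets (density lborel (\<lambda>x. ennreal (h x))) = sigma_sets UNIV ?E"
      "sets (density lborel (\<lambda>x. ennreal (- h x))) = sigma_sets UNIV ?E"
      by (simp_all add: borel_eq_box)
    let ?A = "\<lambda>n::nat. box (- (real n *\<^sub>R One)) (real n *\<^sub>R One) :: 'a set"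
    show "range ?A \<subseteq> ?E" "(\<Union>i. ?A i) = UNIV"
      unfolding UN_box_eq_UNIV by auto
    show "emeasure (density lborel (\<lambda>x. ennreal (h x))) (?A i) \<noteq> \<infinity>" for i
      using fin[of 1 "?A i"] by (simp add: emeasure_density)
    show "emeasure (density lborel (\<lambda>x. ennreal (h x))) X = emeasure (density lborel (\<lambda>x. ennreal (- h x))) X"
      if "X \<in> ?E" for X
    proof -
      obtain c d where X: "X = box c d" using \<open>X \<in> ?E\<close> by auto
      let ?g = "\<lambda>x. indicator (box c d) x * h x"
      have g: "integrable lborel ?g" using integrable_mult_indicator[OF _ h, of "box c d"] by simp
      have pos: "(\<integral>\<^sup>+x. ennreal (?g x) \<partial>lborel) = (\<integral>\<^sup>+x. ennreal (h x) * indicator (box c d) x \<partial>lborel)"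
        by (intro nn_integral_cong) (auto simp: indicator_def)
      have neg: "(\<integral>\<^sup>+x. ennreal (- ?g x) \<partial>lborel) = (\<integral>\<^sup>+x. ennreal (- h x) * indicator (box c d) x \<partial>lborel)"
        by (intro nn_integral_cong) (auto simp: indicator_def)
      have "enn2real (\<integral>\<^sup>+x. ennreal (?g x) \<partial>lborel) - enn2real (\<integral>\<^sup>+x. ennreal (- ?g x) \<partial>lborel) = 0"
        using box[of c d] real_lebesgue_integral_def[OF g] by simp
      moreover have "a = b" if "enn2real a - enn2real b = 0" "a < \<infinity>" "b < \<infinity>" for a b
      proof -
        have "a = ennreal (enn2real a)" "b = ennreal (enn2real b)" using that(2,3) by simp_all
        then show ?thesis using that(1) by (metis right_minus_eq)
      qed
      ultimately have "(\<integral>\<^sup>+x. ennreal (h x) * indicator (box c d) x \<partial>lborel) =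
          (\<integral>\<^sup>+x. ennreal (- h x) * indicator (box c d) x \<partial>lborel)"
        using fin[of 1 "box c d"] fin[of "-1" "box c d"] unfolding pos neg by simp
      then show ?thesis by (simp add: X emeasure_density)
    qed
  qed
  then have "AE x in lborel. ennreal (h x) = ennreal (- h x)"
    by (intro sigma_finite_measure.density_unique[OF sigma_finite_lborel]) auto
  then show ?thesis
  proof eventually_elim
    case (elim x)
    show ?case
    proof (cases "h x \<ge> 0")
      case True
      then have "ennreal (- h x) = 0" by (simp add: ennreal_neg)
      then show ?thesis using elim True by simp
    next
      case False
      then have "ennreal (h x) = 0" by (simp add: ennreal_neg)
      then show ?thesis using elim False by simp
    qed
  qed
qed

text \<open>Smooth approximations of box indicators are admissible test functions as soon as the
  closed box lies in \<open>\<Omega>\<close>, so \<open>w\<close> has zero integral over each such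
  open box. Cutting \<open>w\<close> off to one box reduces the claim to
  \<open>AE_zero_if_box_integrals_zero\<close>; countably many closed boxes cover
  \<open>\<Omega>\<close>, and their frontiers are null sets.\<close>

lemma fundamental_lemma:
  fixes w :: "real^'d::finite \<Rightarrow> real"
  assumes \<Omega>: "open \<Omega>" and w: "w \<in> L2 \<Omega>"
    and zero: "\<And>\<phi>. \<phi> \<in> test_functions \<Omega> \<Longrightarrow> (LINT x|lebesgue_on \<Omega>. w x * \<phi> x) = 0"
  shows "AE x in lebesgue_on \<Omega>. w x = 0"
proof -
  have \<Omega>s[simp]: "\<Omega> \<in> sets lebesgue" using \<Omega> by (simp add: borel_open)
  have [measurable]: "w \<in> borel_measurable (lebesgue_on \<Omega>)" by (rule L2_measurable[OF w])
  have ind[measurable]: "indicat_real (box a b) \<in> borel_measurable (lebesgue_on \<Omega>)" for a b :: "real^'d"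
    by (intro measurable_restrict_space1 borel_measurable_indicator) (simp add: borel_open)
  have w_abs: "(\<lambda>x. \<bar>w x\<bar>) \<in> L2 \<Omega>" by (rule L2_on_bound[OF w, of _ 1]) auto
  have box0: "(LINT x|lebesgue_on \<Omega>. w x * indicat_real (box a b) x) = 0" if "cbox a b \<subseteq> \<Omega>" for a b
  proof -
    obtain \<psi> where \<psi>: "\<And>k. smooth (\<psi> k)" "\<And>k x. \<bar>\<psi> k x\<bar> \<le> indicat_real (cbox a b) x"
      "\<And>x. (\<lambda>k::nat. \<psi> k x) \<longlonglongrightarrow> indicat_real (box a b) x"
      by (rule smooth_box_approximation) blast
    have "\<psi> k x = 0" if "x \<notin> cbox a b" for k x using \<psi>(2)[of k x] that by simp
    then have test: "\<psi> k \<in> test_functions \<Omega>" for k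
      by (intro test_functionsI[OF \<psi>(1) _ that]) auto
    note [measurable] = smooth_measurable_lebesgue_on[OF \<psi>(1)]
    have "(\<lambda>k. LINT x|lebesgue_on \<Omega>. w x * \<psi> k x) \<longlonglongrightarrow> (LINT x|lebesgue_on \<Omega>. w x * indicat_real (box a b) x)"
    proof (rule integral_dominated_convergence[where w = "\<lambda>x. \<bar>w x\<bar> * indicat_real (cbox a b) x"])
      show "integrable (lebesgue_on \<Omega>) (\<lambda>x. \<bar>w x\<bar> * indicat_real (cbox a b) x)"
        by (intro integrable_mult_L2 w_abs L2_indicator_compact) auto
      show "AE x in lebesgue_on \<Omega>. (\<lambda>k. w x * \<psi> k x) \<longlonglongrightarrow> w x * indicat_real (box a b) x"
        by (intro AE_I2 tendsto_intros \<psi>)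
      show "AE x in lebesgue_on \<Omega>. norm (w x * \<psi> k x) \<le> \<bar>w x\<bar> * indicat_real (cbox a b) x" for k
        by (intro AE_I2) (simp only: real_norm_def abs_mult, intro mult_left_mono \<psi>, simp)
    qed measurable
    then show ?thesis using zero[OF test] by (simp add: LIMSEQ_const_iff)
  qed
  have AE_box: "AE x in lebesgue_on \<Omega>. x \<in> box a b \<longrightarrow> w x = 0" if ab: "cbox a b \<subseteq> \<Omega>" for a b
  proof -
    \<comment> \<open>The cut-off function is integrable on the whole space. It is then replaced by
      a Borel version \<open>h\<close>, because the statement about boxes is formulated for
      \<open>lborel\<close>.\<close>
    define h0 where "h0 x = indicat_real \<Omega> x *\<^sub>R (w x * indicat_real (box a b) x)" for x
    have "integrable (lebesgue_on \<Omega>) (\<lambda>x. w x * indicat_real (box a b) x)"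
    proof (rule Bochner_Integration.integrable_bound)
      show "integrable (lebesgue_on \<Omega>) (\<lambda>x. \<bar>w x\<bar> * indicat_real (cbox a b) x)"
        by (intro integrable_mult_L2 w_abs L2_indicator_compact) auto
      show "AE x in lebesgue_on \<Omega>. norm (w x * indicat_real (box a b) x) \<le> norm (\<bar>w x\<bar> * indicat_real (cbox a b) x)"
        using box_subset_cbox[of a b] by (intro AE_I2) (auto simp: indicator_def)
    qed measurable
    then have h0: "integrable lebesgue h0" unfolding h0_def by (subst (asm) integrable_restrict_space) auto
    then obtain h where h: "h \<in> borel_measurable lborel" "AE x in lborel. h0 x = h x"
      using completion_ex_borel_measurable_real[of h0 lborel] by auto
    have AE: "AE x in lebesgue. h0 x = h x" using h(2) by (rule AE_completion)
    have "h \<in> borel_measurable lebesgue" using h(1) by (rule measurable_completion)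
    then have "integrable lebesgue h"
      using h0 AE integrable_cong_AE[OF borel_measurable_integrable[OF h0], of h] by simp
    then have int: "integrable lborel h" using h(1) by (subst (asm) integrable_completion) auto
    have "(LINT x|lborel. indicator (box c d) x * h x) = 0" for c d
    proof -
      \<comment> \<open>Integrating the cut-off function over a box means integrating
        \<open>w\<close> over the intersection of two boxes, again a box.\<close>
      obtain c' d' where cd: "box a b \<inter> box c d = box c' d'" using box_Int_box by blast
      have [measurable]: "h \<in> borel_measurable borel" using h(1) by simp
      have "(LINT x|lborel. indicator (box c d) x * h x) = (LINT x|lebesgue. indicator (box c d) x * h x)"
        by (subst integral_completion) auto
      also have "\<dots> = (LINT x|lebesgue. indicator (box c d) x * h0 x)"
      proof (rule integral_cong_AE)
        show "AE x in lebesgue. indicator (box c d) x * h x = indicator (box c d) x * h0 x"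
          using AE by eventually_elim simp
      qed (auto intro!: borel_measurable_times borel_measurable_indicator borel_measurable_integrable[OF h0]
          \<open>h \<in> borel_measurable lebesgue\<close> simp: borel_open)
      also have "\<dots> = (LINT x|lebesgue. indicat_real \<Omega> x *\<^sub>R (w x * indicat_real (box c' d') x))"
        unfolding h0_def cd[symmetric] by (intro Bochner_Integration.integral_cong) (auto simp: indicator_def)
      also have "\<dots> = (LINT x|lebesgue_on \<Omega>. w x * indicat_real (box c' d') x)"
        by (subst integral_restrict_space) auto
      also have "\<dots> = 0"
      \<comment> \<open>A nonempty open box has the closed box as its closure, which therefore stays
        inside \<open>cbox a b\<close>. An empty open box can have a nonempty degenerate closed box
        lying elsewhere, so it is treated separately.\<close>
      proof (cases "box c' d' = {}")
        case False
        then have "cbox c' d' = closure (box c' d')" by (simp add: closure_box)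
        also have "\<dots> \<subseteq> closure (box a b)" using cd by (intro closure_mono) blast
        also have "\<dots> \<subseteq> cbox a b" by (intro closure_minimal box_subset_cbox closed_cbox)
        finally show ?thesis using ab by (intro box0) blast
      qed simp
      finally show ?thesis .
    qed
    from AE_zero_if_box_integrals_zero[OF int this] have "AE x in lborel. h x = 0" .
    then have "AE x in lebesgue. h x = 0" by (rule AE_completion)
    then have "AE x in lebesgue. h0 x = 0" using AE by eventually_elim simp
    then have "AE x in lebesgue. x \<in> \<Omega> \<longrightarrow> x \<in> box a b \<longrightarrow> w x = 0"
      by eventually_elim (auto simp: h0_def)
    then show ?thesis by (subst AE_restrict_space_iff) auto
  qed
  have AE_cbox: "AE x in lebesgue_on \<Omega>. x \<in> cbox a b \<longrightarrow> w x = 0" if ab: "cbox a b \<subseteq> \<Omega>" for a b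
  proof -
    have "AE x in lebesgue. x \<notin> cbox a b - box a b"
      using negligible_frontier_interval[of a b] by (intro AE_not_in) (simp add: negligible_iff_null_sets)
    then have "AE x in lebesgue_on \<Omega>. x \<notin> cbox a b - box a b"
      by (subst AE_restrict_space_iff) auto
    then show ?thesis using AE_box[OF ab] by eventually_elim auto
  qed
  obtain \<D> where \<D>: "countable \<D>" "\<D> \<subseteq> Pow \<Omega>" "\<And>X. X \<in> \<D> \<Longrightarrow> \<exists>a b. X = cbox a b" "\<Union>\<D> = \<Omega>"
    by (rule open_countable_Union_open_cbox[OF \<Omega>]) blast
  have "AE x in lebesgue_on \<Omega>. \<forall>X\<in>\<D>. x \<in> X \<longrightarrow> w x = 0"
  proof (subst AE_ball_countable[OF \<D>(1)], intro ballI)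
    fix X assume "X \<in> \<D>"
    then show "AE x in lebesgue_on \<Omega>. x \<in> X \<longrightarrow> w x = 0" using \<D>(2,3) AE_cbox by (metis PowD subsetD)
  qed
  moreover have "AE x in lebesgue_on \<Omega>. x \<in> \<Omega>" by (intro AE_I2) simp
  ultimately show ?thesis
  proof eventually_elim
    case (elim x)
    then show ?case using \<D>(4) by blast
  qed
qed

section \<open>Riesz representation\<close>

text \<open>The part of the Riesz theorem that needs neither completeness nor definiteness: along a
  minimizing sequence of \<open>J x = a x x / 2 - l x\<close> the representation of \<open>l\<close>
  holds in the limit. Whoever uses it supplies the limit element.\<close>

lemma semi_inner_minimizing_sequence:
  fixes V :: "('a \<Rightarrow> 'b::real_vector) set" and a :: "('a \<Rightarrow> 'b) \<Rightarrow> ('a \<Rightarrow> 'b) \<Rightarrow> real" and l :: "('a \<Rightarrow> 'b) \<Rightarrow> real"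
  assumes V: "V \<noteq> {}" "\<And>x y c. x \<in> V \<Longrightarrow> y \<in> V \<Longrightarrow> (\<lambda>t. x t + c *\<^sub>R y t) \<in> V"
    and lin: "\<And>x y z c. x \<in> V \<Longrightarrow> y \<in> V \<Longrightarrow> z \<in> V \<Longrightarrow> a (\<lambda>t. x t + c *\<^sub>R y t) z = a x z + c * a y z"
    and sym: "\<And>x y. a x y = a y x"
    and nonneg: "\<And>x. 0 \<le> a x x"
    and l: "\<And>x y c. x \<in> V \<Longrightarrow> y \<in> V \<Longrightarrow> l (\<lambda>t. x t + c *\<^sub>R y t) = l x + c * l y"
    and bound: "\<And>x. x \<in> V \<Longrightarrow> \<bar>l x\<bar> \<le> C * sqrt (a x x)"
  obtains x where "\<And>n::nat. x n \<in> V"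
    "\<And>e. e > 0 \<Longrightarrow> \<exists>N. \<forall>i\<ge>N. \<forall>j\<ge>N. a (\<lambda>t. x i t - x j t) (\<lambda>t. x i t - x j t) < e"
    "\<And>y. y \<in> V \<Longrightarrow> (\<lambda>n. a (x n) y) \<longlonglongrightarrow> l y"
proof -
  define J where "J x = a x x / 2 - l x" for x
  have lin': "a z (\<lambda>t. x t + c *\<^sub>R y t) = a z x + c * a z y" if "x \<in> V" "y \<in> V" "z \<in> V" for x y z c
    using lin[OF that, of c] by (metis sym)
  have expand: "a (\<lambda>t. x t + c *\<^sub>R y t) (\<lambda>t. x t + c *\<^sub>R y t) = a x x + 2 * c * a x y + c\<^sup>2 * a y y"
    if "x \<in> V" "y \<in> V" for x y c
    unfolding lin[OF that V(2)[OF that]] lin'[OF that that(1)] lin'[OF that that(2)] sym[of y x]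
    by (simp add: power2_eq_square algebra_simps)
  \<comment> \<open>By the arithmetic-geometric mean inequality \<open>2 C r \<le> C^2 + r^2\<close>
    with \<open>r = sqrt (a x x)\<close>.\<close>
  have below: "- (C\<^sup>2 / 2) \<le> J x" if "x \<in> V" for x
  proof -
    have "l x \<le> C * sqrt (a x x)" using bound[OF that] by linarith
    moreover have "2 * (C * sqrt (a x x)) \<le> C\<^sup>2 + a x x"
      using sum_squares_bound[of C "sqrt (a x x)"] nonneg[of x] by simp
    ultimately show ?thesis by (simp add: J_def)
  qed
  define I where "I = Inf (J ` V)"
  have bdd: "bdd_below (J ` V)" by (rule bdd_belowI2[OF below])
  have I: "I \<le> J x" if "x \<in> V" for x
    unfolding I_def using that bdd by (auto intro: cInf_lower)
  define \<epsilon> where "\<epsilon> n = inverse (real (Suc n))" for n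
  have "\<exists>x\<in>V. J x < I + \<epsilon> n" for n
    using cInf_lessD[of "J ` V" "I + \<epsilon> n"] V(1) by (auto simp: I_def \<epsilon>_def)
  then obtain x where x: "\<And>n. x n \<in> V" "\<And>n. J (x n) < I + \<epsilon> n" by metis
  have \<epsilon>: "\<epsilon> \<longlonglongrightarrow> 0" unfolding \<epsilon>_def by (rule LIMSEQ_inverse_real_of_nat)
  show ?thesis
  proof (rule that[of x])
    show "x n \<in> V" for n by fact
    fix e :: real assume "e > 0"
    \<comment> \<open>The parallelogram estimate below costs
      \<open>4 (\<epsilon> i + \<epsilon> j)\<close>, which is less than \<open>e\<close> if both
      errors are below \<open>e / 8\<close>.\<close>
    then obtain N where N: "\<And>n. n \<ge> N \<Longrightarrow> \<epsilon> n < e / 8"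
      using order_tendstoD(2)[OF \<epsilon>, of "e / 8"] by (auto simp: eventually_sequentially)
    show "\<exists>N. \<forall>i\<ge>N. \<forall>j\<ge>N. a (\<lambda>t. x i t - x j t) (\<lambda>t. x i t - x j t) < e"
    proof (intro exI allI impI)
      fix i j assume ij: "i \<ge> N" "j \<ge> N"
      let ?d = "\<lambda>t. x i t + (-1) *\<^sub>R x j t"
      have d: "?d \<in> V" by (intro V x)
      \<comment> \<open>\<open>?m\<close> is the midpoint of \<open>x i\<close> and
        \<open>x j\<close>. Since \<open>J\<close> at the midpoint is the mean of the two values
        minus \<open>a ?d ?d / 8\<close>, and is at least the infimum \<open>I\<close>, the
        difference \<open>?d\<close> must be small.\<close>
      let ?m = "\<lambda>t. x i t + (- 1 / 2) *\<^sub>R ?d t"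
      have m: "?m \<in> V" by (intro V x)
      have d_exp: "a ?d ?d = a (x i) (x i) - 2 * a (x i) (x j) + a (x j) (x j)"
        using expand[OF x(1)[of i] x(1)[of j], of "-1"] by simp
      have m_exp: "a ?m ?m = a (x i) (x i) - a (x i) ?d + a ?d ?d / 4"
        using expand[OF x(1)[of i] d, of "-1/2"] by (simp add: power2_eq_square)
      have xd: "a (x i) ?d = a (x i) (x i) - a (x i) (x j)"
        using lin'[OF x(1)[of i] x(1)[of j] x(1)[of i], of "-1"] by simp
      have lm: "l ?m = l (x i) - l ?d / 2"
        using l[OF x(1)[of i] d, of "-1/2"] by simp
      have ld: "l ?d = l (x i) - l (x j)"
        using l[OF x(1)[of i] x(1)[of j], of "-1"] by simp
      have arith: "A < 4 * (r + s)"
        if "I \<le> Am / 2 - lm" "P / 2 - li < I + r" "R / 2 - lj < I + s" "A = P - 2 * Q + R"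
          "Am = P - (P - Q) + A / 4" "lm = li - (li - lj) / 2"
        for A Am P Q R li lj lm r s :: real
        using that by argo
      have "a ?d ?d < 4 * (\<epsilon> i + \<epsilon> j)"
        by (rule arith[OF I[OF m, unfolded J_def] x(2)[of i, unfolded J_def] x(2)[of j, unfolded J_def] d_exp
          m_exp[unfolded xd] lm[unfolded ld]])
      then show "a (\<lambda>t. x i t - x j t) (\<lambda>t. x i t - x j t) < e"
        using N[OF ij(1)] N[OF ij(2)] by simp
    qed
  next
    fix y assume y: "y \<in> V"
    \<comment> \<open>Moving from \<open>x n\<close> along \<open>y\<close> can lower
      \<open>J\<close> by at most \<open>\<epsilon> n\<close>. So a quadratic in \<open>t\<close> is
      nonnegative, and its discriminant bounds the defect \<open>a (x n) y - l y\<close>.\<close>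
    have le: "((a (x n) y - l y) / 2)\<^sup>2 \<le> \<epsilon> n * (a y y / 2)" for n
    proof (rule discriminant_nonpos)
      fix t
      have "I \<le> J (\<lambda>s. x n s + t *\<^sub>R y s)" by (intro I V x y)
      also have "\<dots> = J (x n) + 2 * t * ((a (x n) y - l y) / 2) + t\<^sup>2 * (a y y / 2)"
        unfolding J_def expand[OF x(1) y] l[OF x(1) y] by (simp add: field_simps)
      finally show "0 \<le> \<epsilon> n + 2 * t * ((a (x n) y - l y) / 2) + t\<^sup>2 * (a y y / 2)"
        using x(2)[of n] by linarith
    qed (simp add: nonneg)
    have "(\<lambda>n. ((a (x n) y - l y) / 2)\<^sup>2) \<longlonglongrightarrow> 0"
    proof (rule tendsto_sandwich[OF _ _ tendsto_const])
      show "(\<lambda>n. \<epsilon> n * (a y y / 2)) \<longlonglongrightarrow> 0" using tendsto_mult_left_zero[OF \<epsilon>] .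
    qed (use le in auto)
    then have "(\<lambda>n. (a (x n) y - l y) / 2) \<longlonglongrightarrow> 0" by (subst (asm) power_tendsto_0_iff) simp_all
    then have "(\<lambda>n. a (x n) y - l y) \<longlonglongrightarrow> 0" using tendsto_mult_right_zero[of _ _ 2] by force
    then show "(\<lambda>n. a (x n) y) \<longlonglongrightarrow> l y" by (rule LIM_zero_cancel)
  qed
qed

section \<open>Distributions represented by L2 functions\<close>

lemma represents_L2_rep: "in_L2 \<Omega> D \<Longrightarrow> represents \<Omega> D (L2_rep \<Omega> D)"
  using someI_ex[of "represents \<Omega> D"] by (simp add: in_L2_def L2_rep_def)

lemma distr_of_eq_L2_inner: "distr_of \<Omega> v \<phi> = L2_inner \<Omega> v \<phi>"
  by (simp add: distr_of_def L2_inner_def)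

lemma represents_unique:
  assumes "open \<Omega>" "represents \<Omega> D w" "represents \<Omega> D w'"
  shows "AE x in lebesgue_on \<Omega>. w x = w' x"
proof -
  have w: "w \<in> L2 \<Omega>" "w' \<in> L2 \<Omega>" using assms by (auto simp: represents_def)
  have "AE x in lebesgue_on \<Omega>. w x - w' x = 0"
  proof (rule fundamental_lemma[OF assms(1) L2_on_diff[OF w]])
    fix \<phi> assume \<phi>: "\<phi> \<in> test_functions \<Omega>"
    have "\<phi> \<in> L2 \<Omega>" using \<phi> assms(1) by (intro test_functions_L2) (auto simp: borel_open)
    from L2_inner_diff_left[OF w this] have
      "(LINT x|lebesgue_on \<Omega>. (w x - w' x) * \<phi> x) = distr_of \<Omega> w \<phi> - distr_of \<Omega> w' \<phi>"
      by (simp add: L2_inner_def distr_of_def)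
    also have "\<dots> = 0" using assms(2,3) \<phi> by (simp add: represents_def)
    finally show "(LINT x|lebesgue_on \<Omega>. (w x - w' x) * \<phi> x) = 0" .
  qed
  then show ?thesis by eventually_elim simp
qed

text \<open>Riesz representation on the \<open>L2\<close> closure of the test functions: the
  minimizing sequence consists of test functions, is Cauchy in \<open>L2\<close>, and its limit
  \<open>w\<close> represents \<open>D\<close>. This reduces membership in \<open>L2\<close> to an a
  priori bound.\<close>

lemma in_L2_if_bounded:
  fixes D :: "('d::finite) distr"
  assumes \<Omega>: "open \<Omega>" "bounded \<Omega>"
    and lin: "\<And>\<phi> \<psi> c. \<phi> \<in> test_functions \<Omega> \<Longrightarrow> \<psi> \<in> test_functions \<Omega> \<Longrightarrow> D (\<lambda>x. \<phi> x + c * \<psi> x) = D \<phi> + c * D \<psi>"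
    and bound: "\<And>\<phi>. \<phi> \<in> test_functions \<Omega> \<Longrightarrow> \<bar>D \<phi>\<bar> \<le> C * L2_norm \<Omega> \<phi>"
  shows "in_L2 \<Omega> D"
proof -
  have \<Omega>s: "\<Omega> \<in> sets lebesgue" using \<Omega> by (simp add: borel_open)
  have fin: "finite_measure (lebesgue_on \<Omega>)"
    using \<Omega> by (intro finite_measure_lebesgue_on lmeasurable_open)
  note L2 = test_functions_L2[OF _ \<Omega>s]
  obtain x where x: "\<And>n::nat. x n \<in> test_functions \<Omega>"
    "\<And>e. e > 0 \<Longrightarrow> \<exists>N. \<forall>i\<ge>N. \<forall>j\<ge>N. L2_inner \<Omega> (\<lambda>t. x i t - x j t) (\<lambda>t. x i t - x j t) < e"
    "\<And>\<phi>. \<phi> \<in> test_functions \<Omega> \<Longrightarrow> (\<lambda>n. L2_inner \<Omega> (x n) \<phi>) \<longlonglongrightarrow> D \<phi>"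
  proof (rule semi_inner_minimizing_sequence[of "test_functions \<Omega>" "L2_inner \<Omega>" D C])
    show "test_functions \<Omega> \<noteq> {}" using test_functions_zero by blast
    show "L2_inner \<Omega> (\<lambda>t. x t + c *\<^sub>R y t) z = L2_inner \<Omega> x z + c * L2_inner \<Omega> y z"
      if "x \<in> test_functions \<Omega>" "y \<in> test_functions \<Omega>" "z \<in> test_functions \<Omega>" for x y z c
      by (rule L2_inner_lincomb_left[OF L2[OF that(1)] L2[OF that(2)] L2[OF that(3)]])
    show "\<bar>D x\<bar> \<le> C * sqrt (L2_inner \<Omega> x x)" if "x \<in> test_functions \<Omega>" for x
      using bound[OF that] by (simp add: L2_norm_def)
  qed (auto simp: lin test_functions_lincomb L2_inner_commute L2_inner_self_nonneg)
  have "\<exists>N. \<forall>i\<ge>N. \<forall>j\<ge>N. L2_norm \<Omega> (\<lambda>t. x i t - x j t) < e" if e: "e > 0" for e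
  proof -
    obtain N where "\<forall>i\<ge>N. \<forall>j\<ge>N. L2_inner \<Omega> (\<lambda>t. x i t - x j t) (\<lambda>t. x i t - x j t) < e\<^sup>2"
      using x(2)[of "e\<^sup>2"] e by auto
    moreover have "L2_norm \<Omega> f < e" if "L2_inner \<Omega> f f < e\<^sup>2" for f :: "real^'d \<Rightarrow> real"
      using real_sqrt_less_mono[OF that] e by (simp add: L2_norm_def)
    ultimately show ?thesis by blast
  qed
  then obtain w where w: "w \<in> L2 \<Omega>" "(\<lambda>n. L2_norm \<Omega> (\<lambda>t. x n t - w t)) \<longlonglongrightarrow> 0"
    by (rule L2_complete[of \<Omega> x, OF fin L2[OF x(1)]])
  have "D \<phi> = distr_of \<Omega> w \<phi>" if "\<phi> \<in> test_functions \<Omega>" for \<phi>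
    using LIMSEQ_unique[OF x(3)[OF that] L2_inner_tendsto[OF L2[OF x(1)] w(1) L2[OF that] w(2)]]
    by (simp add: distr_of_eq_L2_inner)
  then show ?thesis using w(1) by (auto simp: in_L2_def represents_def)
qed

lemma L2_norm_translate:
  fixes \<phi> :: "real^'d::finite \<Rightarrow> real"
  assumes "\<phi> \<in> test_functions \<Omega>" "(\<lambda>x. \<phi> (x - a)) \<in> test_functions \<Omega>" "\<Omega> \<in> sets lebesgue"
  shows "L2_norm \<Omega> (\<lambda>x. \<phi> (x - a)) = L2_norm \<Omega> \<phi>"
proof -
  have "L2_inner \<Omega> (\<lambda>x. \<phi> (x - a)) (\<lambda>x. \<phi> (x - a)) = (LINT x|lebesgue. \<phi> (x - a) * \<phi> (x - a))"
    unfolding L2_inner_def inner_real_def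
    using test_functions_zero_outside[OF assms(2)] assms(3) by (intro lebesgue_on_integral_zero_outside) auto
  also have "\<dots> = (LINT x|lebesgue. \<phi> x * \<phi> x)"
    using lebesgue_integral_translate[of "\<lambda>x. \<phi> x * \<phi> x" a]
      smooth_measurable[OF smooth_mult[OF test_functions_smooth[OF assms(1)] test_functions_smooth[OF assms(1)]]] by simp
  also have "\<dots> = L2_inner \<Omega> \<phi> \<phi>"
    unfolding L2_inner_def inner_real_def
    using test_functions_zero_outside[OF assms(1)] assms(3) by (intro lebesgue_on_integral_zero_outside[symmetric]) auto
  finally show ?thesis by (simp add: L2_norm_def)
qed

lemma L2_norm_mult_le:
  assumes "f \<in> L2 \<Omega>" "(\<lambda>x. \<psi> x * f x) \<in> L2 \<Omega>" "\<And>x. \<bar>\<psi> x\<bar> \<le> 1"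
  shows "L2_norm \<Omega> (\<lambda>x. \<psi> x * f x) \<le> L2_norm \<Omega> (f :: _ \<Rightarrow> real)"
proof (rule power2_le_imp_le)
  show "(L2_norm \<Omega> (\<lambda>x. \<psi> x * f x))\<^sup>2 \<le> (L2_norm \<Omega> f)\<^sup>2"
    unfolding L2_norm_sq_integral
  proof (rule integral_mono)
    fix x
    have "\<bar>\<psi> x\<bar> * \<bar>f x\<bar> \<le> 1 * \<bar>f x\<bar>" by (intro mult_right_mono assms) simp
    then show "(norm (\<psi> x * f x))\<^sup>2 \<le> (norm (f x))\<^sup>2" by (intro power_mono) (auto simp: abs_mult)
  qed (use assms in \<open>auto simp: L2_on_def\<close>)
qed (rule L2_norm_nonneg)

section \<open>Intermediate derivatives on Lipschitz domains\<close>

text \<open>Testing \<open>v\<close> with the translates of \<open>\<phi>\<close> gives a scalar function \<open>F\<close> whose values and second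
  derivatives are controlled by \<open>v\<close> and its second weak derivatives; \<open>F' 0\<close> is the first weak derivative
  of \<open>v\<close> tested with \<open>\<phi>\<close>.\<close>

lemma directional_derivative_bound:
  fixes v \<phi> :: "real^'d::finite \<Rightarrow> real"
  assumes \<Omega>: "\<Omega> \<in> sets lebesgue" and v: "v \<in> L2 \<Omega>"
    and \<phi>: "\<And>t. 0 \<le> t \<Longrightarrow> t \<le> h \<Longrightarrow> (\<lambda>x. \<phi> (x - t *\<^sub>R \<xi>)) \<in> test_functions \<Omega>"
    and h: "h > 0"
    and K: "\<And>i j \<psi>. \<psi> \<in> test_functions \<Omega> \<Longrightarrow> \<bar>LINT x|lebesgue_on \<Omega>. v x * partial i (partial j \<psi>) x\<bar> \<le> K * L2_norm \<Omega> \<psi>"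
  shows "\<bar>LINT x|lebesgue_on \<Omega>. v x * (\<Sum>i\<in>UNIV. \<xi> $ i * partial i \<phi> x)\<bar>
    \<le> (2 / h * L2_norm \<Omega> v + h / 2 * ((\<Sum>i\<in>UNIV. \<Sum>j\<in>UNIV. \<bar>\<xi> $ i\<bar> * \<bar>\<xi> $ j\<bar>) * K)) * L2_norm \<Omega> \<phi>"
proof -
  define s where "s = (\<Sum>i\<in>UNIV. \<Sum>j\<in>UNIV. \<bar>\<xi> $ i\<bar> * \<bar>\<xi> $ j\<bar>)"
  have \<phi>0: "\<phi> \<in> test_functions \<Omega>" using \<phi>[of 0] h by simp
  obtain S where S: "smooth \<phi>" "compact S" "S \<subseteq> \<Omega>" "\<And>x. x \<notin> S \<Longrightarrow> \<phi> x = 0"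
    using \<phi>0 by (rule test_functionsE) blast
  \<comment> \<open>With this sign \<open>D f\<close> is the derivative of the translates
    \<open>f (x - t \<xi>)\<close> in \<open>t\<close>.\<close>
  define D where "D f x = - (\<Sum>i\<in>UNIV. \<xi> $ i * partial i f x)" for f :: "real^'d \<Rightarrow> real" and x
  have D_smooth: "smooth (D f)" if "smooth f" for f
  proof -
    have "smooth (\<lambda>x. 0 - (\<Sum>i\<in>UNIV. \<xi> $ i * partial i f x))"
      by (intro smooth_diff smooth_sum smooth_mult smooth_const smooth_partial that) simp
    moreover have "(\<lambda>x. 0 - (\<Sum>i\<in>UNIV. \<xi> $ i * partial i f x)) = D f" by (simp add: D_def fun_eq_iff)
    ultimately show ?thesis by simp
  qed
  have D_zero: "D f x = 0" if "\<And>x. x \<notin> S \<Longrightarrow> f x = 0" "x \<notin> S" for f x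
    unfolding D_def using partial_zero_outside[OF compact_imp_closed[OF S(2)] that] by simp
  define F where "F f t = (LINT x|lebesgue_on \<Omega>. v x * f (x - t *\<^sub>R \<xi>))" for f :: "real^'d \<Rightarrow> real" and t
  have DF: "(F f has_real_derivative F (D f) t) (at t)" if "smooth f" "\<And>x. x \<notin> S \<Longrightarrow> f x = 0" for f t
    unfolding F_def D_def using deriv_integral_translate[OF \<Omega> v that(1) S(2) that(2)] .
  define diff where "diff m = (if m = 0 then F \<phi> else if m = 1 then F (D \<phi>) else F (D (D \<phi>)))" for m :: nat
  have "\<exists>t>0. t < h \<and> F \<phi> h = (\<Sum>m<2. diff m 0 / fact m * h ^ m) + diff 2 t / fact 2 * h ^ 2"
  proof (rule Maclaurin)
    show "\<forall>m t. m < 2 \<and> 0 \<le> t \<and> t \<le> h \<longrightarrow> (diff m has_real_derivative diff (Suc m) t) (at t)"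
    proof (intro allI impI)
      fix m t assume "m < (2::nat) \<and> 0 \<le> t \<and> t \<le> h"
      then consider "m = 0" | "m = 1" by linarith
      then show "(diff m has_real_derivative diff (Suc m) t) (at t)"
        by cases (auto simp: diff_def intro!: DF S D_smooth D_zero)
    qed
  qed (use h in \<open>auto simp: diff_def\<close>)
  then obtain t where t: "0 < t" "t < h" "F \<phi> h = F \<phi> 0 + F (D \<phi>) 0 * h + F (D (D \<phi>)) t / 2 * h\<^sup>2"
    by (auto simp: diff_def numeral_2_eq_2)
  let ?n = "L2_norm \<Omega> \<phi>"
  have F_le: "\<bar>F \<phi> r\<bar> \<le> L2_norm \<Omega> v * ?n" if "0 \<le> r" "r \<le> h" for r
    using L2_Cauchy_Schwarz[OF v test_functions_L2[OF \<phi>[OF that] \<Omega>]] L2_norm_translate[OF \<phi>0 \<phi>[OF that] \<Omega>]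
    by (simp add: F_def L2_inner_def)
  have "\<bar>F (D (D \<phi>)) t\<bar> \<le> s * K * ?n"
  proof -
    \<comment> \<open>The hypothesis on second derivatives is applied to the translate of
      \<open>\<phi>\<close> at the intermediate point \<open>t\<close>. It is a test function on
      \<open>\<Omega>\<close> with the same norm as \<open>\<phi>\<close>.\<close>
    let ?\<psi> = "\<lambda>x. \<phi> (x - t *\<^sub>R \<xi>)"
    have \<psi>: "?\<psi> \<in> test_functions \<Omega>" using t \<phi> by simp
    have part: "partial i (partial j ?\<psi>) = (\<lambda>x. partial i (partial j \<phi>) (x - t *\<^sub>R \<xi>))" for i j
      using S(1) by (simp add: partial_translate smooth_partial)
    have DD: "D (D \<phi>) y = (\<Sum>i\<in>UNIV. \<Sum>j\<in>UNIV. \<xi> $ i * \<xi> $ j * partial i (partial j \<phi>) y)" for y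
    proof -
      have "partial i (D \<phi>) y = - (\<Sum>j\<in>UNIV. \<xi> $ j * partial i (partial j \<phi>) y)" for i
      proof -
        have "((D \<phi>) has_derivative (\<lambda>h. - (\<Sum>j\<in>UNIV. \<xi> $ j * frechet_derivative (partial j \<phi>) (at y) h))) (at y)"
          unfolding D_def
          by (intro derivative_intros smooth_has_derivative smooth_partial S)
        then show ?thesis by (simp add: partial_eq) (simp add: partial_def)
      qed
      then show ?thesis by (simp add: D_def[of "D \<phi>"] sum_negf sum_distrib_left mult.assoc)
    qed
    have int: "integrable (lebesgue_on \<Omega>) (\<lambda>x. v x * partial i (partial j ?\<psi>) x)" for i j
      by (intro integrable_mult_L2[OF v] test_functions_L2[OF test_functions_partial[OF test_functions_partial[OF \<psi>]] \<Omega>])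
    have "F (D (D \<phi>)) t = (LINT x|lebesgue_on \<Omega>. (\<Sum>i\<in>UNIV. \<Sum>j\<in>UNIV. \<xi> $ i * \<xi> $ j * (v x * partial i (partial j ?\<psi>) x)))"
      unfolding F_def DD part by (intro Bochner_Integration.integral_cong) (auto simp: sum_distrib_left mult_ac)
    also have "\<dots> = (\<Sum>i\<in>UNIV. \<Sum>j\<in>UNIV. \<xi> $ i * \<xi> $ j * (LINT x|lebesgue_on \<Omega>. v x * partial i (partial j ?\<psi>) x))"
      using int by simp
    also have "\<bar>\<dots>\<bar> \<le> (\<Sum>i\<in>UNIV. \<Sum>j\<in>UNIV. \<bar>\<xi> $ i\<bar> * \<bar>\<xi> $ j\<bar> * (K * ?n))"
    proof (intro order_trans[OF sum_abs] sum_mono)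
      fix i j
      have "\<bar>\<xi> $ i * \<xi> $ j * (LINT x|lebesgue_on \<Omega>. v x * partial i (partial j ?\<psi>) x)\<bar>
        = \<bar>\<xi> $ i\<bar> * \<bar>\<xi> $ j\<bar> * \<bar>LINT x|lebesgue_on \<Omega>. v x * partial i (partial j ?\<psi>) x\<bar>"
        by (simp only: abs_mult)
      also have "\<dots> \<le> \<bar>\<xi> $ i\<bar> * \<bar>\<xi> $ j\<bar> * (K * ?n)"
        using K[OF \<psi>, of i j] L2_norm_translate[OF \<phi>0 \<psi> \<Omega>] by (intro mult_left_mono) auto
      finally show "\<bar>\<xi> $ i * \<xi> $ j * (LINT x|lebesgue_on \<Omega>. v x * partial i (partial j ?\<psi>) x)\<bar> \<le> \<bar>\<xi> $ i\<bar> * \<bar>\<xi> $ j\<bar> * (K * ?n)" .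
    qed
    finally show ?thesis by (simp add: s_def sum_distrib_right mult.assoc)
  qed
  then have "\<bar>F (D (D \<phi>)) t / 2 * h\<^sup>2\<bar> \<le> s * K * ?n / 2 * h\<^sup>2"
    by (simp add: abs_mult mult_right_mono)
  moreover have "\<bar>F \<phi> 0\<bar> \<le> L2_norm \<Omega> v * ?n" "\<bar>F \<phi> h\<bar> \<le> L2_norm \<Omega> v * ?n" using F_le h by auto
  \<comment> \<open>Taylor's formula solved for
    \<open>h F'(0) = F(h) - F(0) - h^2 F''(t) / 2\<close>. Division by \<open>h\<close> gives the
    constants \<open>2 / h\<close> and \<open>h / 2\<close> of the statement.\<close>
  ultimately have "\<bar>F (D \<phi>) 0 * h\<bar> \<le> 2 * (L2_norm \<Omega> v * ?n) + s * K * ?n / 2 * h\<^sup>2"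
    using t(3) by linarith
  then have "\<bar>F (D \<phi>) 0\<bar> \<le> (2 * (L2_norm \<Omega> v * ?n) + s * K * ?n / 2 * h\<^sup>2) / h"
    using h by (simp add: abs_mult pos_le_divide_eq)
  also have "\<dots> = (2 / h * L2_norm \<Omega> v + h / 2 * (s * K)) * ?n"
    using h by (simp add: field_simps power2_eq_square)
  finally show ?thesis by (simp add: F_def D_def s_def)
qed

text \<open>A step \<open>t \<xi>\<close> with \<open>\<xi> = e + \<eta>\<close> raises the height
  over the boundary graph by \<open>t (1 + \<eta> \<bullet> e)\<close>, while the graph itself rises
  by at most \<open>2 L t norm \<eta>\<close>; for small \<open>\<eta>\<close> the point stays above
  it. A whole ball of directions is provided because coordinate derivatives are obtained as
  differences of two directional ones.\<close>

lemma lipschitz_boundary_cone: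
  fixes \<Omega> :: "(real^'d::finite) set"
  assumes \<Omega>: "open \<Omega>" "lipschitz_boundary \<Omega>" and x: "x \<in> closure \<Omega>"
  obtains r h \<delta> e where "0 < r" "0 < h" "0 < \<delta>"
    "\<And>y \<xi> t. y \<in> \<Omega> \<Longrightarrow> y \<in> ball x r \<Longrightarrow> \<xi> \<in> ball e \<delta> \<Longrightarrow> 0 \<le> t \<Longrightarrow> t \<le> h \<Longrightarrow> y + t *\<^sub>R \<xi> \<in> \<Omega>"
proof (cases "x \<in> \<Omega>")
  case True
  then obtain R where R: "R > 0" "ball x R \<subseteq> \<Omega>" using \<Omega>(1) openE by blast
  \<comment> \<open>Around an interior point the directions may be centred at 0: every shift shorter
    than \<open>R / 2\<close> stays inside the ball.\<close>
  show ?thesis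
  proof (rule that[of "R/2" "R/2" 1 0])
    fix y \<xi> :: "real^'d" and t
    assume a: "y \<in> ball x (R/2)" "\<xi> \<in> ball 0 1" "0 \<le> t" "t \<le> R/2"
    have "norm (t *\<^sub>R \<xi>) \<le> R/2 * 1"
      using a by (simp only: norm_scaleR) (intro mult_mono, auto)
    moreover have "dist x (y + t *\<^sub>R \<xi>) \<le> dist x y + norm (t *\<^sub>R \<xi>)"
      using dist_triangle[of x "y + t *\<^sub>R \<xi>" y] by (simp add: dist_norm)
    ultimately have "y + t *\<^sub>R \<xi> \<in> ball x R" using a(1) by simp
    then show "y + t *\<^sub>R \<xi> \<in> \<Omega>" using R by blast
  qed (use R in auto)
next
  case False
  then have "x \<in> frontier \<Omega>" using x \<Omega>(1) by (simp add: frontier_def interior_open)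
  then obtain r e L g where r: "r > 0" "norm e = 1" "L-lipschitz_on UNIV g"
    "\<And>y. y \<in> ball x r \<Longrightarrow> y \<in> \<Omega> \<longleftrightarrow> y \<bullet> e > g (y - (y \<bullet> e) *\<^sub>R e)"
    using \<Omega>(2) unfolding lipschitz_boundary_def by (metis (no_types, lifting))
  have L: "L \<ge> 0" using r(3) by (rule lipschitz_on_nonneg)
  have ee: "e \<bullet> e = 1" using r(2) by (simp add: dot_square_norm)
  \<comment> \<open>This is the threshold at which \<open>norm \<eta> (1 + 2 L) \<le> 1\<close>,
    that is, \<open>2 L norm \<eta> \<le> 1 - norm \<eta> \<le> 1 + \<eta> \<bullet>
    e\<close>.\<close>
  define \<delta> where "\<delta> = 1 / (1 + 2 * L)"
  have \<delta>: "0 < \<delta>" "\<delta> \<le> 1" "\<delta> * (1 + 2 * L) = 1" using L by (auto simp: \<delta>_def divide_simps)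
  show ?thesis
  \<comment> \<open>Since \<open>norm \<xi> < 2\<close>, steps up to \<open>r / 4\<close> move a
    point by at most \<open>r / 2\<close>, so it remains in the ball in which the graph describes
    \<open>\<Omega>\<close>.\<close>
  proof (rule that[of "r/2" "r/4" \<delta> e])
    fix y \<xi> :: "real^'d" and t
    assume y: "y \<in> \<Omega>" "y \<in> ball x (r/2)" and \<xi>: "\<xi> \<in> ball e \<delta>" and t: "0 \<le> t" "t \<le> r/4"
    define \<eta> where "\<eta> = \<xi> - e"
    have \<eta>: "norm \<eta> < \<delta>" using \<xi> by (simp add: \<eta>_def dist_norm norm_minus_commute)
    have \<xi>_eq: "\<xi> = e + \<eta>" by (simp add: \<eta>_def)
    have n\<xi>: "norm \<xi> < 2"
      using norm_triangle_ineq[of e \<eta>] \<eta> \<delta> r(2) by (simp add: \<xi>_eq)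
    have "norm (t *\<^sub>R \<xi>) \<le> r/4 * 2"
      using t n\<xi> r(1) by (simp only: norm_scaleR) (intro mult_mono, auto)
    moreover have "dist x (y + t *\<^sub>R \<xi>) \<le> dist x y + norm (t *\<^sub>R \<xi>)"
      using dist_triangle[of x "y + t *\<^sub>R \<xi>" y] by (simp add: dist_norm)
    ultimately have b: "y + t *\<^sub>R \<xi> \<in> ball x r" using y(2) by simp
    have \<eta>e: "\<bar>\<eta> \<bullet> e\<bar> \<le> norm \<eta>" using Cauchy_Schwarz_ineq2[of \<eta> e] r(2) by simp
    let ?p = "\<lambda>y. y - (y \<bullet> e) *\<^sub>R e"
    have "?p (y + t *\<^sub>R \<xi>) - ?p y = t *\<^sub>R (\<eta> - (\<eta> \<bullet> e) *\<^sub>R e)"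
      by (simp add: \<xi>_eq inner_add_left ee algebra_simps)
    moreover have "norm (\<eta> - (\<eta> \<bullet> e) *\<^sub>R e) \<le> norm \<eta> + norm ((\<eta> \<bullet> e) *\<^sub>R e)" by (rule norm_triangle_ineq4)
    moreover have "norm ((\<eta> \<bullet> e) *\<^sub>R e) \<le> norm \<eta>" using \<eta>e r(2) by simp
    ultimately have "dist (?p (y + t *\<^sub>R \<xi>)) (?p y) \<le> t * (2 * norm \<eta>)"
      using t(1) by (simp add: dist_norm mult_left_mono)
    moreover have "dist (g (?p (y + t *\<^sub>R \<xi>))) (g (?p y)) \<le> L * dist (?p (y + t *\<^sub>R \<xi>)) (?p y)"
      using r(3) by (auto intro: lipschitz_onD)
    ultimately have "dist (g (?p (y + t *\<^sub>R \<xi>))) (g (?p y)) \<le> L * (t * (2 * norm \<eta>))"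
      using L by (meson mult_left_mono order_trans)
    then have g: "g (?p (y + t *\<^sub>R \<xi>)) \<le> g (?p y) + t * (2 * L * norm \<eta>)"
      by (simp add: dist_real_def algebra_simps)
    have "norm \<eta> * (1 + 2 * L) \<le> 1" using \<eta> \<delta>(3) L mult_right_mono[of "norm \<eta>" \<delta> "1 + 2 * L"] by simp
    then have "t * (2 * L * norm \<eta>) \<le> t * (1 + \<eta> \<bullet> e)"
      using \<eta>e t(1) by (intro mult_left_mono) (auto simp: algebra_simps)
    moreover have "(y + t *\<^sub>R \<xi>) \<bullet> e = y \<bullet> e + t * (1 + \<eta> \<bullet> e)"
      by (simp add: \<xi>_eq inner_add_left ee algebra_simps)
    moreover have "g (?p y) < y \<bullet> e" using r(4)[of y] y r(1) by simp
    ultimately have "g (?p (y + t *\<^sub>R \<xi>)) < (y + t *\<^sub>R \<xi>) \<bullet> e" using g by linarith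
    then show "y + t *\<^sub>R \<xi> \<in> \<Omega>" using r(4)[OF b] by simp
  qed (use r \<delta> in auto)
qed

text \<open>The direction \<open>e\<close> and its perturbation by \<open>\<delta> / 2\<close> times
  the \<open>i\<close>-th unit vector are both admissible translation directions. The
  \<open>i\<close>-th partial derivative is \<open>2 / \<delta>\<close> times the difference of the
  two directional derivatives.\<close>

lemma local_partial_bound:
  fixes v :: "real^'d::finite \<Rightarrow> real"
  assumes \<Omega>: "open \<Omega>" "lipschitz_boundary \<Omega>" and x: "x \<in> closure \<Omega>" and v: "v \<in> L2 \<Omega>"
    and K: "\<And>i j \<psi>. \<psi> \<in> test_functions \<Omega> \<Longrightarrow> \<bar>LINT x|lebesgue_on \<Omega>. v x * partial i (partial j \<psi>) x\<bar> \<le> K * L2_norm \<Omega> \<psi>"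
  obtains r C where "0 < r" "0 \<le> C" "\<And>\<phi>. \<phi> \<in> test_functions \<Omega> \<Longrightarrow> (\<And>y. y \<notin> ball x r \<Longrightarrow> \<phi> y = 0) \<Longrightarrow>
      \<bar>LINT x|lebesgue_on \<Omega>. v x * partial i \<phi> x\<bar> \<le> C * L2_norm \<Omega> \<phi>"
proof -
  have \<Omega>s: "\<Omega> \<in> sets lebesgue" using \<Omega> by (simp add: borel_open)
  obtain r h \<delta> e where cone: "0 < r" "0 < h" "0 < \<delta>"
    "\<And>y \<xi> t. y \<in> \<Omega> \<Longrightarrow> y \<in> ball x r \<Longrightarrow> \<xi> \<in> ball e \<delta> \<Longrightarrow> 0 \<le> t \<Longrightarrow> t \<le> h \<Longrightarrow> y + t *\<^sub>R \<xi> \<in> \<Omega>"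
    using lipschitz_boundary_cone[OF \<Omega> x] by blast
  \<comment> \<open>The absolute value of \<open>K\<close> keeps the constant nonnegative, as
    \<open>K\<close> comes without a sign.\<close>
  define C where "C \<xi> = 2 / h * L2_norm \<Omega> v + h / 2 * ((\<Sum>i\<in>UNIV. \<Sum>j\<in>UNIV. \<bar>\<xi> $ i\<bar> * \<bar>\<xi> $ j\<bar>) * \<bar>K\<bar>)"
    for \<xi> :: "real^'d"
  have C: "0 \<le> C \<xi>" for \<xi> using cone L2_norm_nonneg[of \<Omega> v] unfolding C_def
    by (intro add_nonneg_nonneg mult_nonneg_nonneg sum_nonneg) auto
  define \<xi> where "\<xi> = e + (\<delta> / 2) *\<^sub>R axis i 1"
  have \<xi>: "\<xi> \<in> ball e \<delta>" "e \<in> ball e \<delta>" using cone(3) by (auto simp: \<xi>_def dist_norm)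
  show ?thesis
  proof (rule that[of "r/2" "2 / \<delta> * (C \<xi> + C e)"])
    fix \<phi> assume \<phi>: "\<phi> \<in> test_functions \<Omega>" and sub: "\<And>y. y \<notin> ball x (r/2) \<Longrightarrow> \<phi> y = 0"
    obtain S where S: "smooth \<phi>" "compact S" "S \<subseteq> \<Omega>" "\<And>x. x \<notin> S \<Longrightarrow> \<phi> x = 0"
      using \<phi> by (rule test_functionsE) blast
    \<comment> \<open>\<open>\<phi>\<close> vanishes outside the half ball; its support is
      intersected with the closed half ball to get a compact set inside \<open>ball x r\<close>,
      where the admissible shifts are available.\<close>
    define S' where "S' = S \<inter> cball x (r/2)"
    have S': "compact S'" "S' \<subseteq> \<Omega>" "S' \<subseteq> ball x r" "\<And>x. x \<notin> S' \<Longrightarrow> \<phi> x = 0"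
      using S sub cone(1) by (auto simp: S'_def)
    have int: "integrable (lebesgue_on \<Omega>) (\<lambda>x. v x * partial i \<phi> x)" for i
      by (intro integrable_mult_L2[OF v] test_functions_L2[OF test_functions_partial[OF \<phi>] \<Omega>s])
    define I where "I i = (LINT x|lebesgue_on \<Omega>. v x * partial i \<phi> x)" for i
    have dir: "\<bar>\<Sum>i\<in>UNIV. \<zeta> $ i * I i\<bar> \<le> C \<zeta> * L2_norm \<Omega> \<phi>" if \<zeta>: "\<zeta> \<in> ball e \<delta>" for \<zeta>
    proof -
      have "\<bar>LINT x|lebesgue_on \<Omega>. v x * (\<Sum>i\<in>UNIV. \<zeta> $ i * partial i \<phi> x)\<bar> \<le> C \<zeta> * L2_norm \<Omega> \<phi>"
        unfolding C_def
      proof (rule directional_derivative_bound[OF \<Omega>s v _ cone(2)])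
        fix t assume t: "0 \<le> t" "t \<le> h"
        show "(\<lambda>x. \<phi> (x - t *\<^sub>R \<zeta>)) \<in> test_functions \<Omega>"
        proof (rule test_functionsI)
          show "smooth (\<lambda>x. \<phi> (x - t *\<^sub>R \<zeta>))" by (intro smooth_translate S)
          show "compact ((+) (t *\<^sub>R \<zeta>) ` S')" using S'(1) by (rule compact_translation)
          show "(+) (t *\<^sub>R \<zeta>) ` S' \<subseteq> \<Omega>" 
          proof (rule image_subsetI)
            fix y assume "y \<in> S'"
            then have "y \<in> \<Omega>" "y \<in> ball x r" using S'(2,3) by blast+
            from cone(4)[OF this \<zeta> t] show "t *\<^sub>R \<zeta> + y \<in> \<Omega>" by (simp add: add.commute)
          qed
          show "\<phi> (x - t *\<^sub>R \<zeta>) = 0" if "x \<notin> (+) (t *\<^sub>R \<zeta>) ` S'" for x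
          proof (rule S'(4))
            show "x - t *\<^sub>R \<zeta> \<notin> S'"
              using that image_eqI[of x "(+) (t *\<^sub>R \<zeta>)" "x - t *\<^sub>R \<zeta>" S'] by auto
          qed
        qed
      next
        fix i j \<psi> assume "\<psi> \<in> test_functions \<Omega>"
        then have "\<bar>LINT x|lebesgue_on \<Omega>. v x * partial i (partial j \<psi>) x\<bar> \<le> K * L2_norm \<Omega> \<psi>" by (rule K)
        also have "\<dots> \<le> \<bar>K\<bar> * L2_norm \<Omega> \<psi>" by (intro mult_right_mono L2_norm_nonneg) simp
        finally show "\<bar>LINT x|lebesgue_on \<Omega>. v x * partial i (partial j \<psi>) x\<bar> \<le> \<bar>K\<bar> * L2_norm \<Omega> \<psi>" .
      qed
      also have "(LINT x|lebesgue_on \<Omega>. v x * (\<Sum>i\<in>UNIV. \<zeta> $ i * partial i \<phi> x)) = (\<Sum>i\<in>UNIV. \<zeta> $ i * I i)"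
      proof -
        have "(LINT x|lebesgue_on \<Omega>. v x * (\<Sum>i\<in>UNIV. \<zeta> $ i * partial i \<phi> x))
            = (LINT x|lebesgue_on \<Omega>. (\<Sum>i\<in>UNIV. \<zeta> $ i * (v x * partial i \<phi> x)))"
          by (intro Bochner_Integration.integral_cong) (auto simp: sum_distrib_left mult_ac)
        then show ?thesis using int by (simp add: I_def)
      qed
      finally show ?thesis .
    qed
    have "(\<Sum>j\<in>UNIV. \<xi> $ j * I j) = (\<Sum>j\<in>UNIV. e $ j * I j) + (\<delta> / 2) * I i"
      by (simp add: \<xi>_def algebra_simps sum.distrib axis_def if_distrib[of "\<lambda>x. _ * x"] cong: if_cong)
    then have "\<bar>(\<delta> / 2) * I i\<bar> \<le> (C \<xi> + C e) * L2_norm \<Omega> \<phi>"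
      using dir[OF \<xi>(1)] dir[OF \<xi>(2)] unfolding distrib_right by linarith
    then show "\<bar>LINT x|lebesgue_on \<Omega>. v x * partial i \<phi> x\<bar> \<le> 2 / \<delta> * (C \<xi> + C e) * L2_norm \<Omega> \<phi>"
      using cone(3) by (simp add: I_def abs_mult field_simps)
  qed (use cone C in auto)
qed

text \<open>The closure is covered by finitely many half balls, and the induction peels off one ball
  at a time by \<open>\<phi> = \<psi> \<phi> + (1 - \<psi>) \<phi>\<close>. Because the bounds
  contain only \<open>L2_norm\<close> of the test function, neither factor increases them and
  derivatives of \<open>\<psi>\<close> do not enter.\<close>

lemma partial_bound:
  fixes v :: "real^'d::finite \<Rightarrow> real"
  assumes \<Omega>: "open \<Omega>" "bounded \<Omega>" "lipschitz_boundary \<Omega>" and v: "v \<in> L2 \<Omega>"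
    and K: "\<And>i j \<psi>. \<psi> \<in> test_functions \<Omega> \<Longrightarrow> \<bar>LINT x|lebesgue_on \<Omega>. v x * partial i (partial j \<psi>) x\<bar> \<le> K * L2_norm \<Omega> \<psi>"
  obtains C where "\<And>\<phi>. \<phi> \<in> test_functions \<Omega> \<Longrightarrow>
      \<bar>LINT x|lebesgue_on \<Omega>. v x * partial i \<phi> x\<bar> \<le> C * L2_norm \<Omega> \<phi>"
proof -
  have \<Omega>s: "\<Omega> \<in> sets lebesgue" using \<Omega> by (simp add: borel_open)
  define Q where "Q x r C \<longleftrightarrow> 0 < r \<and> 0 \<le> C \<and> (\<forall>\<phi>\<in>test_functions \<Omega>. (\<forall>y. y \<notin> ball x r \<longrightarrow> \<phi> y = 0) \<longrightarrow>
      \<bar>LINT x|lebesgue_on \<Omega>. v x * partial i \<phi> x\<bar> \<le> C * L2_norm \<Omega> \<phi>)" for x r C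
  have "\<exists>r C. Q x r C" if x: "x \<in> closure \<Omega>" for x
  proof (rule local_partial_bound[OF \<Omega>(1,3) x v K, of i])
    fix r C
    assume "0 < r" "0 \<le> C" "\<And>\<phi>. \<phi> \<in> test_functions \<Omega> \<Longrightarrow> (\<And>y. y \<notin> ball x r \<Longrightarrow> \<phi> y = 0) \<Longrightarrow>
      \<bar>LINT x|lebesgue_on \<Omega>. v x * partial i \<phi> x\<bar> \<le> C * L2_norm \<Omega> \<phi>"
    then have "Q x r C" unfolding Q_def by simp
    then show "\<exists>r C. Q x r C" by blast
  qed
  then have "\<forall>x\<in>closure \<Omega>. \<exists>r C. Q x r C" by blast
  then obtain r c where rcQ: "\<And>x. x \<in> closure \<Omega> \<Longrightarrow> Q x (r x) (c x)" by metis
  have rc: "0 < r x" "0 \<le> c x"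
    "\<phi> \<in> test_functions \<Omega> \<Longrightarrow> (\<And>y. y \<notin> ball x (r x) \<Longrightarrow> \<phi> y = 0) \<Longrightarrow>
      \<bar>LINT x|lebesgue_on \<Omega>. v x * partial i \<phi> x\<bar> \<le> c x * L2_norm \<Omega> \<phi>" if "x \<in> closure \<Omega>" for x \<phi>
    using rcQ[OF that] by (simp_all add: Q_def)
  have "compact (closure \<Omega>)" using \<Omega>(2) by simp
  \<comment> \<open>The half radii leave room for a cutoff that is 1 on the half ball and supported
    in the full ball, on which the local bound is known.\<close>
  moreover have "closure \<Omega> \<subseteq> (\<Union>x\<in>closure \<Omega>. ball x (r x / 2))"
    using rc(1) by fastforce
  ultimately obtain X where X: "X \<subseteq> closure \<Omega>" "finite X" "closure \<Omega> \<subseteq> (\<Union>x\<in>X. ball x (r x / 2))"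
    using compactE_image[of "closure \<Omega>" "closure \<Omega>" "\<lambda>x. ball x (r x / 2)"] by (metis open_ball)
  from X(2,1) have "\<exists>C\<ge>0. \<forall>\<phi>\<in>test_functions \<Omega>. (\<forall>y. y \<notin> (\<Union>x\<in>X. ball x (r x / 2)) \<longrightarrow> \<phi> y = 0) \<longrightarrow>
      \<bar>LINT x|lebesgue_on \<Omega>. v x * partial i \<phi> x\<bar> \<le> C * L2_norm \<Omega> \<phi>"
  proof (induction X rule: finite_induct)
    case empty
    have "partial i \<phi> x = 0" if "\<forall>y. \<phi> y = 0" for \<phi> x
      by (rule partial_zero_outside[of "{}"]) (use that in auto)
    then show ?case by (intro exI[of _ 0]) simp
  next
    case (insert a X)
    then obtain C where C: "C \<ge> 0" "\<And>\<phi>. \<phi> \<in> test_functions \<Omega> \<Longrightarrow> (\<And>y. y \<notin> (\<Union>x\<in>X. ball x (r x / 2)) \<Longrightarrow> \<phi> y = 0) \<Longrightarrow>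
      \<bar>LINT x|lebesgue_on \<Omega>. v x * partial i \<phi> x\<bar> \<le> C * L2_norm \<Omega> \<phi>" by auto
    have a: "a \<in> closure \<Omega>" using insert by simp
    obtain \<psi> where \<psi>: "smooth \<psi>" "\<And>x. 0 \<le> \<psi> x \<and> \<psi> x \<le> 1" "\<And>x. x \<in> cball a (r a / 2) \<Longrightarrow> \<psi> x = 1"
      "\<And>x. x \<notin> ball a (r a) \<Longrightarrow> \<psi> x = 0"
      by (rule ball_cutoff[of "r a / 2" "r a" a]) (use rc(1)[OF a] in auto)
    show ?case
    proof (intro exI[of _ "c a + C"] conjI ballI impI)
      show "0 \<le> c a + C" using C(1) rc(2)[OF a] by simp
      fix \<phi> assume \<phi>: "\<phi> \<in> test_functions \<Omega>" and zero: "\<forall>y. y \<notin> (\<Union>x\<in>insert a X. ball x (r x / 2)) \<longrightarrow> \<phi> y = 0"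
      define \<phi>1 \<phi>2 where "\<phi>1 x = \<psi> x * \<phi> x" and "\<phi>2 x = (1 - \<psi> x) * \<phi> x" for x
      have t: "\<phi>1 \<in> test_functions \<Omega>" "\<phi>2 \<in> test_functions \<Omega>"
        unfolding \<phi>1_def[abs_def] \<phi>2_def[abs_def] using \<phi> \<psi>(1)
        by (auto intro!: test_functions_mult smooth_diff smooth_const)
      have n: "L2_norm \<Omega> \<phi>1 \<le> L2_norm \<Omega> \<phi>" "L2_norm \<Omega> \<phi>2 \<le> L2_norm \<Omega> \<phi>"
        unfolding \<phi>1_def[abs_def] \<phi>2_def[abs_def]
        using t[THEN test_functions_L2, OF \<Omega>s] \<psi>(2) test_functions_L2[OF \<phi> \<Omega>s]
        unfolding \<phi>1_def[abs_def] \<phi>2_def[abs_def]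
        by (auto intro!: L2_norm_mult_le simp: abs_le_iff)
      have "\<bar>LINT x|lebesgue_on \<Omega>. v x * partial i \<phi>1 x\<bar> \<le> c a * L2_norm \<Omega> \<phi>1"
        by (rule rc(3)[OF a t(1)]) (simp add: \<phi>1_def \<psi>(4))
      also have "\<dots> \<le> c a * L2_norm \<Omega> \<phi>" by (intro mult_left_mono n rc(2) a)
      finally have 1: "\<bar>LINT x|lebesgue_on \<Omega>. v x * partial i \<phi>1 x\<bar> \<le> c a * L2_norm \<Omega> \<phi>" .
      have "\<bar>LINT x|lebesgue_on \<Omega>. v x * partial i \<phi>2 x\<bar> \<le> C * L2_norm \<Omega> \<phi>2"
      proof (rule C(2)[OF t(2)])
        fix y assume "y \<notin> (\<Union>x\<in>X. ball x (r x / 2))"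
        \<comment> \<open>Inside the half ball around \<open>a\<close> the factor
          \<open>1 - \<psi>\<close> vanishes; outside it \<open>\<phi>\<close> itself does.\<close>
        then show "\<phi>2 y = 0" using zero \<psi>(3)[of y] by (cases "y \<in> ball a (r a / 2)") (auto simp: \<phi>2_def)
      qed
      also have "\<dots> \<le> C * L2_norm \<Omega> \<phi>" by (intro mult_left_mono n C)
      finally have 2: "\<bar>LINT x|lebesgue_on \<Omega>. v x * partial i \<phi>2 x\<bar> \<le> C * L2_norm \<Omega> \<phi>" .
      have "\<phi> = (\<lambda>x. \<phi>1 x + 1 * \<phi>2 x)" by (simp add: \<phi>1_def \<phi>2_def fun_eq_iff algebra_simps)
      then have "partial i \<phi> = (\<lambda>x. partial i \<phi>1 x + 1 * partial i \<phi>2 x)"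
        using partial_lincomb[OF t[THEN test_functions_smooth]] by metis
      moreover have "integrable (lebesgue_on \<Omega>) (\<lambda>x. v x * partial i \<phi>' x)" if "\<phi>' \<in> test_functions \<Omega>" for \<phi>'
        by (intro integrable_mult_L2[OF v] test_functions_L2[OF test_functions_partial[OF that] \<Omega>s])
      ultimately have "(LINT x|lebesgue_on \<Omega>. v x * partial i \<phi> x) =
          (LINT x|lebesgue_on \<Omega>. v x * partial i \<phi>1 x) + (LINT x|lebesgue_on \<Omega>. v x * partial i \<phi>2 x)"
        using t by (simp add: distrib_left)
      then show "\<bar>LINT x|lebesgue_on \<Omega>. v x * partial i \<phi> x\<bar> \<le> (c a + C) * L2_norm \<Omega> \<phi>"
        using 1 2 by (simp add: distrib_right)
    qed
  qed
  then obtain C where C: "\<And>\<phi>. \<phi> \<in> test_functions \<Omega> \<Longrightarrow> (\<forall>y. y \<notin> (\<Union>x\<in>X. ball x (r x / 2)) \<longrightarrow> \<phi> y = 0) \<Longrightarrow>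
      \<bar>LINT x|lebesgue_on \<Omega>. v x * partial i \<phi> x\<bar> \<le> C * L2_norm \<Omega> \<phi>" by blast
  show ?thesis
  proof (rule that[OF C])
    fix \<phi> assume \<phi>: "\<phi> \<in> test_functions \<Omega>"
    show "\<forall>y. y \<notin> (\<Union>x\<in>X. ball x (r x / 2)) \<longrightarrow> \<phi> y = 0"
      using X(3) closure_subset[of \<Omega>] test_functions_zero_outside[OF \<phi>] by blast
  qed
qed

lemma dpartial_dpartial_distr_of:
  "dpartial i (dpartial j (distr_of \<Omega> v)) \<phi> = (LINT x|lebesgue_on \<Omega>. v x * partial j (partial i \<phi>) x)"
  by (simp add: dpartial_def distr_of_def)

text \<open>The definition of \<open>H2\<close> also asks for the first derivatives.
  \<open>partial_bound\<close> bounds them as functionals on test functions, and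
  \<open>in_L2_if_bounded\<close> turns the bound into \<open>L2\<close> functions.\<close>

lemma H2_if_second_derivatives_in_L2:
  fixes v :: "real^'d::finite \<Rightarrow> real"
  assumes \<Omega>: "open \<Omega>" "bounded \<Omega>" "lipschitz_boundary \<Omega>" and v: "v \<in> L2 \<Omega>"
    and D2: "\<And>i j. in_L2 \<Omega> (dpartial i (dpartial j (distr_of \<Omega> v)))"
  shows "v \<in> H2 \<Omega>"
proof -
  have \<Omega>s: "\<Omega> \<in> sets lebesgue" using \<Omega> by (simp add: borel_open)
  define w where "w i j = L2_rep \<Omega> (dpartial i (dpartial j (distr_of \<Omega> v)))" for i j
  have w: "w i j \<in> L2 \<Omega>" "\<And>\<phi>. \<phi> \<in> test_functions \<Omega> \<Longrightarrow> dpartial i (dpartial j (distr_of \<Omega> v)) \<phi> = L2_inner \<Omega> (w i j) \<phi>" for i j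
    using represents_L2_rep[OF D2[of i j]] by (auto simp: represents_def w_def distr_of_eq_L2_inner)
  define K where "K = (\<Sum>i\<in>UNIV. \<Sum>j\<in>UNIV. L2_norm \<Omega> (w i j))"
  have w_le: "L2_norm \<Omega> (w i j) \<le> K" for i j
  proof -
    have "L2_norm \<Omega> (w i j) \<le> (\<Sum>j\<in>UNIV. L2_norm \<Omega> (w i j))"
      by (intro member_le_sum) (auto simp: L2_norm_nonneg)
    also have "\<dots> \<le> K" unfolding K_def
      by (intro member_le_sum[of i UNIV "\<lambda>i. \<Sum>j\<in>UNIV. L2_norm \<Omega> (w i j)"]) (auto simp: L2_norm_nonneg sum_nonneg)
    finally show ?thesis .
  qed
  have K: "\<bar>LINT x|lebesgue_on \<Omega>. v x * partial i (partial j \<psi>) x\<bar> \<le> K * L2_norm \<Omega> \<psi>"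
    if \<psi>: "\<psi> \<in> test_functions \<Omega>" for i j \<psi>
  proof -
    \<comment> \<open>Distributional derivatives reach the test function in reverse order, hence
      \<open>w j i\<close>.\<close>
    have "\<bar>LINT x|lebesgue_on \<Omega>. v x * partial i (partial j \<psi>) x\<bar> = \<bar>L2_inner \<Omega> (w j i) \<psi>\<bar>"
      using w(2)[OF \<psi>, of j i] by (simp add: dpartial_dpartial_distr_of)
    also have "\<dots> \<le> L2_norm \<Omega> (w j i) * L2_norm \<Omega> \<psi>"
      by (intro L2_Cauchy_Schwarz w test_functions_L2[OF \<psi> \<Omega>s])
    also have "\<dots> \<le> K * L2_norm \<Omega> \<psi>" by (intro mult_right_mono w_le L2_norm_nonneg)
    finally show ?thesis .
  qed
  have "in_L2 \<Omega> (dpartial i (distr_of \<Omega> v))" for i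
  proof -
    obtain C where C: "\<And>\<phi>. \<phi> \<in> test_functions \<Omega> \<Longrightarrow>
      \<bar>LINT x|lebesgue_on \<Omega>. v x * partial i \<phi> x\<bar> \<le> C * L2_norm \<Omega> \<phi>"
      using partial_bound[OF \<Omega> v K] by blast
    show ?thesis
    proof (rule in_L2_if_bounded[OF \<Omega>(1,2)])
      fix \<phi> \<psi> c assume t: "\<phi> \<in> test_functions \<Omega>" "\<psi> \<in> test_functions \<Omega>"
      have "integrable (lebesgue_on \<Omega>) (\<lambda>x. v x * partial i \<phi>' x)" if "\<phi>' \<in> test_functions \<Omega>" for \<phi>'
        by (intro integrable_mult_L2[OF v] test_functions_L2[OF test_functions_partial[OF that] \<Omega>s])
      note int = this[OF t(1)] this[OF t(2)]
      have "(LINT x|lebesgue_on \<Omega>. v x * partial i (\<lambda>x. \<phi> x + c * \<psi> x) x)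
          = (LINT x|lebesgue_on \<Omega>. v x * partial i \<phi> x + c * (v x * partial i \<psi> x))"
        unfolding partial_lincomb[OF t[THEN test_functions_smooth]]
        by (intro Bochner_Integration.integral_cong) (auto simp: algebra_simps)
      then show "dpartial i (distr_of \<Omega> v) (\<lambda>x. \<phi> x + c * \<psi> x) =
          dpartial i (distr_of \<Omega> v) \<phi> + c * dpartial i (distr_of \<Omega> v) \<psi>"
        using int by (simp add: dpartial_def distr_of_def)
    qed (use C in \<open>simp add: dpartial_def distr_of_def\<close>)
  qed
  then show ?thesis using v D2 by (simp add: H2_def H1_def)
qed

section \<open>Weak Hessian and iterated divergence\<close>

lemma L2_on_vecI:
  fixes f :: "'a \<Rightarrow> 'b::euclidean_space^'n"
  assumes f: "\<And>i. (\<lambda>x. f x $ i) \<in> L2_on \<mu>"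
  shows "f \<in> L2_on \<mu>"
proof -
  have "(\<lambda>x. f x \<bullet> b) \<in> borel_measurable \<mu>" if b_Basis: "b \<in> Basis" for b
  proof -
    obtain i u where b: "b = axis i u" using b_Basis by (auto simp: Basis_vec_def)
    have "(\<lambda>x. (f x $ i) \<bullet> u) \<in> borel_measurable \<mu>"
      using L2_measurable[OF f[of i]] by measurable
    then show ?thesis by (simp add: b inner_axis)
  qed
  then have "f \<in> borel_measurable \<mu>" by (subst borel_measurable_euclidean_space) blast
  moreover have "(norm (f x))\<^sup>2 = (\<Sum>i\<in>UNIV. (norm (f x $ i))\<^sup>2)" for x
    by (simp add: power2_norm_eq_inner inner_vec_def)
  moreover have "integrable \<mu> (\<lambda>x. \<Sum>i\<in>UNIV. (norm (f x $ i))\<^sup>2)"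
    using f by (intro Bochner_Integration.integrable_sum) (simp add: L2_on_def)
  ultimately show ?thesis by (simp add: L2_on_def)
qed

lemma L2_inner_vec:
  fixes f g :: "'a::euclidean_space \<Rightarrow> 'b::euclidean_space^'n"
  assumes "f \<in> L2 \<Omega>" "g \<in> L2 \<Omega>"
  shows "L2_inner \<Omega> f g = (\<Sum>i\<in>UNIV. L2_inner \<Omega> (\<lambda>x. f x $ i) (\<lambda>x. g x $ i))"
proof -
  have "L2_inner \<Omega> f g = (LINT x|lebesgue_on \<Omega>. (\<Sum>i\<in>UNIV. (f x $ i) \<bullet> (g x $ i)))"
    by (simp add: L2_inner_def inner_vec_def)
  also have "\<dots> = (\<Sum>i\<in>UNIV. L2_inner \<Omega> (\<lambda>x. f x $ i) (\<lambda>x. g x $ i))"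
    unfolding L2_inner_def
    by (intro Bochner_Integration.integral_sum integrable_inner_L2 L2_on_vec_nth assms)
  finally show ?thesis .
qed

lemma L2_inner_matrix:
  fixes f g :: "'a::euclidean_space \<Rightarrow> real^'n^'k"
  assumes "f \<in> L2 \<Omega>" "g \<in> L2 \<Omega>"
  shows "L2_inner \<Omega> f g = (\<Sum>i\<in>UNIV. \<Sum>j\<in>UNIV. L2_inner \<Omega> (\<lambda>x. f x $ i $ j) (\<lambda>x. g x $ i $ j))"
  unfolding L2_inner_vec[OF assms]
  by (intro sum.cong refl L2_inner_vec L2_on_vec_nth assms)

lemma Linf_L2:
  fixes T :: "real^'d::finite \<Rightarrow> real^'d^'d"
  assumes "T \<in> Linf_sym \<Omega>"
  shows "v \<in> L2 \<Omega> \<Longrightarrow> (\<lambda>x. v x *\<^sub>R T x) \<in> L2 \<Omega>"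
    and "N \<in> L2 \<Omega> \<Longrightarrow> (\<lambda>x. T x \<bullet> N x) \<in> L2 \<Omega>"
proof -
  obtain C where C: "AE x in lebesgue_on \<Omega>. norm (T x) \<le> C" and [measurable]: "T \<in> borel_measurable (lebesgue_on \<Omega>)"
    using assms by (auto simp: Linf_sym_def)
  show "(\<lambda>x. v x *\<^sub>R T x) \<in> L2 \<Omega>" if v: "v \<in> L2 \<Omega>"
  proof (rule L2_on_bound[OF v, of _ C])
    show "AE x in lebesgue_on \<Omega>. norm (v x *\<^sub>R T x) \<le> C * norm (v x)"
      using C by eventually_elim (simp add: mult.commute[of "\<bar>v _\<bar>"] mult_right_mono)
  qed (use L2_measurable[OF v] in measurable)
  show "(\<lambda>x. T x \<bullet> N x) \<in> L2 \<Omega>" if N: "N \<in> L2 \<Omega>"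
  proof (rule L2_on_bound[OF N, of _ C])
    show "AE x in lebesgue_on \<Omega>. norm (T x \<bullet> N x) \<le> C * norm (N x)"
      using C
    proof eventually_elim
      case (elim x)
      have "\<bar>T x \<bullet> N x\<bar> \<le> norm (T x) * norm (N x)" by (rule Cauchy_Schwarz_ineq2)
      also have "\<dots> \<le> C * norm (N x)" using elim by (intro mult_right_mono) auto
      finally show ?case by simp
    qed
  qed (use L2_measurable[OF N] in measurable)
qed

text \<open>Lagrange's identity in the plane. It combines the estimates of the two components of the
  graph norms without losing a constant.\<close>

lemma pair_Cauchy_Schwarz:
  fixes a b c d :: real
  shows "\<bar>a * b + c * d\<bar> \<le> sqrt (a\<^sup>2 + c\<^sup>2) * sqrt (b\<^sup>2 + d\<^sup>2)"
proof -
  have "(a * b + c * d)\<^sup>2 + (a * d - c * b)\<^sup>2 = (a\<^sup>2 + c\<^sup>2) * (b\<^sup>2 + d\<^sup>2)"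
    by (simp add: power2_eq_square algebra_simps)
  then have "(a * b + c * d)\<^sup>2 \<le> (a\<^sup>2 + c\<^sup>2) * (b\<^sup>2 + d\<^sup>2)"
    by (metis le_add_same_cancel1 zero_le_power2)
  then have "sqrt ((a * b + c * d)\<^sup>2) \<le> sqrt ((a\<^sup>2 + c\<^sup>2) * (b\<^sup>2 + d\<^sup>2))" by (rule real_sqrt_le_mono)
  then show ?thesis by (simp add: real_sqrt_mult)
qed

text \<open>The derivatives are taken in the order in which \<open>divDiv_distr\<close> and
  \<open>hessian\<close> pass them to a test function, so both duality identities hold without
  exchanging derivatives.\<close>

definition hessian_matrix :: "(real^'d::finite \<Rightarrow> real) \<Rightarrow> real^'d \<Rightarrow> real^'d^'d" where
  "hessian_matrix \<phi> x = (\<chi> i j. partial j (partial i \<phi>) x)"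

lemma hessian_matrix_L2:
  assumes "\<phi> \<in> test_functions \<Omega>" "\<Omega> \<in> sets lebesgue"
  shows "hessian_matrix \<phi> \<in> L2 \<Omega>"
  by (intro L2_on_vecI) (simp add: hessian_matrix_def test_functions_L2[OF test_functions_partial[OF test_functions_partial[OF assms(1)]] assms(2)])

lemma divDiv_distr_eq:
  assumes "M \<in> L2 \<Omega>" "\<phi> \<in> test_functions \<Omega>" "\<Omega> \<in> sets lebesgue"
  shows "divDiv_distr \<Omega> M \<phi> = L2_inner \<Omega> M (hessian_matrix \<phi>)"
  unfolding L2_inner_matrix[OF assms(1) hessian_matrix_L2[OF assms(2,3)]]
  by (simp add: divDiv_distr_def Div_distr_def dpartial_def hessian_matrix_def distr_of_eq_L2_inner sum_negf)

lemma divDiv_represents: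
  assumes "M \<in> H_dDiv \<Omega>" "open \<Omega>"
  shows "divDiv \<Omega> M \<in> L2 \<Omega>"
    and "\<phi> \<in> test_functions \<Omega> \<Longrightarrow> L2_inner \<Omega> (divDiv \<Omega> M) \<phi> = L2_inner \<Omega> M (hessian_matrix \<phi>)"
proof -
  have M: "M \<in> L2 \<Omega>" and r: "represents \<Omega> (divDiv_distr \<Omega> M) (divDiv \<Omega> M)"
    using assms represents_L2_rep by (auto simp: H_dDiv_def L2_sym_def divDiv_def)
  from r show "divDiv \<Omega> M \<in> L2 \<Omega>" by (simp add: represents_def)
  assume "\<phi> \<in> test_functions \<Omega>"
  then show "L2_inner \<Omega> (divDiv \<Omega> M) \<phi> = L2_inner \<Omega> M (hessian_matrix \<phi>)"
    using r divDiv_distr_eq[OF M] assms(2) by (simp add: represents_def distr_of_eq_L2_inner borel_open)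
qed

text \<open>Converse of \<open>divDiv_represents\<close>: whatever representative
  \<open>L2_rep\<close> has chosen, it agrees almost everywhere with any \<open>w\<close> satisfying
  the duality identity.\<close>

lemma divDiv_eqI:
  assumes "open \<Omega>" "M \<in> L2_sym \<Omega>" "w \<in> L2 \<Omega>"
    and "\<forall>\<phi>\<in>test_functions \<Omega>. L2_inner \<Omega> w \<phi> = L2_inner \<Omega> M (hessian_matrix \<phi>)"
  shows "M \<in> H_dDiv \<Omega>" "AE x in lebesgue_on \<Omega>. divDiv \<Omega> M x = w x"
proof -
  have r: "represents \<Omega> (divDiv_distr \<Omega> M) w"
    using assms divDiv_distr_eq[of M \<Omega>] by (simp add: represents_def distr_of_eq_L2_inner borel_open L2_sym_def)
  then show "M \<in> H_dDiv \<Omega>" using assms(2) by (auto simp: H_dDiv_def in_L2_def)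
  have "represents \<Omega> (divDiv_distr \<Omega> M) (divDiv \<Omega> M)"
    using represents_L2_rep r by (auto simp: in_L2_def divDiv_def)
  from represents_unique[OF assms(1) this r] show "AE x in lebesgue_on \<Omega>. divDiv \<Omega> M x = w x" .
qed

lemma hessian_represents:
  assumes "v \<in> H2 \<Omega>"
  shows "hessian \<Omega> v \<in> L2 \<Omega>"
    and "\<phi> \<in> test_functions \<Omega> \<Longrightarrow> L2_inner \<Omega> (\<lambda>x. hessian \<Omega> v x $ i $ j) \<phi> = L2_inner \<Omega> v (partial j (partial i \<phi>))"
proof -
  have r: "represents \<Omega> (dpartial i (dpartial j (distr_of \<Omega> v))) (\<lambda>x. hessian \<Omega> v x $ i $ j)" for i j
    using assms represents_L2_rep[of \<Omega> "dpartial i (dpartial j (distr_of \<Omega> v))"] by (simp add: H2_def hessian_def)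
  then show "hessian \<Omega> v \<in> L2 \<Omega>" by (intro L2_on_vecI) (simp add: represents_def)
  assume "\<phi> \<in> test_functions \<Omega>"
  then show "L2_inner \<Omega> (\<lambda>x. hessian \<Omega> v x $ i $ j) \<phi> = L2_inner \<Omega> v (partial j (partial i \<phi>))"
    using r[of i j] by (simp add: represents_def distr_of_eq_L2_inner dpartial_def)
qed

text \<open>The identity speaks of second derivatives only; that \<open>v\<close> is in
  \<open>H2\<close> is the regularity result for bounded Lipschitz domains.\<close>

lemma hessian_eqI:
  assumes \<Omega>: "open \<Omega>" "bounded \<Omega>" "lipschitz_boundary \<Omega>" and v: "v \<in> L2 \<Omega>" and P: "P \<in> L2 \<Omega>"
    and eq: "\<And>i j. \<forall>\<phi>\<in>test_functions \<Omega>. L2_inner \<Omega> (\<lambda>x. P x $ i $ j) \<phi> = L2_inner \<Omega> v (partial j (partial i \<phi>))"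
  shows "v \<in> H2 \<Omega>" "AE x in lebesgue_on \<Omega>. hessian \<Omega> v x = P x"
proof -
  have r: "represents \<Omega> (dpartial i (dpartial j (distr_of \<Omega> v))) (\<lambda>x. P x $ i $ j)" for i j
    using eq P by (simp add: represents_def distr_of_eq_L2_inner dpartial_def L2_on_vec_nth)
  then have D2: "in_L2 \<Omega> (dpartial i (dpartial j (distr_of \<Omega> v)))" for i j by (auto simp: in_L2_def)
  then show "v \<in> H2 \<Omega>" by (rule H2_if_second_derivatives_in_L2[OF \<Omega> v])
  have "AE x in lebesgue_on \<Omega>. \<forall>i j. hessian \<Omega> v x $ i $ j = P x $ i $ j"
  proof (intro AE_all_countable[THEN iffD2] allI)
    fix i j
    show "AE x in lebesgue_on \<Omega>. hessian \<Omega> v x $ i $ j = P x $ i $ j"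
      using represents_unique[OF \<Omega>(1) represents_L2_rep[OF D2] r, of i j] by (simp add: hessian_def)
  qed
  then show "AE x in lebesgue_on \<Omega>. hessian \<Omega> v x = P x"
    by eventually_elim (simp add: vec_eq_iff)
qed

section \<open>The space H(dDiv): inner product, trace pairing, completeness\<close>

locale dDiv_setting =
  fixes \<Omega> :: "(real^'d::finite) set" and m q B :: real and T :: "real^'d \<Rightarrow> real^'d^'d"
  assumes \<Omega>: "open \<Omega>" "bounded \<Omega>" "lipschitz_boundary \<Omega>"
    and m: "0 < m" and B: "0 < B" and T: "T \<in> Linf_sym \<Omega>"
begin

abbreviation "H \<equiv> H_dDiv \<Omega>"
abbreviation "dD \<equiv> dDiv_op \<Omega> q T"
abbreviation "Gg \<equiv> Ggrad_op \<Omega> q T"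
abbreviation "ip \<equiv> inner_dDiv \<Omega> m q B T"
abbreviation "nrm \<equiv> norm_dDiv \<Omega> m q B T"
abbreviation "nrmG \<equiv> norm_Ggrad \<Omega> m q B T"

lemma \<Omega>_sets: "\<Omega> \<in> sets lebesgue"
  using \<Omega> by (simp add: borel_open)

lemma finite_measure_\<Omega>: "finite_measure (lebesgue_on \<Omega>)"
  using \<Omega> by (intro finite_measure_lebesgue_on lmeasurable_open)

lemma H_L2: "M \<in> H \<Longrightarrow> M \<in> L2 \<Omega>"
  by (simp add: H_dDiv_def L2_sym_def)

lemma dD_L2: "M \<in> H \<Longrightarrow> dD M \<in> L2 \<Omega>"
  unfolding dDiv_op_def using divDiv_represents(1)[OF _ \<Omega>(1)] Linf_L2(2)[OF T H_L2]
  by (intro L2_on_add L2_on_mult)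

lemma Gg_L2: "v \<in> H2 \<Omega> \<Longrightarrow> Gg v \<in> L2 \<Omega>"
  unfolding Ggrad_op_def
  using hessian_represents(1) Linf_L2(1)[OF T, of v] L2_on_scaleR[of "\<lambda>x. v x *\<^sub>R T x" _ "q\<^sup>2"]
  by (intro L2_on_add) (auto simp: H2_def H1_def)

lemma H2_L2: "v \<in> H2 \<Omega> \<Longrightarrow> v \<in> L2 \<Omega>"
  by (simp add: H2_def H1_def)

text \<open>\<open>divDiv\<close> of the combination is a new choice of representative, so linearity
  of \<open>dD\<close> is available only almost everywhere.\<close>

lemma H_lincomb:
  assumes "M \<in> H" "N \<in> H"
  shows "(\<lambda>x. M x + c *\<^sub>R N x) \<in> H"
    and "AE x in lebesgue_on \<Omega>. dD (\<lambda>x. M x + c *\<^sub>R N x) x = dD M x + c *\<^sub>R dD N x"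
proof -
  let ?N = "\<lambda>x. M x + c *\<^sub>R N x" and ?w = "\<lambda>x. divDiv \<Omega> M x + c *\<^sub>R divDiv \<Omega> N x"
  have "AE x in lebesgue_on \<Omega>. transpose (M x) = M x" "AE x in lebesgue_on \<Omega>. transpose (N x) = N x"
    using assms by (auto simp: H_dDiv_def L2_sym_def sym_ae_def)
  then have "AE x in lebesgue_on \<Omega>. transpose (?N x) = ?N x"
    by eventually_elim (auto simp: transpose_def vec_eq_iff)
  then have s: "?N \<in> L2_sym \<Omega>"
    using assms by (auto simp: L2_sym_def sym_ae_def intro: L2_on_lincomb H_L2)
  note d = divDiv_represents[OF assms(1) \<Omega>(1)] divDiv_represents[OF assms(2) \<Omega>(1)]
  have w: "?w \<in> L2 \<Omega>" by (intro L2_on_lincomb d)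
  have eq: "\<forall>\<phi>\<in>test_functions \<Omega>. L2_inner \<Omega> ?w \<phi> = L2_inner \<Omega> ?N (hessian_matrix \<phi>)"
  proof
    fix \<phi> assume \<phi>: "\<phi> \<in> test_functions \<Omega>"
    show "L2_inner \<Omega> ?w \<phi> = L2_inner \<Omega> ?N (hessian_matrix \<phi>)"
      unfolding L2_inner_lincomb_left[OF d(1) d(3) test_functions_L2[OF \<phi> \<Omega>_sets]]
      L2_inner_lincomb_left[OF assms[THEN H_L2] hessian_matrix_L2[OF \<phi> \<Omega>_sets]] d(2)[OF \<phi>] d(4)[OF \<phi>] ..
  qed
  note dI = divDiv_eqI[OF \<Omega>(1) s w eq]
  show "?N \<in> H" by (rule dI(1))
  from dI(2) show "AE x in lebesgue_on \<Omega>. dD ?N x = dD M x + c *\<^sub>R dD N x"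
    by eventually_elim (simp add: dDiv_op_def inner_add_right algebra_simps)
qed

lemma H_diff:
  assumes "M \<in> H" "N \<in> H"
  shows "(\<lambda>x. M x - N x) \<in> H"
    and "AE x in lebesgue_on \<Omega>. dD (\<lambda>x. M x - N x) x = dD M x - dD N x"
  using H_lincomb[OF assms, of "-1"] by simp_all

lemma dD_lincomb_inner:
  assumes "M \<in> H" "N \<in> H" "h \<in> L2 \<Omega>"
  shows "L2_inner \<Omega> (dD (\<lambda>x. M x + c *\<^sub>R N x)) h = L2_inner \<Omega> (dD M) h + c * L2_inner \<Omega> (dD N) h"
proof -
  note H = H_lincomb[OF assms(1,2), of c]
  have "L2_inner \<Omega> (dD (\<lambda>x. M x + c *\<^sub>R N x)) h = L2_inner \<Omega> (\<lambda>x. dD M x + c *\<^sub>R dD N x) h"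
    by (rule L2_inner_cong_AE[OF H(2) AE_I2[OF refl] dD_L2[OF H(1)]
      L2_on_lincomb[OF dD_L2[OF assms(1)] dD_L2[OF assms(2)]] assms(3,3)])
  then show ?thesis by (simp only: L2_inner_lincomb_left[OF dD_L2[OF assms(1)] dD_L2[OF assms(2)] assms(3)])
qed

lemma ip_lincomb:
  assumes "M \<in> H" "N \<in> H" "P \<in> H"
  shows "ip (\<lambda>x. M x + c *\<^sub>R N x) P = ip M P + c * ip N P"
  unfolding inner_dDiv_def dD_lincomb_inner[OF assms(1,2) dD_L2[OF assms(3)]]
    L2_inner_lincomb_left[OF assms[THEN H_L2]]
  by (simp add: algebra_simps)

lemma ip_sym: "ip M N = ip N M"
  by (simp add: inner_dDiv_def L2_inner_commute)

lemma ip_nonneg: "0 \<le> ip M M"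
  using m B by (simp add: inner_dDiv_def L2_inner_self_nonneg)

lemma ip_self: "ip M M = B * (L2_norm \<Omega> M)\<^sup>2 + B\<^sup>2 / m * (L2_norm \<Omega> (dD M))\<^sup>2"
  by (simp add: inner_dDiv_def L2_norm_sq)

text \<open>Both norms are written as Euclidean norms of pairs, with weights \<open>sqrt B\<close>,
  \<open>B / sqrt m\<close> here and \<open>sqrt m\<close>, \<open>sqrt B\<close> in
  \<open>nrmG_eq\<close>. Multiplied crosswise the weights give \<open>B\<close> each time, which is
  the factor in \<open>tr_bound\<close>.\<close>

lemma nrm_eq: "nrm M = sqrt ((sqrt B * L2_norm \<Omega> M)\<^sup>2 + (B / sqrt m * L2_norm \<Omega> (dD M))\<^sup>2)"
  using m B by (simp add: norm_dDiv_def ip_self power_mult_distrib power_divide)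

lemma nrmG_eq: "nrmG v = sqrt ((sqrt m * L2_norm \<Omega> v)\<^sup>2 + (sqrt B * L2_norm \<Omega> (Gg v))\<^sup>2)"
  using m B by (simp add: norm_Ggrad_def power_mult_distrib)

lemma nrm_nonneg: "0 \<le> nrm M"
  by (simp add: norm_dDiv_def ip_nonneg)

lemma nrm_sq: "(nrm M)\<^sup>2 = ip M M"
  by (simp add: norm_dDiv_def ip_nonneg)

lemma L2_norm_le_nrm: "sqrt B * L2_norm \<Omega> M \<le> nrm M"
  unfolding nrm_eq by (rule real_le_rsqrt) simp

lemma dD_norm_le_nrm: "B / sqrt m * L2_norm \<Omega> (dD M) \<le> nrm M"
  unfolding nrm_eq by (rule real_le_rsqrt) simp

lemma ip_Cauchy_Schwarz:
  assumes "M \<in> H" "N \<in> H"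
  shows "\<bar>ip M N\<bar> \<le> nrm M * nrm N"
proof -
  have "\<bar>ip M N\<bar> \<le> B * \<bar>L2_inner \<Omega> M N\<bar> + B\<^sup>2 / m * \<bar>L2_inner \<Omega> (dD M) (dD N)\<bar>"
    unfolding inner_dDiv_def using m B by (intro order_trans[OF abs_triangle_ineq]) (simp add: abs_mult)
  also have "\<dots> \<le> B * (L2_norm \<Omega> M * L2_norm \<Omega> N) + B\<^sup>2 / m * (L2_norm \<Omega> (dD M) * L2_norm \<Omega> (dD N))"
    using m B assms by (intro add_mono mult_left_mono L2_Cauchy_Schwarz H_L2 dD_L2) auto
  also have "\<dots> = (sqrt B * L2_norm \<Omega> M) * (sqrt B * L2_norm \<Omega> N) +
      (B / sqrt m * L2_norm \<Omega> (dD M)) * (B / sqrt m * L2_norm \<Omega> (dD N))"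
  proof -
    have f: "sqrt B * sqrt B = B" "B / sqrt m * (B / sqrt m) = B\<^sup>2 / m"
      using m B by (simp_all add: power2_eq_square)
    have alg: "(s * a) * (s * b) = (s * s) * (a * b)" for s a b :: real by (simp only: mult_ac)
    have "(sqrt B * a) * (sqrt B * b) = B * (a * b)"
      "(B / sqrt m * a) * (B / sqrt m * b) = B\<^sup>2 / m * (a * b)" for a b
      by (rule trans[OF alg], simp only: f)+
    then show ?thesis by (simp only:)
  qed
  also have "\<dots> \<le> nrm M * nrm N"
    unfolding nrm_eq by (rule order_trans[OF abs_ge_self pair_Cauchy_Schwarz])
  finally show ?thesis .
qed

lemma nrm_triangle:
  assumes "M \<in> H" "N \<in> H"
  shows "nrm (\<lambda>x. M x + 1 *\<^sub>R N x) \<le> nrm M + nrm N"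
proof (rule power2_le_imp_le)
  have S: "(\<lambda>x. M x + 1 *\<^sub>R N x) \<in> H" by (rule H_lincomb[OF assms])
  have "(nrm (\<lambda>x. M x + 1 *\<^sub>R N x))\<^sup>2 = ip M M + 2 * ip M N + ip N N"
    unfolding nrm_sq ip_lincomb[OF assms S] ip_sym[of M "\<lambda>x. M x + 1 *\<^sub>R N x"] ip_sym[of N "\<lambda>x. M x + 1 *\<^sub>R N x"]
      ip_lincomb[OF assms assms(1)] ip_lincomb[OF assms assms(2)] using ip_sym[of N M] by simp
  also have "\<dots> \<le> (nrm M + nrm N)\<^sup>2"
    using ip_Cauchy_Schwarz[OF assms] by (simp add: power2_sum nrm_sq)
  finally show "(nrm (\<lambda>x. M x + 1 *\<^sub>R N x))\<^sup>2 \<le> (nrm M + nrm N)\<^sup>2" .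
qed (use nrm_nonneg in simp)

text \<open>The contributions of \<open>T\<close> cancel, since
  \<open>(T : N, v) = (N, v T)\<close>. In this form the trace pairing is controlled by exactly the
  quantities in the two graph norms.\<close>

lemma tr_eq:
  assumes v: "v \<in> H2 \<Omega>" and N: "N \<in> H"
  shows "tr_Ggrad \<Omega> v N = L2_inner \<Omega> (dD N) v - L2_inner \<Omega> N (Gg v)"
proof -
  have 1: "L2_inner \<Omega> (dD N) v = L2_inner \<Omega> (divDiv \<Omega> N) v + q\<^sup>2 * L2_inner \<Omega> (\<lambda>x. T x \<bullet> N x) v"
    using L2_inner_lincomb_left[OF divDiv_represents(1)[OF N \<Omega>(1)] Linf_L2(2)[OF T H_L2[OF N]] H2_L2[OF v], of "q\<^sup>2"]
    by (simp add: dDiv_op_def[abs_def])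
  have 2: "L2_inner \<Omega> N (Gg v) = L2_inner \<Omega> N (hessian \<Omega> v) + q\<^sup>2 * L2_inner \<Omega> N (\<lambda>x. v x *\<^sub>R T x)"
    using L2_inner_lincomb_right[OF hessian_represents(1)[OF v] Linf_L2(1)[OF T H2_L2[OF v]] H_L2[OF N], of "q\<^sup>2"]
    by (simp add: Ggrad_op_def[abs_def])
  have "L2_inner \<Omega> (\<lambda>x. T x \<bullet> N x) v = L2_inner \<Omega> N (\<lambda>x. v x *\<^sub>R T x)"
    by (simp add: L2_inner_def inner_commute mult.commute)
  then show ?thesis unfolding 1 2 by (simp add: tr_Ggrad_def)
qed

lemma tr_dDiv_eq: "tr_dDiv \<Omega> N v = tr_Ggrad \<Omega> v N"
  by (simp add: tr_dDiv_def tr_Ggrad_def)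

lemma tr_lincomb:
  assumes v: "v \<in> H2 \<Omega>" and "M \<in> H" "N \<in> H"
  shows "tr_Ggrad \<Omega> v (\<lambda>x. M x + c *\<^sub>R N x) = tr_Ggrad \<Omega> v M + c * tr_Ggrad \<Omega> v N"
  unfolding tr_eq[OF v assms(2)] tr_eq[OF v assms(3)] tr_eq[OF v H_lincomb(1)[OF assms(2,3)]]
    dD_lincomb_inner[OF assms(2,3) H2_L2[OF v]] L2_inner_lincomb_left[OF H_L2[OF assms(2)] H_L2[OF assms(3)] Gg_L2[OF v]]
  by (simp add: algebra_simps)

text \<open>\<open>v\<close> is paired with \<open>dD N\<close> and \<open>Gg v\<close> with
  \<open>N\<close>, so the components meet crosswise, and the planar Cauchy-Schwarz inequality gives
  constant 1.\<close>

lemma tr_bound: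
  assumes v: "v \<in> H2 \<Omega>" and N: "N \<in> H"
  shows "B * \<bar>tr_Ggrad \<Omega> v N\<bar> \<le> nrmG v * nrm N"
proof -
  have "\<bar>tr_Ggrad \<Omega> v N\<bar> \<le> \<bar>L2_inner \<Omega> (dD N) v\<bar> + \<bar>L2_inner \<Omega> N (Gg v)\<bar>"
    unfolding tr_eq[OF v N] by linarith
  also have "\<dots> \<le> L2_norm \<Omega> (dD N) * L2_norm \<Omega> v + L2_norm \<Omega> N * L2_norm \<Omega> (Gg v)"
    using v N by (intro add_mono L2_Cauchy_Schwarz H_L2 dD_L2 H2_L2 Gg_L2)
  finally have "B * \<bar>tr_Ggrad \<Omega> v N\<bar> \<le> B * (L2_norm \<Omega> (dD N) * L2_norm \<Omega> v + L2_norm \<Omega> N * L2_norm \<Omega> (Gg v))"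
    using B by (intro mult_left_mono) auto
  also have "\<dots> = (sqrt m * L2_norm \<Omega> v) * (B / sqrt m * L2_norm \<Omega> (dD N)) +
      (sqrt B * L2_norm \<Omega> (Gg v)) * (sqrt B * L2_norm \<Omega> N)"
  proof -
    have f: "sqrt B * sqrt B = B" "sqrt m * (B / sqrt m) = B" using m B by simp_all
    have alg: "(s * a) * (t * b) = (s * t) * (b * a)" for s t a b :: real by (simp only: mult_ac)
    have "(sqrt m * a) * (B / sqrt m * b) = B * (b * a)" "(sqrt B * a) * (sqrt B * b) = B * (b * a)" for a b
      by (rule trans[OF alg], simp only: f)+
    then show ?thesis by (simp only: distrib_left)
  qed
  also have "\<dots> \<le> nrmG v * nrm N"
    unfolding nrm_eq nrmG_eq add.commute[of "(sqrt B * L2_norm \<Omega> N)\<^sup>2"]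
    by (rule order_trans[OF abs_ge_self pair_Cauchy_Schwarz])
  finally show ?thesis .
qed

lemma f_bound:
  assumes f: "f \<in> L2 \<Omega>" and N: "N \<in> H"
  shows "B / m * \<bar>L2_inner \<Omega> f (dD N)\<bar> \<le> 1 / sqrt m * L2_norm \<Omega> f * nrm N"
proof -
  have "B / m * \<bar>L2_inner \<Omega> f (dD N)\<bar> \<le> B / m * (L2_norm \<Omega> f * L2_norm \<Omega> (dD N))"
    using B m by (intro mult_left_mono L2_Cauchy_Schwarz f dD_L2 N) auto
  also have "\<dots> = 1 / sqrt m * L2_norm \<Omega> f * (B / sqrt m * L2_norm \<Omega> (dD N))"
    using m by (simp add: field_simps)
  also have "\<dots> \<le> 1 / sqrt m * L2_norm \<Omega> f * nrm N"
    using m by (intro mult_left_mono dD_norm_le_nrm mult_nonneg_nonneg L2_norm_nonneg) auto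
  finally show ?thesis .
qed

text \<open>The sequences \<open>x n\<close> and \<open>dD (x n)\<close> converge separately in
  \<open>L2\<close>; the point is that the limit of the second is \<open>dD\<close> of the limit of
  the first. Convergence against fixed \<open>L2\<close> functions is what is passed on, because the
  equations only contain inner products.\<close>

lemma H_complete:
  assumes x: "\<And>n::nat. x n \<in> H"
    and Cauchy: "\<And>e. e > 0 \<Longrightarrow> \<exists>N. \<forall>i\<ge>N. \<forall>j\<ge>N. ip (\<lambda>t. x i t - x j t) (\<lambda>t. x i t - x j t) < e"
  obtains M where "M \<in> H" "\<And>P. P \<in> L2 \<Omega> \<Longrightarrow> (\<lambda>n. L2_inner \<Omega> (x n) P) \<longlonglongrightarrow> L2_inner \<Omega> M P"
    "\<And>p. p \<in> L2 \<Omega> \<Longrightarrow> (\<lambda>n. L2_inner \<Omega> (dD (x n)) p) \<longlonglongrightarrow> L2_inner \<Omega> (dD M) p"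
proof -
  have nrm_Cauchy: "\<exists>N. \<forall>i\<ge>N. \<forall>j\<ge>N. nrm (\<lambda>t. x i t - x j t) < e" if e: "e > 0" for e
  proof -
    have "nrm f < e" if "ip f f < e\<^sup>2" for f
      using real_sqrt_less_mono[OF that] e by (simp add: norm_dDiv_def)
    moreover have "e\<^sup>2 > 0" using e by simp
    ultimately show ?thesis using Cauchy by meson
  qed
  have "\<exists>N. \<forall>i\<ge>N. \<forall>j\<ge>N. L2_norm \<Omega> (\<lambda>t. x i t - x j t) < e" if e: "e > 0" for e
  proof -
    have "L2_norm \<Omega> f < e" if "nrm f < sqrt B * e" for f
      using L2_norm_le_nrm[of f] that B by (metis le_less_trans mult_less_cancel_left_pos real_sqrt_gt_0_iff)
    moreover have "sqrt B * e > 0" using B e by simp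
    ultimately show ?thesis using nrm_Cauchy by meson
  qed
  from L2_complete[of \<Omega> x, OF finite_measure_\<Omega> H_L2[OF x] this]
  obtain M where M: "M \<in> L2 \<Omega>" "(\<lambda>n. L2_norm \<Omega> (\<lambda>t. x n t - M t)) \<longlonglongrightarrow> 0"
    "\<forall>S. closed S \<longrightarrow> (\<forall>n. AE t in lebesgue_on \<Omega>. x n t \<in> S) \<longrightarrow> (AE t in lebesgue_on \<Omega>. M t \<in> S)"
    by blast
  have "\<exists>N. \<forall>i\<ge>N. \<forall>j\<ge>N. L2_norm \<Omega> (\<lambda>t. dD (x i) t - dD (x j) t) < e" if e: "e > 0" for e
  proof -
    have "L2_norm \<Omega> (\<lambda>t. dD (x i) t - dD (x j) t) < e" if less: "nrm (\<lambda>t. x i t - x j t) < B / sqrt m * e" for i j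
    proof -
      note H = H_diff[OF x x, of i j]
      have "L2_norm \<Omega> (\<lambda>t. dD (x i) t - dD (x j) t) = L2_norm \<Omega> (dD (\<lambda>t. x i t - x j t))"
        using L2_norm_cong_AE[OF H(2) dD_L2[OF H(1)]] x by (simp add: L2_on_diff dD_L2)
      moreover have "B / sqrt m * L2_norm \<Omega> (dD (\<lambda>t. x i t - x j t)) < B / sqrt m * e"
        using dD_norm_le_nrm less by (rule le_less_trans)
      moreover have "B / sqrt m > 0" using B m by simp
      ultimately show ?thesis using mult_less_cancel_left_pos by metis
    qed
    moreover have "B / sqrt m * e > 0" using B m e by simp
    ultimately show ?thesis using nrm_Cauchy by meson
  qed
  from L2_complete[of \<Omega> "\<lambda>n. dD (x n)", OF finite_measure_\<Omega> dD_L2[OF x] this]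
  obtain d where d: "d \<in> L2 \<Omega>" "(\<lambda>n. L2_norm \<Omega> (\<lambda>t. dD (x n) t - d t)) \<longlonglongrightarrow> 0"
    by blast
  have limM: "(\<lambda>n. L2_inner \<Omega> (x n) P) \<longlonglongrightarrow> L2_inner \<Omega> M P" if "P \<in> L2 \<Omega>" for P
    by (rule L2_inner_tendsto[OF H_L2[OF x] M(1) that M(2)])
  have limd: "(\<lambda>n. L2_inner \<Omega> (dD (x n)) p) \<longlonglongrightarrow> L2_inner \<Omega> d p" if "p \<in> L2 \<Omega>" for p
    by (rule L2_inner_tendsto[OF dD_L2[OF x] d(1) that d(2)])
  have "continuous_on UNIV (\<lambda>y::real^'d^'d. transpose y)"
    unfolding transpose_def by (intro continuous_intros)
  then have "closed {y::real^'d^'d. transpose y = y}"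
    by (intro closed_Collect_eq continuous_intros) auto
  moreover have "\<forall>n. AE t in lebesgue_on \<Omega>. x n t \<in> {y. transpose y = y}"
    using x by (auto simp: H_dDiv_def L2_sym_def sym_ae_def)
  ultimately have "AE t in lebesgue_on \<Omega>. M t \<in> {y. transpose y = y}"
    using M(3) by blast
  then have "AE t in lebesgue_on \<Omega>. transpose (M t) = M t" by simp
  then have sym: "M \<in> L2_sym \<Omega>" using M(1) by (simp add: L2_sym_def sym_ae_def)
  \<comment> \<open>The candidate for \<open>divDiv \<Omega> M\<close>: the limit \<open>d\<close>
    of \<open>dD (x n)\<close> with the term in \<open>T\<close> removed. Its duality identity holds
    because both sides are limits of the same sequence.\<close>
  define w where "w t = d t + (- q\<^sup>2) *\<^sub>R (T t \<bullet> M t)" for t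
  have w: "w \<in> L2 \<Omega>" unfolding w_def[abs_def] by (intro L2_on_lincomb d Linf_L2(2)[OF T] M)
  have eq: "\<forall>\<phi>\<in>test_functions \<Omega>. L2_inner \<Omega> w \<phi> = L2_inner \<Omega> M (hessian_matrix \<phi>)"
  proof (intro ballI LIMSEQ_unique)
    fix \<phi> assume \<phi>: "\<phi> \<in> test_functions \<Omega>"
    note \<phi>L = test_functions_L2[OF \<phi> \<Omega>_sets]
    show "(\<lambda>n. L2_inner \<Omega> (x n) (hessian_matrix \<phi>)) \<longlonglongrightarrow> L2_inner \<Omega> M (hessian_matrix \<phi>)"
      by (intro limM hessian_matrix_L2 \<phi> \<Omega>_sets)
    have T_swap: "L2_inner \<Omega> (\<lambda>t. T t \<bullet> N t) \<phi> = L2_inner \<Omega> N (\<lambda>t. \<phi> t *\<^sub>R T t)" for N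
      by (simp add: L2_inner_def inner_commute mult.commute)
    have xn: "L2_inner \<Omega> (x n) (hessian_matrix \<phi>) = L2_inner \<Omega> (dD (x n)) \<phi> + (- q\<^sup>2) * L2_inner \<Omega> (x n) (\<lambda>t. \<phi> t *\<^sub>R T t)" for n
    proof -
      have "divDiv \<Omega> (x n) = (\<lambda>t. dD (x n) t + (- q\<^sup>2) *\<^sub>R (T t \<bullet> x n t))"
        by (simp add: dDiv_op_def fun_eq_iff)
      then have "L2_inner \<Omega> (divDiv \<Omega> (x n)) \<phi> = L2_inner \<Omega> (dD (x n)) \<phi> + (- q\<^sup>2) * L2_inner \<Omega> (\<lambda>t. T t \<bullet> x n t) \<phi>"
        using L2_inner_lincomb_left[OF dD_L2[OF x] Linf_L2(2)[OF T H_L2[OF x]] \<phi>L, of n "- q\<^sup>2" n] by metis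
      then show ?thesis
        using divDiv_represents(2)[OF x \<Omega>(1) \<phi>, of n] by (simp only: T_swap)
    qed
    have "L2_inner \<Omega> w \<phi> = L2_inner \<Omega> d \<phi> + (- q\<^sup>2) * L2_inner \<Omega> M (\<lambda>t. \<phi> t *\<^sub>R T t)"
      unfolding w_def[abs_def] L2_inner_lincomb_left[OF d(1) Linf_L2(2)[OF T M(1)] \<phi>L] T_swap ..
    then show "(\<lambda>n. L2_inner \<Omega> (x n) (hessian_matrix \<phi>)) \<longlonglongrightarrow> L2_inner \<Omega> w \<phi>"
      unfolding xn by (simp only:) (intro tendsto_intros limd limM Linf_L2(1)[OF T] \<phi>L)
  qed
  note dI = divDiv_eqI[OF \<Omega>(1) sym w eq]
  have AE: "AE t in lebesgue_on \<Omega>. d t = dD M t"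
    using dI(2) by eventually_elim (simp add: dDiv_op_def w_def)
  show ?thesis
  proof (rule that[OF dI(1) limM])
    fix p :: "real^'d \<Rightarrow> real" assume p: "p \<in> L2 \<Omega>"
    have "L2_inner \<Omega> d p = L2_inner \<Omega> (dD M) p"
      by (rule L2_inner_cong_AE[OF AE]) (use p d dD_L2[OF dI(1)] in auto)
    then show "(\<lambda>n. L2_inner \<Omega> (dD (x n)) p) \<longlonglongrightarrow> L2_inner \<Omega> (dD M) p"
      using limd[OF p] by simp
  qed
qed

lemma integration_by_parts_twice:
  assumes "\<phi> \<in> test_functions \<Omega>" "\<psi> \<in> test_functions \<Omega>"
  shows "L2_inner \<Omega> (partial k (partial l \<phi>)) \<psi> = L2_inner \<Omega> \<phi> (partial l (partial k \<psi>))"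
  using integration_by_parts[OF test_functions_partial[OF assms(1)] assms(2) \<Omega>_sets, of k l]
    integration_by_parts[OF assms(1) test_functions_partial[OF assms(2)] \<Omega>_sets, of l k]
  by (simp add: L2_inner_def)

text \<open>For a compactly supported smooth tensor the iterated divergence is classical and the
  trace functional vanishes on all of \<open>H2\<close>. Such tensors therefore lie in
  \<open>HN\<close> for every choice of boundary conditions and can be used to test equation
  (a).\<close>

lemma test_tensor:
  fixes E :: "real^'d^'d"
  assumes \<phi>: "\<phi> \<in> test_functions \<Omega>" and E: "transpose E = E"
  defines "N \<equiv> \<lambda>x. \<phi> x *\<^sub>R E" and "w \<equiv> \<lambda>x. E \<bullet> hessian_matrix \<phi> x"
  shows "N \<in> H" "w \<in> L2 \<Omega>" "AE x in lebesgue_on \<Omega>. divDiv \<Omega> N x = w x"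
    "\<And>v. v \<in> H2 \<Omega> \<Longrightarrow> tr_Ggrad \<Omega> v N = 0"
proof -
  note \<phi>L = test_functions_L2[OF \<phi> \<Omega>_sets]
  have Elk: "E $ l $ k = E $ k $ l" for k l using E by (metis transpose_def vec_lambda_beta)
  have N: "N \<in> L2 \<Omega>"
  proof (rule L2_on_bound[OF \<phi>L, of _ "norm E"])
    show "N \<in> borel_measurable (lebesgue_on \<Omega>)" unfolding N_def using L2_measurable[OF \<phi>L] by measurable
  qed (simp add: N_def mult.commute)
  then have s: "N \<in> L2_sym \<Omega>"
    using Elk by (auto simp: L2_sym_def sym_ae_def N_def transpose_def vec_eq_iff)
  have w_eq: "w = (\<lambda>x. \<Sum>k\<in>UNIV. \<Sum>l\<in>UNIV. E $ k $ l * partial l (partial k \<phi>) x)"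
    by (simp add: w_def hessian_matrix_def inner_vec_def)
  have pL: "partial l (partial k \<psi>) \<in> L2 \<Omega>" if "\<psi> \<in> test_functions \<Omega>" for k l \<psi>
    using test_functions_L2[OF test_functions_partial[OF test_functions_partial[OF that]] \<Omega>_sets] .
  show w: "w \<in> L2 \<Omega>" unfolding w_eq by (intro L2_on_sum L2_on_mult pL \<phi>) auto
  have w_inner: "L2_inner \<Omega> w p = (\<Sum>k\<in>UNIV. \<Sum>l\<in>UNIV. E $ k $ l * L2_inner \<Omega> (partial l (partial k \<phi>)) p)"
    if p: "p \<in> L2 \<Omega>" for p
  proof -
    have "integrable (lebesgue_on \<Omega>) (\<lambda>x. partial l (partial k \<phi>) x * p x)" for k l
      by (intro integrable_mult_L2 pL \<phi> p)
    then show ?thesis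
      by (simp add: w_eq L2_inner_def sum_distrib_right mult.assoc)
  qed
  have N_inner: "L2_inner \<Omega> N P = (\<Sum>k\<in>UNIV. \<Sum>l\<in>UNIV. E $ k $ l * L2_inner \<Omega> \<phi> (\<lambda>x. P x $ k $ l))"
    if "P \<in> L2 \<Omega>" for P
    unfolding L2_inner_matrix[OF N that] by (simp add: N_def L2_inner_def mult.assoc mult.left_commute[of "\<phi> _"])
  have eq: "\<forall>\<psi>\<in>test_functions \<Omega>. L2_inner \<Omega> w \<psi> = L2_inner \<Omega> N (hessian_matrix \<psi>)"
  proof
    fix \<psi> assume \<psi>: "\<psi> \<in> test_functions \<Omega>"
    \<comment> \<open>Two integrations by parts reverse the order of differentiation; symmetry of
      second derivatives restores it.\<close>
    show "L2_inner \<Omega> w \<psi> = L2_inner \<Omega> N (hessian_matrix \<psi>)"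
      unfolding w_inner[OF test_functions_L2[OF \<psi> \<Omega>_sets]] N_inner[OF hessian_matrix_L2[OF \<psi> \<Omega>_sets]]
      integration_by_parts_twice[OF \<phi> \<psi>]
    by (simp add: hessian_matrix_def partial_commute[OF test_functions_smooth[OF \<psi>]])
  qed
  note dI = divDiv_eqI[OF \<Omega>(1) s w eq]
  show "N \<in> H" "AE x in lebesgue_on \<Omega>. divDiv \<Omega> N x = w x" by (rule dI)+
  fix v assume v: "v \<in> H2 \<Omega>"
  have "L2_inner \<Omega> (divDiv \<Omega> N) v = L2_inner \<Omega> w v"
    by (rule L2_inner_cong_AE[OF dI(2)]) (use H2_L2[OF v] w divDiv_represents(1)[OF dI(1) \<Omega>(1)] in auto)
  also have "\<dots> = L2_inner \<Omega> N (hessian \<Omega> v)"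
    unfolding w_inner[OF H2_L2[OF v]] N_inner[OF hessian_represents(1)[OF v]]
      L2_inner_commute[of \<Omega> \<phi>] hessian_represents(2)[OF v \<phi>] L2_inner_commute[of \<Omega> v] ..
  finally show "tr_Ggrad \<Omega> v N = 0" by (simp add: tr_Ggrad_def)
qed

end

section \<open>The mixed problem\<close>

locale mixed_setting = dDiv_setting +
  fixes HN :: "(real^'a \<Rightarrow> real^'a^'a) set" and HD :: "(real^'a \<Rightarrow> real) set"
    and f g :: "real^'a \<Rightarrow> real" and G :: "real^'a \<Rightarrow> real^'a^'a"
  assumes HD: "HD \<subseteq> H2 \<Omega>" and HN: "HN = {M \<in> H. \<forall>v\<in>HD. tr_dDiv \<Omega> M v = 0}"
    and f: "f \<in> L2 \<Omega>" and G: "G \<in> H" and g: "g \<in> H2 \<Omega>"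
begin

abbreviation "solution \<equiv> mixed_solution \<Omega> m q B T HN HD f G g"

definition "u_of M = (\<lambda>x. 1 / m * f x - B / m * dD M x)"

lemma HN_H: "N \<in> HN \<Longrightarrow> N \<in> H"
  by (simp add: HN)

lemma HN_lincomb:
  assumes "M \<in> HN" "N \<in> HN"
  shows "(\<lambda>x. M x + c *\<^sub>R N x) \<in> HN"
  using assms HD by (auto simp: HN H_lincomb tr_dDiv_eq tr_lincomb subset_iff)

text \<open>The functional of equation (a) after the datum \<open>G\<close> is moved to the right:
  the remaining unknown \<open>M - G\<close> then ranges over the linear space
  \<open>HN\<close>.\<close>

definition rhs where "rhs N = B / m * L2_inner \<Omega> f (dD N) - B * tr_Ggrad \<Omega> g N - ip G N"

definition "C0 = 1 / sqrt m * L2_norm \<Omega> f + nrmG g + nrm G"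

lemma rhs_lincomb:
  assumes "M \<in> H" "N \<in> H"
  shows "rhs (\<lambda>x. M x + c *\<^sub>R N x) = rhs M + c * rhs N"
  unfolding rhs_def L2_inner_commute[of \<Omega> f] dD_lincomb_inner[OF assms f] tr_lincomb[OF g assms]
    ip_sym[of G] ip_lincomb[OF assms G]
  by (simp add: algebra_simps)

lemma rhs_bound:
  assumes N: "N \<in> H"
  shows "\<bar>rhs N\<bar> \<le> C0 * nrm N"
proof -
  have "\<bar>rhs N\<bar> \<le> \<bar>B / m * L2_inner \<Omega> f (dD N)\<bar> + \<bar>B * tr_Ggrad \<Omega> g N\<bar> + \<bar>ip G N\<bar>"
    unfolding rhs_def by linarith
  also have "\<dots> = B / m * \<bar>L2_inner \<Omega> f (dD N)\<bar> + B * \<bar>tr_Ggrad \<Omega> g N\<bar> + \<bar>ip G N\<bar>"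
    using B m by (simp add: abs_mult)
  also have "\<dots> \<le> 1 / sqrt m * L2_norm \<Omega> f * nrm N + nrmG g * nrm N + nrm G * nrm N"
    by (intro add_mono f_bound[OF f N] tr_bound[OF g N] ip_Cauchy_Schwarz[OF G N])
  finally show ?thesis by (simp add: C0_def distrib_right)
qed

lemma solution_diff_HN:
  assumes "solution M"
  shows "(\<lambda>x. M x - G x) \<in> HN"
proof -
  have M: "M \<in> H" "\<forall>w\<in>HD. tr_dDiv \<Omega> M w = tr_dDiv \<Omega> G w"
    using assms by (auto simp: mixed_solution_def)
  have "tr_dDiv \<Omega> (\<lambda>x. M x - G x) w = 0" if "w \<in> HD" for w
    using tr_lincomb[of w M G "-1"] M G HD that by (auto simp: tr_dDiv_eq)
  then show ?thesis using H_diff(1)[OF M(1) G] by (simp add: HN)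
qed

lemma solution_exists: "\<exists>M. solution M"
proof -
  \<comment> \<open>The zero tensor is obtained as \<open>G - G\<close>, so that the linearity
    lemmas apply; it shows that \<open>HN\<close> is nonempty.\<close>
  have zero: "(\<lambda>x. 0 *\<^sub>R G x) \<in> HN"
  proof -
    have H0: "(\<lambda>x. G x + (-1) *\<^sub>R G x) \<in> H" by (rule H_lincomb[OF G G])
    have "tr_dDiv \<Omega> (\<lambda>x. G x + (-1) *\<^sub>R G x) v = 0" if "v \<in> HD" for v
    proof -
      have "v \<in> H2 \<Omega>" using that HD by blast
      from tr_lincomb[OF this G G, of "-1"] show ?thesis by (simp add: tr_dDiv_eq)
    qed
    then have "(\<lambda>x. G x + (-1) *\<^sub>R G x) \<in> HN" using H0 by (simp add: HN)
    then show ?thesis by simp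
  qed
  obtain x where x: "\<And>n::nat. x n \<in> HN"
    "\<And>e. e > 0 \<Longrightarrow> \<exists>N. \<forall>i\<ge>N. \<forall>j\<ge>N. ip (\<lambda>t. x i t - x j t) (\<lambda>t. x i t - x j t) < e"
    "\<And>y. y \<in> HN \<Longrightarrow> (\<lambda>n. ip (x n) y) \<longlonglongrightarrow> rhs y"
  proof (rule semi_inner_minimizing_sequence[of HN ip rhs C0])
    show "HN \<noteq> {}" using zero by blast
    show "(\<lambda>t. M t + c *\<^sub>R N t) \<in> HN" if "M \<in> HN" "N \<in> HN" for M N c
      by (rule HN_lincomb[OF that])
    show "ip (\<lambda>t. M t + c *\<^sub>R N t) P = ip M P + c * ip N P" if "M \<in> HN" "N \<in> HN" "P \<in> HN" for M N P c
      by (rule ip_lincomb[OF that[THEN HN_H]])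
    show "ip M N = ip N M" for M N by (rule ip_sym)
    show "0 \<le> ip M M" for M by (rule ip_nonneg)
    show "rhs (\<lambda>t. M t + c *\<^sub>R N t) = rhs M + c * rhs N" if "M \<in> HN" "N \<in> HN" for M N c
      by (rule rhs_lincomb[OF that[THEN HN_H]])
    show "\<bar>rhs M\<bar> \<le> C0 * sqrt (ip M M)" if "M \<in> HN" for M
      using rhs_bound[OF HN_H[OF that]] by (simp add: norm_dDiv_def)
  qed blast
  obtain M0 where M0: "M0 \<in> H" "\<And>P. P \<in> L2 \<Omega> \<Longrightarrow> (\<lambda>n. L2_inner \<Omega> (x n) P) \<longlonglongrightarrow> L2_inner \<Omega> M0 P"
    "\<And>p. p \<in> L2 \<Omega> \<Longrightarrow> (\<lambda>n. L2_inner \<Omega> (dD (x n)) p) \<longlonglongrightarrow> L2_inner \<Omega> (dD M0) p"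
  proof (rule H_complete[of x])
    show "x n \<in> H" for n by (rule HN_H[OF x(1)])
    show "\<exists>N. \<forall>i\<ge>N. \<forall>j\<ge>N. ip (\<lambda>t. x i t - x j t) (\<lambda>t. x i t - x j t) < e" if "e > 0" for e
      by (rule x(2)[OF that])
  qed blast
  \<comment> \<open>\<open>HN\<close> is closed: by \<open>tr_eq\<close> each trace functional is a
    combination of inner products that converge along the sequence.\<close>
  have tr0: "tr_Ggrad \<Omega> v M0 = 0" if v: "v \<in> HD" for v
  proof -
    have v2: "v \<in> H2 \<Omega>" using v HD by blast
    have "(\<lambda>n. tr_Ggrad \<Omega> v (x n)) \<longlonglongrightarrow> tr_Ggrad \<Omega> v M0"
      unfolding tr_eq[OF v2 HN_H[OF x(1)]] tr_eq[OF v2 M0(1)]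
      by (intro tendsto_diff M0 H2_L2 Gg_L2 v2)
    moreover have "tr_Ggrad \<Omega> v (x n) = 0" for n
      using x(1)[of n] v by (simp add: HN tr_dDiv_eq)
    ultimately show ?thesis by (simp add: LIMSEQ_const_iff)
  qed
  have ipM0: "ip M0 N = rhs N" if N: "N \<in> HN" for N
  proof (rule LIMSEQ_unique[OF _ x(3)[OF N]])
    show "(\<lambda>n. ip (x n) N) \<longlonglongrightarrow> ip M0 N"
      unfolding inner_dDiv_def by (intro tendsto_intros M0 H_L2 dD_L2 HN_H N)
  qed
  let ?M = "\<lambda>x. G x + 1 *\<^sub>R M0 x"
  have "?M \<in> H" by (rule H_lincomb[OF G M0(1)])
  moreover have "ip ?M N = B / m * L2_inner \<Omega> f (dD N) - B * tr_Ggrad \<Omega> g N" if N: "N \<in> HN" for N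
    unfolding ip_lincomb[OF G M0(1) HN_H[OF N]] ipM0[OF N] by (simp add: rhs_def)
  moreover have "tr_dDiv \<Omega> ?M w = tr_dDiv \<Omega> G w" if "w \<in> HD" for w
    using tr_lincomb[OF _ G M0(1), of w 1] tr0[OF that] that HD by (auto simp: tr_dDiv_eq)
  ultimately show ?thesis unfolding mixed_solution_def by blast
qed

lemma solution_H: "solution M \<Longrightarrow> M \<in> H"
  by (simp add: mixed_solution_def)

lemma solution_ip: "solution M \<Longrightarrow> N \<in> HN \<Longrightarrow> ip M N = B / m * L2_inner \<Omega> f (dD N) - B * tr_Ggrad \<Omega> g N"
  by (simp add: mixed_solution_def)

lemma solution_unique:
  assumes "solution M" "solution M'"
  shows "AE x in lebesgue_on \<Omega>. M x = M' x"
proof -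
  note M = assms[THEN solution_H]
  let ?D = "\<lambda>x. M x + (-1) *\<^sub>R M' x"
  \<comment> \<open>\<open>M - M'\<close> is the difference of \<open>M - G\<close> and
    \<open>M' - G\<close>, both in \<open>HN\<close>.\<close>
  have D: "?D \<in> HN"
    using HN_lincomb[OF assms[THEN solution_diff_HN], of "-1"] by simp
  then have "ip ?D ?D = 0"
    unfolding ip_lincomb[OF M HN_H[OF D]] solution_ip[OF assms(1) D] solution_ip[OF assms(2) D]
    by (simp only: mult_minus1 right_minus)
  then have "nrm ?D = 0" by (simp add: norm_dDiv_def)
  then have "sqrt B * L2_norm \<Omega> ?D \<le> 0" using L2_norm_le_nrm[of ?D] by simp
  then have "L2_norm \<Omega> ?D = 0"
    using B L2_norm_nonneg[of \<Omega> ?D] by (simp add: mult_le_0_iff)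
  moreover have "?D \<in> L2 \<Omega>" by (intro L2_on_lincomb H_L2 M)
  ultimately have "AE x in lebesgue_on \<Omega>. ?D x = 0" by (intro L2_norm_zero_imp_AE)
  then show ?thesis by eventually_elim simp
qed

section \<open>A solution of the mixed problem and the associated minimizer\<close>

context
  fixes M
  assumes M: "solution M"
begin

abbreviation "u \<equiv> u_of M"

text \<open>Testing with \<open>M - G\<close> itself bounds its norm by \<open>C0\<close>. The norm
  of \<open>G\<close> counts twice: once inside \<open>C0\<close> and once in the triangle
  inequality for \<open>M = G + (M - G)\<close>.\<close>

lemma solution_bound: "nrm M \<le> 1 / sqrt m * L2_norm \<Omega> f + 2 * nrm G + nrmG g"
proof -
  let ?D = "\<lambda>x. M x - G x"
  have D: "?D \<in> HN" by (rule solution_diff_HN[OF M])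
  have "ip ?D ?D = rhs ?D"
    using ip_lincomb[OF solution_H[OF M] G HN_H[OF D], of "-1"] solution_ip[OF M D] by (simp add: rhs_def)
  then have "nrm ?D * nrm ?D \<le> C0 * nrm ?D"
    using rhs_bound[OF HN_H[OF D]] nrm_sq[of ?D] by (simp add: power2_eq_square)
  moreover have "0 \<le> C0"
    unfolding C0_def nrmG_eq using m by (intro add_nonneg_nonneg nrm_nonneg mult_nonneg_nonneg L2_norm_nonneg) simp_all
  ultimately have "nrm ?D \<le> C0"
    using nrm_nonneg[of ?D] by (cases "nrm ?D = 0") auto
  moreover have "nrm M \<le> nrm G + nrm ?D"
    using nrm_triangle[OF G HN_H[OF D]] by simp
  ultimately show ?thesis by (simp add: C0_def)
qed

lemma u_L2: "u \<in> L2 \<Omega>"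
  unfolding u_of_def by (intro L2_on_diff L2_on_mult f dD_L2 solution_H M)

lemma u_inner:
  assumes "p \<in> L2 \<Omega>"
  shows "L2_inner \<Omega> u p = 1 / m * L2_inner \<Omega> f p - B / m * L2_inner \<Omega> (dD M) p"
proof -
  have "L2_inner \<Omega> (\<lambda>x. (1 / m) *\<^sub>R f x + (- B / m) *\<^sub>R dD M x) p
      = L2_inner \<Omega> (\<lambda>x. (1 / m) *\<^sub>R f x) p + (- B / m) * L2_inner \<Omega> (dD M) p"
    by (intro L2_inner_lincomb_left L2_on_scaleR f dD_L2 solution_H M assms)
  moreover have "L2_inner \<Omega> (\<lambda>x. (1 / m) *\<^sub>R f x) p = 1 / m * L2_inner \<Omega> f p"
    using L2_inner_lincomb_left[OF L2_on_zero f assms, of "1 / m"] by (simp add: L2_inner_def)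
  moreover have "u = (\<lambda>x. (1 / m) *\<^sub>R f x + (- B / m) *\<^sub>R dD M x)"
    by (simp add: u_of_def fun_eq_iff)
  ultimately show ?thesis by simp
qed

text \<open>Equation (a) divided by \<open>B\<close>: the terms with \<open>f\<close> and
  \<open>dD M\<close> combine into the inner product of \<open>dD N\<close> with \<open>u\<close>,
  which is the reason for the definition of \<open>u\<close>.\<close>

lemma u_dD:
  assumes N: "N \<in> HN"
  shows "L2_inner \<Omega> (dD N) u = L2_inner \<Omega> M N + tr_Ggrad \<Omega> g N"
proof -
  have "B * L2_inner \<Omega> u (dD N) = B / m * L2_inner \<Omega> f (dD N) - B\<^sup>2 / m * L2_inner \<Omega> (dD M) (dD N)"
    unfolding u_inner[OF dD_L2[OF HN_H[OF N]]] by (simp add: algebra_simps power2_eq_square)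
  also have "\<dots> = B * (L2_inner \<Omega> M N + tr_Ggrad \<Omega> g N)"
    using solution_ip[OF M N] by (simp add: inner_dDiv_def algebra_simps)
  finally show ?thesis using B by (simp add: L2_inner_commute)
qed

text \<open>Testing with \<open>\<phi> E\<close> for symmetric constant \<open>E\<close>, whose trace functional vanishes, identifies the weak Hessian of
  \<open>u\<close>.\<close>

lemma u_hessian:
  "u \<in> H2 \<Omega>" "AE x in lebesgue_on \<Omega>. M x = Gg u x"
proof -
  note M_L2 = H_L2[OF solution_H[OF M]]
  \<comment> \<open>The candidate for the weak Hessian, read off from
    \<open>M = \<nabla>^2 u + q^2 u T\<close>.\<close>
  define P where "P x = M x + (- q\<^sup>2) *\<^sub>R (u x *\<^sub>R T x)" for x
  have P: "P \<in> L2 \<Omega>" unfolding P_def[abs_def]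
    by (intro L2_on_lincomb M_L2 Linf_L2(1)[OF T] u_L2)
  have "AE x in lebesgue_on \<Omega>. transpose (M x) = M x" "AE x in lebesgue_on \<Omega>. transpose (T x) = T x"
    using solution_H[OF M] T by (auto simp: H_dDiv_def L2_sym_def sym_ae_def Linf_sym_def)
  then have P_sym: "AE x in lebesgue_on \<Omega>. transpose (P x) = P x"
    by eventually_elim (auto simp: P_def transpose_def vec_eq_iff)
  have eq: "\<forall>\<phi>\<in>test_functions \<Omega>. L2_inner \<Omega> (\<lambda>x. P x $ i $ j) \<phi> = L2_inner \<Omega> u (partial j (partial i \<phi>))" for i j
  proof
    fix \<phi> assume \<phi>: "\<phi> \<in> test_functions \<Omega>"
    note \<phi>L = test_functions_L2[OF \<phi> \<Omega>_sets]
    \<comment> \<open>The symmetrised matrix unit, whose Frobenius product with \<open>Q\<close> is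
      \<open>Q $ i $ j + Q $ j $ i\<close>. For \<open>i = j\<close> the two summands add up to 2,
      so no separate case arises.\<close>
    define E :: "real^'a^'a" where "E = (\<chi> k l. (if k = i then if l = j then 1 else 0 else 0) + (if k = j then if l = i then 1 else 0 else 0))"
    have E: "transpose E = E" by (auto simp: E_def transpose_def vec_eq_iff)
    have "(\<Sum>l\<in>UNIV. if c then h l else 0) = (if c then sum h UNIV else 0)" for c and h :: "'a \<Rightarrow> real"
      by simp
    then have E_inner: "E \<bullet> Q = Q $ i $ j + Q $ j $ i" for Q
      by (simp add: E_def inner_vec_def distrib_right sum.distrib if_distrib[of "\<lambda>x. x * _"] cong: if_cong)
    note tt = test_tensor[OF \<phi> E]
    let ?N = "\<lambda>x. \<phi> x *\<^sub>R E"
    have N: "?N \<in> HN" using tt(1,4) HD by (auto simp: HN tr_dDiv_eq)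
    have TN: "(\<lambda>x. T x \<bullet> ?N x) \<in> L2 \<Omega>" by (rule Linf_L2(2)[OF T H_L2[OF tt(1)]])
    \<comment> \<open>The datum \<open>g\<close> drops out because the trace functional of a test
      tensor vanishes.\<close>
    have "L2_inner \<Omega> (dD ?N) u = L2_inner \<Omega> M ?N"
      using u_dD[OF N] tt(4)[OF g] by simp
    also have "L2_inner \<Omega> (dD ?N) u = L2_inner \<Omega> (\<lambda>x. E \<bullet> hessian_matrix \<phi> x + q\<^sup>2 *\<^sub>R (T x \<bullet> ?N x)) u"
    proof (rule L2_inner_cong_AE[OF _ AE_I2[OF refl] dD_L2[OF tt(1)] _ u_L2 u_L2])
      show "(\<lambda>x. E \<bullet> hessian_matrix \<phi> x + q\<^sup>2 *\<^sub>R (T x \<bullet> ?N x)) \<in> L2 \<Omega>"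
        by (intro L2_on_lincomb tt TN)
      show "AE x in lebesgue_on \<Omega>. dD ?N x = E \<bullet> hessian_matrix \<phi> x + q\<^sup>2 *\<^sub>R (T x \<bullet> ?N x)"
        using tt(3) by eventually_elim (simp add: dDiv_op_def)
    qed
    also have "\<dots> = L2_inner \<Omega> (\<lambda>x. E \<bullet> hessian_matrix \<phi> x) u + q\<^sup>2 * L2_inner \<Omega> (\<lambda>x. T x \<bullet> ?N x) u"
      by (rule L2_inner_lincomb_left[OF tt(2) TN u_L2])
    also have "L2_inner \<Omega> (\<lambda>x. T x \<bullet> ?N x) u = L2_inner \<Omega> (\<lambda>x. u x *\<^sub>R T x) ?N"
      by (simp add: L2_inner_def mult_ac)
    finally have "L2_inner \<Omega> (\<lambda>x. E \<bullet> hessian_matrix \<phi> x) u = L2_inner \<Omega> P ?N"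
      unfolding P_def[abs_def] L2_inner_lincomb_left[OF M_L2 Linf_L2(1)[OF T u_L2] H_L2[OF tt(1)]] by simp
    also have "L2_inner \<Omega> P ?N = L2_inner \<Omega> (\<lambda>x. 2 * P x $ i $ j) \<phi>"
    proof -
      have "L2_inner \<Omega> P ?N = L2_inner \<Omega> (\<lambda>x. P x $ i $ j + P x $ j $ i) \<phi>"
        by (simp add: L2_inner_def inner_commute[of _ E] E_inner mult.commute)
      also have "\<dots> = L2_inner \<Omega> (\<lambda>x. 2 * P x $ i $ j) \<phi>"
      \<comment> \<open>Testing with symmetric tensors only determines the symmetric part of
        \<open>P\<close>; that \<open>P\<close> is symmetric almost everywhere recovers the single
        entry, up to the factor 2 present on both sides.\<close>
      proof (rule L2_inner_cong_AE[OF _ AE_I2[OF refl] _ _ \<phi>L \<phi>L])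
        show "AE x in lebesgue_on \<Omega>. P x $ i $ j + P x $ j $ i = 2 * P x $ i $ j"
          using P_sym
        proof eventually_elim
          case (elim x)
          then have "P x $ j $ i = P x $ i $ j" by (metis transpose_def vec_lambda_beta)
          then show ?case by simp
        qed
      qed (intro L2_on_add L2_on_mult L2_on_vec_nth P)+
      finally show ?thesis .
    qed
    also have "(\<lambda>x. E \<bullet> hessian_matrix \<phi> x) = (\<lambda>x. 2 * partial j (partial i \<phi>) x)"
      by (simp add: E_inner hessian_matrix_def partial_commute[OF test_functions_smooth[OF \<phi>], of i j])
    finally have "L2_inner \<Omega> (\<lambda>x. 2 * partial j (partial i \<phi>) x) u = L2_inner \<Omega> (\<lambda>x. 2 * P x $ i $ j) \<phi>" .
    moreover have "L2_inner \<Omega> (\<lambda>x. 2 * p x) r = 2 * L2_inner \<Omega> p r" for p r :: "real^'a \<Rightarrow> real"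
      by (simp add: L2_inner_def mult.assoc)
    ultimately show "L2_inner \<Omega> (\<lambda>x. P x $ i $ j) \<phi> = L2_inner \<Omega> u (partial j (partial i \<phi>))"
      by (simp add: L2_inner_commute[of \<Omega> u])
  qed
  note hI = hessian_eqI[OF \<Omega> u_L2 P eq]
  show "u \<in> H2 \<Omega>" by (rule hI(1))
  show "AE x in lebesgue_on \<Omega>. M x = Gg u x"
    using hI(2) by eventually_elim (simp add: Ggrad_op_def P_def)
qed

lemma Gg_u_inner:
  assumes "P \<in> L2 \<Omega>"
  shows "L2_inner \<Omega> (Gg u) P = L2_inner \<Omega> M P" "L2_inner \<Omega> P (Gg u) = L2_inner \<Omega> P M"
proof -
  have eq: "AE x in lebesgue_on \<Omega>. Gg u x = M x" using u_hessian(2) by eventually_elim simp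
  show 1: "L2_inner \<Omega> (Gg u) P = L2_inner \<Omega> M P"
    by (rule L2_inner_cong_AE[OF eq AE_I2[OF refl] Gg_L2[OF u_hessian(1)] H_L2[OF solution_H[OF M]] assms assms])
  then show "L2_inner \<Omega> P (Gg u) = L2_inner \<Omega> P M" by (simp add: L2_inner_commute[of \<Omega> P])
qed

lemma u_tr:
  assumes N: "N \<in> HN"
  shows "tr_Ggrad \<Omega> u N = tr_Ggrad \<Omega> g N"
  unfolding tr_eq[OF u_hessian(1) HN_H[OF N]] u_dD[OF N] Gg_u_inner(2)[OF H_L2[OF HN_H[OF N]]]
  by (simp add: L2_inner_commute)

lemma u_admissible: "u \<in> admissible \<Omega> HN g"
  using u_hessian(1) u_tr by (simp add: admissible_def)

lemma energy_eq:
  assumes "v \<in> H2 \<Omega>"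
  shows "energy \<Omega> m q B T f G v = B / 2 * L2_inner \<Omega> (Gg v) (Gg v) + m / 2 * L2_inner \<Omega> v v
    - L2_inner \<Omega> f v + B * tr_Ggrad \<Omega> v G"
  by (simp add: energy_def L2_inner_def tr_dDiv_eq power2_norm_eq_inner power2_eq_square[of "v _"])

text \<open>\<open>v\<close> and \<open>u\<close> have the same trace pairing with
  \<open>M - G\<close>, so in the boundary term for \<open>v - u\<close> the datum \<open>G\<close>
  may be replaced by \<open>M\<close>, for which \<open>tr_eq\<close> is explicit. With
  \<open>m u = f - B dD M\<close> and \<open>Gg u = M\<close> all first-order terms cancel.\<close>

lemma energy_expansion:
  assumes v: "v \<in> admissible \<Omega> HN g"
  shows "energy \<Omega> m q B T f G v = energy \<Omega> m q B T f G u
    + B / 2 * (L2_norm \<Omega> (\<lambda>x. Gg v x - Gg u x))\<^sup>2 + m / 2 * (L2_norm \<Omega> (\<lambda>x. v x - u x))\<^sup>2"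
proof -
  have v2: "v \<in> H2 \<Omega>" using v by (simp add: admissible_def)
  note L = Gg_L2[OF v2] Gg_L2[OF u_hessian(1)] H2_L2[OF v2] u_L2 H_L2[OF solution_H[OF M]]
  have sq: "(L2_norm \<Omega> (\<lambda>x. a x - b x))\<^sup>2 = L2_inner \<Omega> a a - 2 * L2_inner \<Omega> b a + L2_inner \<Omega> b b"
    if "a \<in> L2 \<Omega>" "b \<in> L2 \<Omega>" for a b :: "real^'a \<Rightarrow> 'b::euclidean_space"
    unfolding L2_norm_sq L2_inner_diff_left[OF that L2_on_diff[OF that]]
      L2_inner_diff_right[OF that that(1)] L2_inner_diff_right[OF that that(2)] L2_inner_commute[of \<Omega> a b] by simp
  have tr: "tr_Ggrad \<Omega> w (\<lambda>x. M x - G x) = tr_Ggrad \<Omega> g (\<lambda>x. M x - G x)" if "w \<in> admissible \<Omega> HN g" for w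
    using that solution_diff_HN[OF M] by (simp add: admissible_def)
  have tr_diff: "tr_Ggrad \<Omega> w M - tr_Ggrad \<Omega> w G = tr_Ggrad \<Omega> w (\<lambda>x. M x - G x)" if "w \<in> H2 \<Omega>" for w
    using tr_lincomb[OF that solution_H[OF M] G, of "-1"] by simp
  have trM: "tr_Ggrad \<Omega> v G - tr_Ggrad \<Omega> u G = tr_Ggrad \<Omega> v M - tr_Ggrad \<Omega> u M"
    using tr_diff[OF v2] tr_diff[OF u_hessian(1)] tr[OF v] tr[OF u_admissible] by linarith
  have mu: "m * L2_inner \<Omega> u p = L2_inner \<Omega> f p - B * L2_inner \<Omega> (dD M) p" if "p \<in> L2 \<Omega>" for p
    unfolding u_inner[OF that] using m by (simp add: field_simps)
  have trv: "tr_Ggrad \<Omega> v M = L2_inner \<Omega> (dD M) v - L2_inner \<Omega> M (Gg v)"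
    by (rule tr_eq[OF v2 solution_H[OF M]])
  have tru: "tr_Ggrad \<Omega> u M = L2_inner \<Omega> (dD M) u - L2_inner \<Omega> M M"
    unfolding tr_eq[OF u_hessian(1) solution_H[OF M]] Gg_u_inner(2)[OF L(5)] ..
  have Guu: "L2_inner \<Omega> (Gg u) (Gg u) = L2_inner \<Omega> M M" "L2_inner \<Omega> (Gg u) (Gg v) = L2_inner \<Omega> M (Gg v)"
    using Gg_u_inner[OF L(2)] Gg_u_inner[OF L(5)] Gg_u_inner[OF L(1)] by simp_all
  have "B * (tr_Ggrad \<Omega> v G - tr_Ggrad \<Omega> u G) = B * L2_inner \<Omega> (dD M) v - B * L2_inner \<Omega> M (Gg v)
      - B * L2_inner \<Omega> (dD M) u + B * L2_inner \<Omega> M M"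
    unfolding trM trv tru by (simp add: algebra_simps)
  then show ?thesis
    unfolding energy_eq[OF v2] energy_eq[OF u_hessian(1)] sq[OF L(1,2)] sq[OF L(3,4)] Guu
    using mu[OF L(3)] mu[OF L(4)] by (simp add: algebra_simps)
qed

lemma u_minimizes:
  "is_arg_min (energy \<Omega> m q B T f G) (\<lambda>v. v \<in> admissible \<Omega> HN g) u"
proof -
  have "energy \<Omega> m q B T f G u \<le> energy \<Omega> m q B T f G v" if "v \<in> admissible \<Omega> HN g" for v
    using energy_expansion[OF that] m B by simp
  then show ?thesis using u_admissible by (auto simp: is_arg_min_def not_less)
qed

text \<open>The mass term of the expansion alone decides: it is nonnegative, cannot be positive at
  another minimizer, and \<open>m > 0\<close>.\<close>

lemma minimizer_unique:
  assumes "is_arg_min (energy \<Omega> m q B T f G) (\<lambda>v. v \<in> admissible \<Omega> HN g) v"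
  shows "AE x in lebesgue_on \<Omega>. v x = u x"
proof -
  have v: "v \<in> admissible \<Omega> HN g" "energy \<Omega> m q B T f G v \<le> energy \<Omega> m q B T f G u"
    using assms u_admissible by (auto simp: is_arg_min_def not_less)
  have "m / 2 * (L2_norm \<Omega> (\<lambda>x. v x - u x))\<^sup>2 \<le> 0"
  proof -
    have "0 \<le> B / 2 * (L2_norm \<Omega> (\<lambda>x. Gg v x - Gg u x))\<^sup>2" using B by simp
    then show ?thesis using energy_expansion[OF v(1)] v(2) by linarith
  qed
  then have "L2_norm \<Omega> (\<lambda>x. v x - u x) = 0" using m by (simp add: mult_le_0_iff)
  moreover have "(\<lambda>x. v x - u x) \<in> L2 \<Omega>"
    using v(1) by (intro L2_on_diff H2_L2 u_L2) (simp add: admissible_def)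
  ultimately have "AE x in lebesgue_on \<Omega>. v x - u x = 0" by (intro L2_norm_zero_imp_AE)
  then show ?thesis by eventually_elim simp
qed

lemma u_norm_bound: "L2_norm \<Omega> u \<le> 1 / m * L2_norm \<Omega> f + B / m * L2_norm \<Omega> (dD M)"
proof -
  have "L2_norm \<Omega> (\<lambda>x. (1 / m) *\<^sub>R f x + (- B / m) *\<^sub>R dD M x)
      \<le> L2_norm \<Omega> (\<lambda>x. (1 / m) *\<^sub>R f x) + \<bar>- B / m\<bar> * L2_norm \<Omega> (dD M)"
    by (intro L2_norm_triangle L2_on_scaleR f dD_L2 solution_H M)
  moreover have "u = (\<lambda>x. (1 / m) *\<^sub>R f x + (- B / m) *\<^sub>R dD M x)"
    by (simp add: u_of_def fun_eq_iff)
  ultimately show ?thesis unfolding L2_norm_scaleR using m B by simp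
qed

lemma dD_norm_bound: "B / m * L2_norm \<Omega> (dD M) \<le> 1 / sqrt m * nrm M"
proof -
  have "B / m * L2_norm \<Omega> (dD M) = 1 / sqrt m * (B / sqrt m * L2_norm \<Omega> (dD M))"
    using m by (simp add: field_simps)
  also have "\<dots> \<le> 1 / sqrt m * nrm M"
    using m by (intro mult_left_mono dD_norm_le_nrm) simp
  finally show ?thesis .
qed

text \<open>The pair of weighted norms of \<open>u\<close> and \<open>M\<close> is dominated by
  \<open>(a, 0) + (b, c)\<close>, where the Euclidean length of \<open>(b, c)\<close> is exactly
  \<open>nrm M\<close>. The triangle inequality in the plane is sharper here than adding the
  components.\<close>

lemma u_Ggrad_bound: "nrmG u \<le> 1 / sqrt m * L2_norm \<Omega> f + nrm M"
proof -
  define a b c where "a = 1 / sqrt m * L2_norm \<Omega> f" and "b = B / sqrt m * L2_norm \<Omega> (dD M)" and "c = sqrt B * L2_norm \<Omega> M"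
  have nn: "0 \<le> a" "0 \<le> b" "0 \<le> c" using m B by (simp_all add: a_def b_def c_def L2_norm_nonneg)
  have "L2_norm \<Omega> (Gg u) = L2_norm \<Omega> M"
    using Gg_u_inner[OF Gg_L2[OF u_hessian(1)]] Gg_u_inner[OF H_L2[OF solution_H[OF M]]] by (simp add: L2_norm_def)
  moreover have "sqrt m * L2_norm \<Omega> u \<le> a + b"
  proof -
    have "sqrt m * L2_norm \<Omega> u \<le> sqrt m * (1 / m * L2_norm \<Omega> f + B / m * L2_norm \<Omega> (dD M))"
      using m by (intro mult_left_mono u_norm_bound) simp
    also have "\<dots> = (sqrt m / m) * L2_norm \<Omega> f + B * ((sqrt m / m) * L2_norm \<Omega> (dD M))"
      by (simp add: distrib_left)
    also have "\<dots> = a + b"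
      using sqrt_divide_self_eq[of m] m by (simp add: a_def b_def divide_inverse)
    finally show ?thesis .
  qed
  then have "(sqrt m * L2_norm \<Omega> u)\<^sup>2 \<le> (a + b)\<^sup>2"
    using m L2_norm_nonneg[of \<Omega> u] by (intro power_mono) auto
  ultimately have "nrmG u \<le> sqrt ((a + b)\<^sup>2 + (0 + c)\<^sup>2)"
    unfolding nrmG_eq c_def by (intro real_sqrt_le_mono) simp
  also have "\<dots> \<le> sqrt (a\<^sup>2 + 0\<^sup>2) + sqrt (b\<^sup>2 + c\<^sup>2)" by (rule real_sqrt_sum_squares_triangle_ineq)
  also have "\<dots> = a + nrm M" using nn by (simp add: nrm_eq b_def c_def add.commute)
  finally show ?thesis by (simp add: a_def)
qed

end

end

theorem theorem3:
  fixes \<Omega> \<Gamma>hc \<Gamma>ss \<Gamma>sc \<Gamma>f :: "(real^'d::finite) set"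
    and JD JN :: "(real^'d) set set"
    and m q B :: real
    and T G :: "real^'d \<Rightarrow> real^'d^'d"
    and f g :: "real^'d \<Rightarrow> real"
    and HN :: "(real^'d \<Rightarrow> real^'d^'d) set"
    and HD :: "(real^'d \<Rightarrow> real) set"
  assumes "CARD('d) \<in> {2, 3}"
    and "polyhedral_lipschitz_domain \<Omega>"
    and "boundary_decomposition \<Omega> \<Gamma>hc \<Gamma>ss \<Gamma>sc \<Gamma>f JD JN"
    and "m > 0" and "q > 0" and "0 < B" and "B \<le> 1"
    and "T \<in> Linf_sym \<Omega>"
    and "f \<in> L2 \<Omega>" and "G \<in> H_dDiv \<Omega>" and "g \<in> H2 \<Omega>"
    and HN: "HN = HN_dDiv \<Omega> \<Gamma>hc \<Gamma>ss \<Gamma>sc JD"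
    and HD: "HD = H2_D \<Omega> \<Gamma>hc \<Gamma>ss \<Gamma>sc JD"
  shows "(\<exists>M. mixed_solution \<Omega> m q B T HN HD f G g M) \<and>
    (\<forall>M M'. mixed_solution \<Omega> m q B T HN HD f G g M \<longrightarrow>
       mixed_solution \<Omega> m q B T HN HD f G g M' \<longrightarrow>
       (AE x in lebesgue_on \<Omega>. M x = M' x)) \<and>
    (\<forall>M. mixed_solution \<Omega> m q B T HN HD f G g M \<longrightarrow>
      norm_dDiv \<Omega> m q B T M
        \<le> 1 / sqrt m * L2_norm \<Omega> f + 2 * norm_dDiv \<Omega> m q B T G + norm_Ggrad \<Omega> m q B T g \<and>
      (let u = (\<lambda>x. 1 / m * f x - B / m * dDiv_op \<Omega> q T M x) in
        is_arg_min (energy \<Omega> m q B T f G) (\<lambda>v. v \<in> admissible \<Omega> HN g) u \<and>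
        (\<forall>v. is_arg_min (energy \<Omega> m q B T f G) (\<lambda>v. v \<in> admissible \<Omega> HN g) v \<longrightarrow>
          (AE x in lebesgue_on \<Omega>. v x = u x)) \<and>
        (AE x in lebesgue_on \<Omega>. M x = Ggrad_op \<Omega> q T u x) \<and>
        u \<in> H2 \<Omega> \<and>
        (\<forall>N\<in>HN. tr_Ggrad \<Omega> u N = tr_Ggrad \<Omega> g N) \<and>
        norm_Ggrad \<Omega> m q B T u
          \<le> 3 / sqrt m * L2_norm \<Omega> f + 3 * norm_dDiv \<Omega> m q B T G + 2 * norm_Ggrad \<Omega> m q B T g \<and>
        L2_norm \<Omega> u \<le> 1 / m * L2_norm \<Omega> f + B / m * L2_norm \<Omega> (dDiv_op \<Omega> q T M) \<and>
        1 / m * L2_norm \<Omega> f + B / m * L2_norm \<Omega> (dDiv_op \<Omega> q T M)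
          \<le> 1 / m * L2_norm \<Omega> f + 1 / sqrt m * norm_dDiv \<Omega> m q B T M))"
proof -
  interpret mixed_setting \<Omega> m q B T HN HD f g G
  proof
    show "open \<Omega>" "bounded \<Omega>" "lipschitz_boundary \<Omega>"
      using assms(2) by (auto simp: polyhedral_lipschitz_domain_def)
    show "HD \<subseteq> H2 \<Omega>" by (auto simp: HD H2_D_def)
    show "HN = {M \<in> H_dDiv \<Omega>. \<forall>v\<in>HD. tr_dDiv \<Omega> M v = 0}" by (simp add: HN HD HN_dDiv_def)
  qed (use assms in auto)
  have "nrmG (u_of M) \<le> 3 / sqrt m * L2_norm \<Omega> f + 3 * nrm G + 2 * nrmG g" if M: "solution M" for M
  proof -
    \<comment> \<open>Inserting the bound on \<open>M\<close> yields the factors 2, 2, 1; they are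
      rounded up to 3, 3, 2 using nonnegativity of the three norms.\<close>
    have "nrmG (u_of M) \<le> 2 * (1 / sqrt m * L2_norm \<Omega> f) + 2 * nrm G + nrmG g"
      using u_Ggrad_bound[OF M] solution_bound[OF M] by linarith
    moreover have "0 \<le> 1 / sqrt m * L2_norm \<Omega> f" using m L2_norm_nonneg[of \<Omega> f] by simp
    moreover have "0 \<le> nrmG g" by (simp add: nrmG_eq)
    ultimately have "nrmG (u_of M) \<le> 3 * (1 / sqrt m * L2_norm \<Omega> f) + 3 * nrm G + 2 * nrmG g"
      using nrm_nonneg[of G] by linarith
    then show ?thesis by simp
  qed
  then show ?thesis
    unfolding Let_def u_of_def[symmetric]
    using solution_exists solution_unique solution_bound u_minimizes minimizer_unique u_hessian u_tr
      u_norm_bound dD_norm_bound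
    by (intro conjI allI impI ballI add_left_mono) auto
qed

end
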